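(* Consider nearest-neighbour Bernoulli bond percolation on the square lattice $\mathbb{Z}^2$ with $p=p_c=1/2$. If there exists $\eta>0$ such that $\mathbb{P}_{p_c}(x\leftrightarrow y) \asymp \|x-y\|_2^{-\eta}$ for every $x \neq y\in \mathbb{Z}^2$ then, for each integer $k\geq 2$, \[\tau_{p_c}(x_1,\ldots,x_k) \asymp_k S(x_1,\ldots,x_k)^{-\eta/2}\] for every distinct $k$-tuple of points $x_1,\ldots,x_k \in \mathbb{Z}^2$.
   Context: In nearest-neighbour Bernoulli bond percolation on $\mathbb{Z}^2$ each edge of the square lattice is open independently with probability $p$; $\mathbb{P}_p$ denotes the law, clusters are connected components of the open subgraph, $\{x\leftrightarrow y\}$ is the event that $x$ and $y$ are in the same cluster, and $\tau_p(x_1,\ldots,x_k)=\mathbb{P}_p(x_1,\ldots,x_k\text{ all belong to the same cluster})$. The function $S$, from finite subsets of $\mathbb{R}^2$ with at least two elements to $(0,\infty)$, is defined recursively by $S(\{x,y\})=\|x-y\|_2^2$ and, for $|A|\ge3$, $S(A)=\min\sqrt{S(A_1\cup A_2)S(A_2\cup A_3)S(A_3\cup A_1)}$, where the minimum is over partitions of $A$ into three non-empty subsets $A_1,A_2,A_3$. We write $S(x_1,\ldots,x_k)=S(\{x_1,\ldots,x_k\})$ for distinct $x_1,\ldots,x_k$. The notation $\asymp$ means equality up to positive multiplicative constants that do not depend on the points; in $\asymp_k$ the constants may additionally depend on $k$ (but not on the points). *)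

theory Defs
  imports "HOL-Probability.Probability"
begin

section \<open>Bernoulli bond percolation on the square lattice\<close>

definition lattice_edges :: "(int \<times> int) set set" where
  "lattice_edges = {{x, y} | x y. \<bar>fst x - fst y\<bar> + \<bar>snd x - snd y\<bar> = 1}"

text \<open>A configuration maps each edge to \<^const>\<open>True\<close> (open) or \<^const>\<open>False\<close> (closed);
  its value outside \<open>lattice_edges\<close> is irrelevant.\<close>

definition percolation :: "real \<Rightarrow> ((int \<times> int) set \<Rightarrow> bool) measure" where
  "percolation p = PiM lattice_edges (\<lambda>_. measure_pmf (bernoulli_pmf p))"

definition open_adj :: "((int \<times> int) set \<Rightarrow> bool) \<Rightarrow> ((int \<times> int) \<times> (int \<times> int)) set" where
  "open_adj \<omega> = {(x, y). {x, y} \<in> lattice_edges \<and> \<omega> {x, y}}"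

definition cluster :: "((int \<times> int) set \<Rightarrow> bool) \<Rightarrow> int \<times> int \<Rightarrow> (int \<times> int) set" where
  "cluster \<omega> z = {y. (z, y) \<in> (open_adj \<omega>)\<^sup>*}"

definition same_cluster :: "((int \<times> int) set \<Rightarrow> bool) \<Rightarrow> (int \<times> int) set \<Rightarrow> bool" where
  "same_cluster \<omega> X \<longleftrightarrow> (\<exists>z. X \<subseteq> cluster \<omega> z)"

definition tau :: "real \<Rightarrow> (int \<times> int) list \<Rightarrow> real" where
  "tau p xs = \<P>(\<omega> in percolation p. same_cluster \<omega> (set xs))"

section \<open>The function \<open>S\<close>\<close>

text \<open>The norm and distance on \<^typ>\<open>real \<times> real\<close> are the Euclidean ones.\<close>

definition plane :: "int \<times> int \<Rightarrow> real \<times> real" where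
  "plane x = (of_int (fst x), of_int (snd x))"

definition tripartitions :: "'a set \<Rightarrow> ('a set \<times> 'a set \<times> 'a set) set" where
  "tripartitions A = {(A1, A2, A3). A1 \<noteq> {} \<and> A2 \<noteq> {} \<and> A3 \<noteq> {} \<and>
     A1 \<inter> A2 = {} \<and> A2 \<inter> A3 = {} \<and> A3 \<inter> A1 = {} \<and> A1 \<union> A2 \<union> A3 = A}"

text \<open>\<open>Sfun\<close> is the function \<open>S\<close> (renamed so as not to occupy a one-letter name). The value \<open>0\<close> is a dummy for infinite sets and sets with fewer than two elements,
  where \<open>S\<close> is undefined.\<close>

function Sfun :: "(real \<times> real) set \<Rightarrow> real" where
  "Sfun A =
    (if card A = 2 then (THE s. \<exists>x y. x \<noteq> y \<and> A = {x, y} \<and> s = (norm (x - y))\<^sup>2)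
     else if card A \<ge> 3 then
       Min ((\<lambda>(A1, A2, A3). sqrt (Sfun (A1 \<union> A2) * Sfun (A2 \<union> A3) * Sfun (A3 \<union> A1))) ` tripartitions A)
     else 0)"
  by auto
termination
proof (relation "Wellfounded.measure card", goal_cases)
  case 1
  then show ?case by simp
next
  case (2 A t A1 u A2 A3)
  then have "finite A" by (metis card.infinite not_numeral_le_zero)
  with 2 show ?case by (auto simp: tripartitions_def intro!: psubset_card_mono)
next
  case (3 A t A1 u A2 A3)
  then have "finite A" by (metis card.infinite not_numeral_le_zero)
  with 3 show ?case by (auto simp: tripartitions_def intro!: psubset_card_mono)
next
  case (4 A t A1 u A2 A3)
  then have "finite A" by (metis card.infinite not_numeral_le_zero)
  with 4 show ?case by (auto simp: tripartitions_def intro!: psubset_card_mono)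
qed

declare Sfun.simps [simp del]

lemma Sfun_pair:
  assumes "x \<noteq> y"
  shows "Sfun {x, y} = (norm (x - y))\<^sup>2"
proof -
  have "(THE s. \<exists>u v. u \<noteq> v \<and> {x, y} = {u, v} \<and> s = (norm (u - v))\<^sup>2) = (norm (x - y))\<^sup>2"
  proof (rule the_equality)
    show "\<exists>u v. u \<noteq> v \<and> {x, y} = {u, v} \<and> (norm (x - y))\<^sup>2 = (norm (u - v))\<^sup>2"
      using assms by blast
  next
    fix s assume "\<exists>u v. u \<noteq> v \<and> {x, y} = {u, v} \<and> s = (norm (u - v))\<^sup>2"
    then obtain u v where uv: "{x, y} = {u, v}" and s: "s = (norm (u - v))\<^sup>2" by blast
    from uv have "x = u \<and> y = v \<or> x = v \<and> y = u" unfolding doubleton_eq_iff .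
    with s show "s = (norm (x - y))\<^sup>2" by (metis norm_minus_commute)
  qed
  moreover have "card {x, y} = 2" using assms by simp
  ultimately show ?thesis by (subst Sfun.simps) (simp only: if_True simp_thms)
qed

lemma finite_tripartitions: "finite A \<Longrightarrow> finite (tripartitions A)"
  by (rule finite_subset[of _ "Pow A \<times> Pow A \<times> Pow A"]) (auto simp: tripartitions_def)

lemma tripartitions_nonempty:
  assumes "card A \<ge> 3"
  shows "tripartitions A \<noteq> {}"
proof -
  obtain B where B: "B \<subseteq> A" "card B = 3"
    using assms by (metis obtain_subset_with_card_n)
  then obtain x y z where "B = {x, y, z}" "x \<noteq> y" "y \<noteq> z" "x \<noteq> z"
    by (auto simp: card_3_iff)
  with B have "({x}, {y}, A - {x, y}) \<in> tripartitions A"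
    by (auto simp: tripartitions_def)
  then show ?thesis by blast
qed

section \<open>Equality up to constants\<close>

definition equal_up_to_consts :: "'a set \<Rightarrow> ('a \<Rightarrow> real) \<Rightarrow> ('a \<Rightarrow> real) \<Rightarrow> bool" where
  "equal_up_to_consts D f g \<longleftrightarrow> (\<exists>c>0. \<exists>C>0. \<forall>x\<in>D. c * g x \<le> f x \<and> f x \<le> C * g x)"

end

theory Submission
  imports Defs
begin

text \<open>
  Write \<open>\<tau>\<close> for the probability that a finite set is connected. First, the power law and the value 1/2 for
  crossing probabilities of squares (self-duality) give open circuits with probability bounded below at
  all scales, up to a bounded factor, by Tassion's version of the Russo-Seymour-Welsh argument: either crossings of a
  box have end points spread over a side, and then they can be glued to crossings of longer
  rectangles, or they end near a fixed point, and then they can be glued by a circuit of a much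
  smaller scale; the latter alternative cannot persist, because it contradicts the power law.

  Gluing with circuits and independence show that the one-arm probability at distance \<open>n\<close> is of order
  \<open>n powr (- \<eta> / 2)\<close>. Let \<open>a, b\<close> be a closest pair of \<open>X\<close>, at distance \<open>\<delta>\<close>. Then
  \<open>\<tau> X\<close> is at most a constant times \<open>\<delta> powr (- \<eta> / 2) * \<tau> (X - {b})\<close>, and likewise with \<open>a\<close>, so the partition
  \<open>{a}, {b}, X - {a, b}\<close> gives the upper bound by induction. For the lower bound choose an annulus around
  \<open>a\<close> without points of \<open>X\<close>, at a scale comparable to \<open>\<delta>\<close>. A circuit in it and an arm from \<open>b\<close> show that
  \<open>\<tau> X\<close> is at least a constant times \<open>\<delta> powr (- \<eta> / 2) * \<tau> (X - {b})\<close>, unless all points of \<open>X\<close> are inside, when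
  arms from all of them give \<open>(\<delta> ^ card X) powr (- \<eta> / 2)\<close>. This matches the inequalities
  \<open>\<delta> / 2 * S (X - {b}) \<le> S X\<close> and \<open>\<delta> ^ card X \<le> S X\<close>.
\<close>

section \<open>Events that depend on finitely many edges\<close>

text \<open>The exponent of an arm is half of \<open>\<eta>\<close> because a connection of two
  points costs two arms, which a circuit around the pair joins at bounded cost. The power law is
  therefore used twice: for the exponent, and to produce circuits at all scales in the first place.
  At \<open>p = 1/2\<close> the law on finitely many edges is uniform, so positive correlation,
  independence and the symmetry between open and closed edges become statements about cardinalities
  of families of sets. Planarity enters in two forms: paths that cross a rectangle in the two
  directions meet, by the Fashoda theorem for curves, and a crossing or a dual crossing always
  exists, by a discrete Stokes formula.\<close>

definition pr :: "(((int \<times> int) set \<Rightarrow> bool) \<Rightarrow> bool) \<Rightarrow> real" where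
  "pr P = \<P>(\<omega> in percolation (1/2). P \<omega>)"

definition determined :: "'a set \<Rightarrow> (('a \<Rightarrow> bool) \<Rightarrow> bool) \<Rightarrow> bool" where
  "determined E P \<longleftrightarrow> (\<forall>\<omega> \<omega>'. (\<forall>e\<in>E. \<omega> e = \<omega>' e) \<longrightarrow> P \<omega> = P \<omega>')"

definition finitary :: "(((int \<times> int) set \<Rightarrow> bool) \<Rightarrow> bool) \<Rightarrow> bool" where
  "finitary P \<longleftrightarrow> (\<exists>E. finite E \<and> E \<subseteq> lattice_edges \<and> determined E P)"

definition event :: "(((int \<times> int) set \<Rightarrow> bool) \<Rightarrow> bool) \<Rightarrow> bool" where
  "event P \<longleftrightarrow> {\<omega> \<in> space (percolation (1/2)). P \<omega>} \<in> sets (percolation (1/2))"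

lemma determinedD: "determined E P \<Longrightarrow> (\<And>e. e \<in> E \<Longrightarrow> \<omega> e = \<omega>' e) \<Longrightarrow> P \<omega> = P \<omega>'"
  unfolding determined_def by simp

lemma determined_mono: "determined E P \<Longrightarrow> E \<subseteq> F \<Longrightarrow> determined F P"
  unfolding determined_def by blast

lemma determined_conj:
  "determined E P \<Longrightarrow> determined F Q \<Longrightarrow> determined (E \<union> F) (\<lambda>\<omega>. P \<omega> \<and> Q \<omega>)"
  unfolding determined_def by (metis UnCI)

lemma determined_disj:
  "determined E P \<Longrightarrow> determined F Q \<Longrightarrow> determined (E \<union> F) (\<lambda>\<omega>. P \<omega> \<or> Q \<omega>)"
  unfolding determined_def by (metis UnCI)

lemma finitaryI: "finite E \<Longrightarrow> E \<subseteq> lattice_edges \<Longrightarrow> determined E P \<Longrightarrow> finitary P"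
  unfolding finitary_def by blast

lemma finitary_conj: "finitary P \<Longrightarrow> finitary Q \<Longrightarrow> finitary (\<lambda>\<omega>. P \<omega> \<and> Q \<omega>)"
  unfolding finitary_def by (metis determined_conj finite_UnI Un_least)

lemma finitary_disj: "finitary P \<Longrightarrow> finitary Q \<Longrightarrow> finitary (\<lambda>\<omega>. P \<omega> \<or> Q \<omega>)"
  unfolding finitary_def by (metis determined_disj finite_UnI Un_least)

interpretation edges: product_prob_space "\<lambda>_::(int \<times> int) set. measure_pmf (bernoulli_pmf (1/2))" lattice_edges
  by standard

interpretation percolation: prob_space "percolation (1/2)"
  unfolding percolation_def by (rule prob_space_PiM) (rule measure_pmf.prob_space_axioms)

lemma pr_le_1: "pr P \<le> 1" and pr_nonneg: "0 \<le> pr P"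
  unfolding pr_def by auto

lemma cylinder:
  assumes "finite E" "E \<subseteq> lattice_edges"
  shows "{\<omega> \<in> space (percolation (1/2)). \<forall>e\<in>E. \<omega> e = (e \<in> A)} \<in> sets (percolation (1/2))"
    and "measure (percolation (1/2)) {\<omega> \<in> space (percolation (1/2)). \<forall>e\<in>E. \<omega> e = (e \<in> A)} = 1 / 2 ^ card E"
proof -
  let ?M = "\<lambda>_::(int \<times> int) set. measure_pmf (bernoulli_pmf (1/2))"
  have eq: "{\<omega> \<in> space (percolation (1/2)). \<forall>e\<in>E. \<omega> e = (e \<in> A)} =
      prod_emb lattice_edges ?M E (Pi\<^sub>E E (\<lambda>e. {e \<in> A}))"
    using assms(2) unfolding percolation_def
    by (auto simp: prod_emb_def space_PiM PiE_iff extensional_def)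
  show "{\<omega> \<in> space (percolation (1/2)). \<forall>e\<in>E. \<omega> e = (e \<in> A)} \<in> sets (percolation (1/2))"
    unfolding eq unfolding percolation_def
    by (rule sets_PiM_I) (use assms in auto)
  have "measure (percolation (1/2)) {\<omega> \<in> space (percolation (1/2)). \<forall>e\<in>E. \<omega> e = (e \<in> A)} =
      (\<Prod>e\<in>E. measure (measure_pmf (bernoulli_pmf (1/2))) {e \<in> A})"
    unfolding eq unfolding percolation_def
    by (rule edges.measure_PiM_emb) (use assms in auto)
  also have "\<dots> = (\<Prod>e\<in>E. 1/2)"
    by (rule prod.cong) (auto simp: measure_pmf_single)
  finally show "measure (percolation (1/2)) {\<omega> \<in> space (percolation (1/2)). \<forall>e\<in>E. \<omega> e = (e \<in> A)} = 1 / 2 ^ card E"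
    by (simp add: power_divide)
qed

lemma determined_decompose:
  assumes "determined E P"
  shows "{\<omega> \<in> space M. P \<omega>} =
     (\<Union>A\<in>{A\<in>Pow E. P (\<lambda>e. e \<in> A)}. {\<omega> \<in> space M. \<forall>e\<in>E. \<omega> e = (e \<in> A)})"
proof (intro equalityI subsetI)
  fix \<omega> assume *: "\<omega> \<in> {\<omega> \<in> space M. P \<omega>}"
  have "P (\<lambda>e. e \<in> {e\<in>E. \<omega> e}) = P \<omega>"
    using assms unfolding determined_def by auto
  with * have "{e\<in>E. \<omega> e} \<in> {A\<in>Pow E. P (\<lambda>e. e \<in> A)}" by auto
  then show "\<omega> \<in> (\<Union>A\<in>{A\<in>Pow E. P (\<lambda>e. e \<in> A)}. {\<omega> \<in> space M. \<forall>e\<in>E. \<omega> e = (e \<in> A)})"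
    by (rule UN_I) (use * in simp)
next
  fix \<omega> assume "\<omega> \<in> (\<Union>A\<in>{A\<in>Pow E. P (\<lambda>e. e \<in> A)}. {\<omega> \<in> space M. \<forall>e\<in>E. \<omega> e = (e \<in> A)})"
  then obtain A where A: "A \<subseteq> E" "P (\<lambda>e. e \<in> A)" "\<omega> \<in> space M" "\<forall>e\<in>E. \<omega> e = (e \<in> A)"
    by blast
  then have "P \<omega> = P (\<lambda>e. e \<in> A)" by (intro determinedD[OF assms]) simp
  with A show "\<omega> \<in> {\<omega> \<in> space M. P \<omega>}" by blast
qed

lemma finitary_event: "finitary P \<Longrightarrow> event P"
  unfolding finitary_def event_def
  by (auto simp: determined_decompose intro!: sets.finite_UN cylinder)

text \<open>At \<open>p = 1/2\<close> every pattern on \<open>E\<close> has the same weight, so the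
  probability of a finitary event is a normalised cardinality. Correlation, independence and
  symmetry below are all proved by counting.\<close>

lemma pr_count:
  assumes "finite E" "E \<subseteq> lattice_edges" "determined E P"
  shows "pr P = card {A\<in>Pow E. P (\<lambda>e. e \<in> A)} / 2 ^ card E"
proof -
  let ?M = "percolation (1/2)"
  let ?C = "\<lambda>A. {\<omega> \<in> space ?M. \<forall>e\<in>E. \<omega> e = (e \<in> A)}"
  let ?I = "{A\<in>Pow E. P (\<lambda>e. e \<in> A)}"
  have "disjoint_family_on ?C ?I"
    unfolding disjoint_family_on_def
  proof (intro ballI impI)
    fix A B assume "A \<in> ?I" "B \<in> ?I" "A \<noteq> B"
    then obtain e where "e \<in> E" "e \<in> A \<longleftrightarrow> e \<notin> B" by blast
    then show "?C A \<inter> ?C B = {}" by auto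
  qed
  note disj = this
  have "pr P = measure ?M (\<Union>A\<in>?I. ?C A)"
    unfolding pr_def by (subst determined_decompose[OF assms(3)]) simp
  also have "\<dots> = (\<Sum>A\<in>?I. measure ?M (?C A))"
    by (rule percolation.finite_measure_finite_Union)
      (use assms disj in \<open>auto intro!: cylinder\<close>)
  also have "\<dots> = (\<Sum>A\<in>?I. 1 / 2 ^ card E)"
    by (rule sum.cong) (use assms in \<open>auto simp: cylinder\<close>)
  finally show ?thesis by simp
qed

lemma pr_mono: "event Q \<Longrightarrow> (\<And>\<omega>. P \<omega> \<Longrightarrow> Q \<omega>) \<Longrightarrow> pr P \<le> pr Q"
  unfolding pr_def event_def by (rule percolation.finite_measure_mono) auto

lemma pr_disj: "event P \<Longrightarrow> event Q \<Longrightarrow> pr (\<lambda>\<omega>. P \<omega> \<or> Q \<omega>) \<le> pr P + pr Q"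
proof -
  assume *: "event P" "event Q"
  have "{\<omega> \<in> space (percolation (1/2)). P \<omega> \<or> Q \<omega>} =
    {\<omega> \<in> space (percolation (1/2)). P \<omega>} \<union> {\<omega> \<in> space (percolation (1/2)). Q \<omega>}" by blast
  then show ?thesis using * unfolding pr_def event_def
    by (simp add: measure_Un_le)
qed

lemma pr_True: "pr (\<lambda>_. True) = 1"
  unfolding pr_def by (simp add: percolation.prob_space)

section \<open>Positive association of increasing events\<close>

text \<open>Induction on \<open>E\<close>, splitting each family by membership of the new element
  \<open>e\<close>. For an up-set the part with \<open>e\<close> is at least as large as the part
  without, and Chebyshev's inequality \<open>0 \<le> (u1 - u0) * (v1 - v0)\<close> combines the two
  induction hypotheses.\<close>

lemma Kleitman:
  assumes "finite E"
    and "\<And>A B. A \<subseteq> B \<Longrightarrow> U A \<Longrightarrow> U B" "\<And>A B. A \<subseteq> B \<Longrightarrow> V A \<Longrightarrow> V B"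
  shows "card {A\<in>Pow E. U A} * card {A\<in>Pow E. V A} \<le> 2 ^ card E * card {A\<in>Pow E. U A \<and> V A}"
  using assms
proof (induction E arbitrary: U V rule: finite_induct)
  case empty
  then show ?case by (cases "U {}"; cases "V {}") (simp_all cong: conj_cong)
next
  case (insert e E)
  have split: "card {A\<in>Pow (insert e E). W A} =
      card {A\<in>Pow E. W A} + card {A\<in>Pow E. W (insert e A)}" for W :: "'a set \<Rightarrow> bool"
  proof -
    have "{A\<in>Pow (insert e E). W A} = {A\<in>Pow E. W A} \<union> insert e ` {A\<in>Pow E. W (insert e A)}"
      by (auto simp: Pow_insert)
    also have "card \<dots> = card {A\<in>Pow E. W A} + card (insert e ` {A\<in>Pow E. W (insert e A)})"
      by (rule card_Un_disjoint) (use insert in auto)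
    also have "card (insert e ` {A\<in>Pow E. W (insert e A)}) = card {A\<in>Pow E. W (insert e A)}"
    proof (intro card_image inj_onI)
      fix A B assume "A \<in> {A\<in>Pow E. W (insert e A)}" "B \<in> {A\<in>Pow E. W (insert e A)}" "insert e A = insert e B"
      moreover from this have "e \<notin> A" "e \<notin> B" using insert.hyps(2) by auto
      ultimately show "A = B" by (simp add: insert_ident)
    qed
    finally show ?thesis .
  qed
  define u0 u1 v0 v1 w0 w1 where
    "u0 = int (card {A\<in>Pow E. U A})" "u1 = int (card {A\<in>Pow E. U (insert e A)})"
    "v0 = int (card {A\<in>Pow E. V A})" "v1 = int (card {A\<in>Pow E. V (insert e A)})"
    "w0 = int (card {A\<in>Pow E. U A \<and> V A})" "w1 = int (card {A\<in>Pow E. U (insert e A) \<and> V (insert e A)})"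
  note d = this
  have 0: "u0 * v0 \<le> 2 ^ card E * w0"
  proof -
    have "card {A\<in>Pow E. U A} * card {A\<in>Pow E. V A} \<le> 2 ^ card E * card {A\<in>Pow E. U A \<and> V A}"
      by (rule insert.IH) (use insert.prems in blast)+
    from of_nat_mono[OF this, where 'a=int] show ?thesis unfolding d by simp
  qed
  have mono: "U (insert e A) \<Longrightarrow> U (insert e B)" "V (insert e A) \<Longrightarrow> V (insert e B)"
    if "A \<subseteq> B" for A B
    using insert.prems[OF Set.insert_mono[OF that]] by simp_all
  have 1: "u1 * v1 \<le> 2 ^ card E * w1"
  proof -
    have "card {A\<in>Pow E. U (insert e A)} * card {A\<in>Pow E. V (insert e A)}
        \<le> 2 ^ card E * card {A\<in>Pow E. U (insert e A) \<and> V (insert e A)}"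
      by (rule insert.IH) (fact mono)+
    from of_nat_mono[OF this, where 'a=int] show ?thesis unfolding d by simp
  qed
  have "{A\<in>Pow E. U A} \<subseteq> {A\<in>Pow E. U (insert e A)}" "{A\<in>Pow E. V A} \<subseteq> {A\<in>Pow E. V (insert e A)}"
    using insert.prems[OF subset_insertI] by blast+
  then have "u0 \<le> u1" "v0 \<le> v1"
    unfolding d of_nat_le_iff using insert.hyps(1) by (simp_all add: card_mono)
  then have "0 \<le> (u1 - u0) * (v1 - v0)" by simp
  then have "(u0 + u1) * (v0 + v1) \<le> 2 * (u0 * v0 + u1 * v1)" by (simp add: algebra_simps)
  also have "\<dots> \<le> 2 * 2 ^ card E * (w0 + w1)" using 0 1 by (simp add: algebra_simps)
  finally have "(u0 + u1) * (v0 + v1) \<le> 2 ^ card (insert e E) * (w0 + w1)" using insert by simp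
  then have "int ((card {A\<in>Pow E. U A} + card {A\<in>Pow E. U (insert e A)}) *
        (card {A\<in>Pow E. V A} + card {A\<in>Pow E. V (insert e A)})) \<le>
      int (2 ^ card (insert e E) * (card {A\<in>Pow E. U A \<and> V A} +
        card {A\<in>Pow E. U (insert e A) \<and> V (insert e A)}))"
    unfolding d of_nat_mult of_nat_add of_nat_power of_nat_numeral .
  then show ?case unfolding split by (simp only: of_nat_le_iff)
qed

definition increasing :: "(('a \<Rightarrow> bool) \<Rightarrow> bool) \<Rightarrow> bool" where
  "increasing P \<longleftrightarrow> (\<forall>\<omega> \<omega>'. \<omega> \<le> \<omega>' \<longrightarrow> P \<omega> \<longrightarrow> P \<omega>')"

definition up_event :: "(((int \<times> int) set \<Rightarrow> bool) \<Rightarrow> bool) \<Rightarrow> bool" where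
  "up_event P \<longleftrightarrow> finitary P \<and> increasing P"

lemma up_event_conj: "up_event P \<Longrightarrow> up_event Q \<Longrightarrow> up_event (\<lambda>\<omega>. P \<omega> \<and> Q \<omega>)"
  using finitary_conj[of P Q] unfolding up_event_def increasing_def by simp

lemma up_event_event: "up_event P \<Longrightarrow> event P"
  unfolding up_event_def by (simp add: finitary_event)

lemma Harris:
  assumes "up_event P" "up_event Q"
  shows "pr P * pr Q \<le> pr (\<lambda>\<omega>. P \<omega> \<and> Q \<omega>)"
proof -
  obtain E1 E2 where E: "finite E1" "E1 \<subseteq> lattice_edges" "determined E1 P"
     "finite E2" "E2 \<subseteq> lattice_edges" "determined E2 Q"
    using assms unfolding up_event_def finitary_def by blast
  define E where "E = E1 \<union> E2"
  have fE: "finite E" "E \<subseteq> lattice_edges" and dP: "determined E P" and dQ: "determined E Q"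
    using E unfolding E_def by (auto intro: determined_mono)
  have dPQ: "determined E (\<lambda>\<omega>. P \<omega> \<and> Q \<omega>)" using determined_conj[OF dP dQ] by simp
  let ?c = "\<lambda>P. card {A\<in>Pow E. P (\<lambda>e. e \<in> A)}"
  have inc: "R (\<lambda>e. e \<in> A) \<Longrightarrow> R (\<lambda>e. e \<in> B)" if "increasing R" "A \<subseteq> B" for R and A B :: "(int\<times>int) set set"
    using that(1)[unfolded increasing_def, rule_format, of "\<lambda>e. e \<in> A" "\<lambda>e. e \<in> B"] that(2)
    by (auto simp: le_fun_def)
  have "?c P * ?c Q \<le> 2 ^ card E * ?c (\<lambda>\<omega>. P \<omega> \<and> Q \<omega>)"
    by (rule Kleitman[OF fE(1)]) (use inc assms in \<open>auto simp: up_event_def\<close>)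
  then have "real (?c P * ?c Q) \<le> real (2 ^ card E * ?c (\<lambda>\<omega>. P \<omega> \<and> Q \<omega>))"
    by (simp only: of_nat_le_iff)
  then have "real (?c P) * real (?c Q) \<le> 2 ^ card E * real (?c (\<lambda>\<omega>. P \<omega> \<and> Q \<omega>))"
    unfolding of_nat_mult of_nat_power of_nat_numeral .
  then show ?thesis
    unfolding pr_count[OF fE dP] pr_count[OF fE dQ] pr_count[OF fE dPQ]
    by (simp add: field_simps)
qed

lemma Harris_ge:
  assumes "up_event P" "up_event Q" "p \<le> pr P" "q \<le> pr Q" "0 \<le> p" "0 \<le> q"
  shows "p * q \<le> pr (\<lambda>\<omega>. P \<omega> \<and> Q \<omega>)"
  using Harris[OF assms(1,2)] mult_mono[OF assms(3,4)] assms(5,6) pr_nonneg[of P] by linarith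

lemma up_event_ball:
  assumes "finite X" "\<And>x. x \<in> X \<Longrightarrow> up_event (P x)"
  shows "up_event (\<lambda>\<omega>. \<forall>x\<in>X. P x \<omega>)"
  using assms
proof (induction X rule: finite_induct)
  case empty
  then show ?case by (auto simp: up_event_def increasing_def finitary_def determined_def)
next
  case (insert x X)
  then show ?case using up_event_conj[of "P x" "\<lambda>\<omega>. \<forall>x\<in>X. P x \<omega>"] by simp
qed

lemma Harris_ball:
  assumes "finite X" "\<And>x. x \<in> X \<Longrightarrow> up_event (P x)" "\<And>x. x \<in> X \<Longrightarrow> p \<le> pr (P x)" "0 \<le> p"
  shows "p ^ card X \<le> pr (\<lambda>\<omega>. \<forall>x\<in>X. P x \<omega>)"
  using assms
proof (induction X rule: finite_induct)
  case empty
  then show ?case by (simp add: pr_True)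
next
  case (insert x X)
  then show ?case using Harris_ge[of "P x" "\<lambda>\<omega>. \<forall>x\<in>X. P x \<omega>" p "p ^ card X"]
    by (simp add: up_event_ball)
qed

section \<open>Independence and measure-preserving maps\<close>

lemma pr_indep:
  assumes "finite E" "E \<subseteq> lattice_edges" "determined E P"
    "finite F" "F \<subseteq> lattice_edges" "determined F Q" "E \<inter> F = {}"
  shows "pr (\<lambda>\<omega>. P \<omega> \<and> Q \<omega>) = pr P * pr Q"
proof -
  let ?P = "{A\<in>Pow E. P (\<lambda>e. e \<in> A)}" and ?Q = "{A\<in>Pow F. Q (\<lambda>e. e \<in> A)}"
  let ?PQ = "{A\<in>Pow (E \<union> F). P (\<lambda>e. e \<in> A) \<and> Q (\<lambda>e. e \<in> A)}"
  have dd: "determined (E \<union> F) (\<lambda>\<omega>. P \<omega> \<and> Q \<omega>)" using assms by (intro determined_conj)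
  have PE: "P (\<lambda>e. e \<in> A \<inter> E) = P (\<lambda>e. e \<in> A)" for A
    using assms(3) unfolding determined_def by auto
  have QF: "Q (\<lambda>e. e \<in> A \<inter> F) = Q (\<lambda>e. e \<in> A)" for A
    using assms(6) unfolding determined_def by auto
  have "bij_betw (\<lambda>A. (A \<inter> E, A \<inter> F)) ?PQ (?P \<times> ?Q)"
  proof (rule bij_betw_byWitness[where f' = "\<lambda>(A, B). A \<union> B"])
    show "(\<lambda>A. (A \<inter> E, A \<inter> F)) ` ?PQ \<subseteq> ?P \<times> ?Q" using PE QF by auto
    show "(\<lambda>(A, B). A \<union> B) ` (?P \<times> ?Q) \<subseteq> ?PQ"
    proof clarsimp
      fix A B assume *: "A \<subseteq> E" "P (\<lambda>e. e \<in> A)" "B \<subseteq> F" "Q (\<lambda>e. e \<in> B)"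
      have "(A \<union> B) \<inter> E = A" "(A \<union> B) \<inter> F = B" using * assms(7) by auto
      then show "A \<subseteq> E \<union> F \<and> B \<subseteq> E \<union> F \<and> P (\<lambda>e. e \<in> A \<or> e \<in> B) \<and> Q (\<lambda>e. e \<in> A \<or> e \<in> B)"
        using PE[of "A \<union> B"] QF[of "A \<union> B"] * by auto
    qed
  qed (use assms(7) in auto)
  then have "card ?PQ = card ?P * card ?Q"
    by (simp add: bij_betw_same_card card_cartesian_product)
  then show ?thesis
    unfolding pr_count[OF assms(1-3)] pr_count[OF assms(4-6)]
      pr_count[OF finite_UnI[OF assms(1,4)] Un_least[OF assms(2,5)] dd]
    by (simp add: card_Un_disjoint assms power_add)
qed

text \<open>Subsets of \<open>E\<close> correspond to subsets of its image under
  \<open>\<phi>\<close>. The rule serves both the lattice symmetries and the map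
  \<open>dual_edge\<close>.\<close>

lemma pr_map:
  assumes "finite E" "E \<subseteq> lattice_edges" "determined E P" "inj_on \<phi> E" "\<phi> ` E \<subseteq> lattice_edges"
  shows "pr (\<lambda>\<omega>. P (\<lambda>e. \<omega> (\<phi> e))) = pr P"
proof -
  let ?P = "{A\<in>Pow E. P (\<lambda>e. e \<in> A)}"
  let ?Q = "{A\<in>Pow (\<phi> ` E). P (\<lambda>e. \<phi> e \<in> A)}"
  have dQ: "determined (\<phi> ` E) (\<lambda>\<omega>. P (\<lambda>e. \<omega> (\<phi> e)))"
    using assms(3) unfolding determined_def by auto
  have PE: "P (\<lambda>e. \<phi> e \<in> \<phi> ` A) = P (\<lambda>e. e \<in> A)" if "A \<subseteq> E" for A
    by (rule determinedD[OF assms(3)]) (simp add: inj_on_image_mem_iff[OF assms(4) _ that])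
  have "?Q = image \<phi> ` ?P"
  proof (intro equalityI subsetI)
    fix B assume B: "B \<in> ?Q"
    then obtain A where "A \<subseteq> E" "B = \<phi> ` A" by (auto simp: subset_image_iff)
    with B PE show "B \<in> image \<phi> ` ?P" by auto
  qed (use PE in auto)
  moreover have "inj_on (image \<phi>) ?P"
    by (rule inj_onI) (use inj_on_image_eq_iff[OF assms(4)] in auto)
  ultimately have "card ?Q = card ?P" by (simp add: card_image)
  then show ?thesis
    unfolding pr_count[OF assms(1-3)] pr_count[OF finite_imageI[OF assms(1)] assms(5) dQ]
    by (simp add: card_image assms)
qed

text \<open>Complementation permutes the subsets of \<open>E\<close>. Together with
  \<open>pr_map\<close> for \<open>dual_edge\<close> this expresses self-duality at
  \<open>p = 1/2\<close>.\<close>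

lemma pr_compl:
  assumes "finite E" "E \<subseteq> lattice_edges" "determined E P"
  shows "pr (\<lambda>\<omega>. P (\<lambda>e. \<not> \<omega> e)) = pr P"
proof -
  let ?P = "{A\<in>Pow E. P (\<lambda>e. e \<in> A)}"
  let ?Q = "{A\<in>Pow E. P (\<lambda>e. e \<notin> A)}"
  have dQ: "determined E (\<lambda>\<omega>. P (\<lambda>e. \<not> \<omega> e))"
    using assms(3) unfolding determined_def by simp
  have PE: "P (\<lambda>e. e \<in> E - A) = P (\<lambda>e. e \<notin> A)" "P (\<lambda>e. e \<notin> E - A) = P (\<lambda>e. e \<in> A)" for A
    using assms(3) unfolding determined_def by auto
  have "bij_betw (\<lambda>A. E - A) ?Q ?P"
    by (rule bij_betw_byWitness[where f' = "\<lambda>A. E - A"])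
      (use PE in auto)
  then have "card ?Q = card ?P" by (rule bij_betw_same_card)
  then show ?thesis unfolding pr_count[OF assms(1-3)] pr_count[OF assms(1,2) dQ] by simp
qed

section \<open>Open paths\<close>

definition adj :: "int \<times> int \<Rightarrow> int \<times> int \<Rightarrow> bool" where
  "adj x y \<longleftrightarrow> \<bar>fst x - fst y\<bar> + \<bar>snd x - snd y\<bar> = 1"

lemma adj_sym: "adj x y \<longleftrightarrow> adj y x"
  unfolding adj_def by (simp add: abs_minus_commute)

lemma lattice_edge_iff: "{x, y} \<in> lattice_edges \<longleftrightarrow> adj x y"
proof
  assume "{x, y} \<in> lattice_edges"
  then obtain u v where "{x, y} = {u, v}" "adj u v" unfolding lattice_edges_def adj_def by blast
  then show "adj x y" using adj_sym by (metis doubleton_eq_iff)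
next
  assume "adj x y"
  then show "{x, y} \<in> lattice_edges" unfolding lattice_edges_def adj_def by blast
qed

definition step :: "(int \<times> int) set \<Rightarrow> ((int \<times> int) set \<Rightarrow> bool) \<Rightarrow> ((int \<times> int) \<times> (int \<times> int)) set" where
  "step D \<omega> = {(x, y). x \<in> D \<and> y \<in> D \<and> adj x y \<and> \<omega> {x, y}}"

definition conn :: "(int \<times> int) set \<Rightarrow> ((int \<times> int) set \<Rightarrow> bool) \<Rightarrow> int \<times> int \<Rightarrow> int \<times> int \<Rightarrow> bool" where
  "conn D \<omega> x y \<longleftrightarrow> x \<in> D \<and> (x, y) \<in> (step D \<omega>)\<^sup>*"

text \<open>A set \<open>P\<close> with \<open>joined P x y\<close> stands for a lattice path: only
  the set of visited vertices matters for intersections, so lists of vertices are avoided.\<close>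

abbreviation joined :: "(int \<times> int) set \<Rightarrow> int \<times> int \<Rightarrow> int \<times> int \<Rightarrow> bool" where
  "joined D \<equiv> conn D (\<lambda>_. True)"

lemma conn_refl: "x \<in> D \<Longrightarrow> conn D \<omega> x x"
  unfolding conn_def by simp

lemma conn_in: assumes "conn D \<omega> x y" shows "x \<in> D" "y \<in> D"
proof -
  show "x \<in> D" using assms unfolding conn_def by simp
  have "(x, y) \<in> (step D \<omega>)\<^sup>*" using assms unfolding conn_def by simp
  then show "y \<in> D" using \<open>x \<in> D\<close> by (induction) (auto simp: step_def)
qed

lemma conn_trans: "conn D \<omega> x y \<Longrightarrow> conn D \<omega> y z \<Longrightarrow> conn D \<omega> x z"
  unfolding conn_def by auto

lemma conn_step: "conn D \<omega> x y \<Longrightarrow> z \<in> D \<Longrightarrow> adj y z \<Longrightarrow> \<omega> {y, z} \<Longrightarrow> conn D \<omega> x z"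
  using conn_in[of D \<omega> x y] unfolding conn_def
  by (auto simp: step_def intro: rtrancl_into_rtrancl)

lemma conn_sym: assumes "conn D \<omega> x y" shows "conn D \<omega> y x"
proof -
  have "sym (step D \<omega>)" by (auto simp: sym_def step_def adj_sym insert_commute)
  then have "(y, x) \<in> (step D \<omega>)\<^sup>*"
    using assms sym_rtrancl unfolding conn_def sym_def by blast
  then show ?thesis using conn_in[OF assms] unfolding conn_def by simp
qed

lemma conn_induct [consumes 1, case_names refl step]:
  assumes "conn D \<omega> x y" "x \<in> D \<Longrightarrow> P x"
    "\<And>y z. conn D \<omega> x y \<Longrightarrow> z \<in> D \<Longrightarrow> adj y z \<Longrightarrow> \<omega> {y, z} \<Longrightarrow> P y \<Longrightarrow> P z"
  shows "P y"
proof -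
  have x: "x \<in> D" and "(x, y) \<in> (step D \<omega>)\<^sup>*" using assms(1) unfolding conn_def by auto
  from this(2) show ?thesis
  proof induction
    case base
    then show ?case using assms(2) x by simp
  next
    case (step y z)
    have "conn D \<omega> x y" using x step(1) unfolding conn_def by simp
    moreover have "z \<in> D" "adj y z" "\<omega> {y, z}" using step(2) unfolding step_def by auto
    ultimately show ?case using assms(3) step.IH by blast
  qed
qed

lemma conn_mono:
  assumes "conn D \<omega> x y" "D \<subseteq> D'" "\<And>e. \<omega> e \<Longrightarrow> \<omega>' e"
  shows "conn D' \<omega>' x y"
  using assms(1)
proof (induction rule: conn_induct)
  case refl
  then show ?case using assms(2) by (auto intro: conn_refl)
next
  case (step y z)
  then show ?case using assms(2,3) by (meson conn_step subsetD)
qed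

lemma conn_subset: "conn D \<omega> x y \<Longrightarrow> D \<subseteq> D' \<Longrightarrow> conn D' \<omega> x y"
  by (rule conn_mono)

text \<open>An open connection stays among the vertices reachable from \<open>x\<close>. Hence a
  reachable set can be used as a path in the planar intersection lemmas, and a common vertex merges
  two clusters.\<close>

lemma conn_joined: "conn D \<omega> x y \<Longrightarrow> joined {v. conn D \<omega> x v} x y"
proof (induction rule: conn_induct)
  case refl
  then show ?case by (intro conn_refl) (simp add: conn_refl)
next
  case (step y z)
  then have "conn D \<omega> x z" by (meson conn_step)
  then show ?case using step by (intro conn_step[OF step.IH]) auto
qed

text \<open>A discrete intermediate value argument: the path is followed until it hits level
  \<open>m\<close>, and no level is skipped since \<open>h\<close> changes by at most 1 per
  step.\<close>

lemma conn_level: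
  fixes h :: "int \<times> int \<Rightarrow> int"
  assumes "conn D \<omega> x y" "\<And>u v. adj u v \<Longrightarrow> \<bar>h u - h v\<bar> \<le> 1" "m \<le> h x" "h y \<le> m"
  shows "\<exists>w. h w = m \<and> conn (D \<inter> {v. m \<le> h v}) \<omega> x w"
proof -
  have "conn (D \<inter> {v. m \<le> h v}) \<omega> x y \<or> (\<exists>w. h w = m \<and> conn (D \<inter> {v. m \<le> h v}) \<omega> x w)"
    using assms(1)
  proof (induction rule: conn_induct)
    case refl
    then show ?case using assms(3) by (auto intro: conn_refl)
  next
    case (step y z)
    show ?case
    proof (cases "\<exists>w. h w = m \<and> conn (D \<inter> {v. m \<le> h v}) \<omega> x w")
      case False
      then have c: "conn (D \<inter> {v. m \<le> h v}) \<omega> x y" using step by blast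
      then have "m < h y" using False conn_in(2)[OF c] by (metis (mono_tags, lifting) IntD2 mem_Collect_eq order_le_less)
      then have "m \<le> h z" using assms(2)[OF step(3)] by linarith
      then show ?thesis using conn_step[OF c _ step(3,4)] step(2) by blast
    qed blast
  qed
  moreover have "h y = m" if "conn (D \<inter> {v. m \<le> h v}) \<omega> x y"
    using conn_in(2)[OF that] assms(4) by auto
  ultimately show ?thesis by blast
qed

lemma conn_image:
  assumes "inj \<sigma>" "\<And>x y. adj (\<sigma> x) (\<sigma> y) \<longleftrightarrow> adj x y"
  shows "conn (\<sigma> ` D) \<omega> (\<sigma> x) (\<sigma> y) \<longleftrightarrow> conn D (\<lambda>e. \<omega> (\<sigma> ` e)) x y"
proof
  assume "conn D (\<lambda>e. \<omega> (\<sigma> ` e)) x y"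
  then show "conn (\<sigma> ` D) \<omega> (\<sigma> x) (\<sigma> y)"
  proof (induction rule: conn_induct)
    case (step y z)
    then show ?case using assms(2) by (intro conn_step[OF step.IH]) auto
  qed (auto intro: conn_refl)
next
  assume "conn (\<sigma> ` D) \<omega> (\<sigma> x) (\<sigma> y)"
  then have "\<forall>y'. \<sigma> y = \<sigma> y' \<longrightarrow> conn D (\<lambda>e. \<omega> (\<sigma> ` e)) x y'"
  proof (induction rule: conn_induct)
    case refl
    then have "x \<in> D" using inj_image_mem_iff[OF assms(1)] by simp
    then show ?case using inj_eq[OF assms(1)] by (simp add: conn_refl)
  next
    case (step u v)
    from conn_in(2)[OF step(1)] obtain u' where u: "u = \<sigma> u'" "u' \<in> D" by blast
    from step(2) obtain v' where v: "v = \<sigma> v'" "v' \<in> D" by blast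
    have "conn D (\<lambda>e. \<omega> (\<sigma> ` e)) x v'"
    proof (rule conn_step)
      show "conn D (\<lambda>e. \<omega> (\<sigma> ` e)) x u'" by (rule step.IH[rule_format, OF u(1)])
      show "adj u' v'" using step(3) assms(2) unfolding u v by simp
      show "\<omega> (\<sigma> ` {u', v'})" using step(4) unfolding u v by simp
    qed (use v in simp)
    then show ?case using v inj_eq[OF assms(1)] by simp
  qed
  then show "conn D (\<lambda>e. \<omega> (\<sigma> ` e)) x y" by blast
qed

definition edges_in :: "(int \<times> int) set \<Rightarrow> (int \<times> int) set set" where
  "edges_in D = {e \<in> lattice_edges. e \<subseteq> D}"

lemma edges_in_lattice: "edges_in D \<subseteq> lattice_edges"
  unfolding edges_in_def by blast

lemma finite_edges_in: "finite D \<Longrightarrow> finite (edges_in D)"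
  by (rule finite_subset[of _ "Pow D"]) (auto simp: edges_in_def)

lemma edges_in_disjoint:
  assumes "D \<inter> D' = {}" shows "edges_in D \<inter> edges_in D' = {}"
proof -
  have False if "e \<in> edges_in D" "e \<in> edges_in D'" for e
  proof -
    have "e \<noteq> {}" using that(1) unfolding edges_in_def lattice_edges_def by auto
    then show False using that assms unfolding edges_in_def by blast
  qed
  then show ?thesis by blast
qed

lemma conn_determined: "determined (edges_in D) (\<lambda>\<omega>. conn D \<omega> x y)"
  unfolding determined_def
proof (intro allI impI)
  fix \<omega> \<omega>' :: "(int \<times> int) set \<Rightarrow> bool" assume "\<forall>e\<in>edges_in D. \<omega> e = \<omega>' e"
  then have "step D \<omega> = step D \<omega>'"
    unfolding step_def edges_in_def by (auto simp: lattice_edge_iff)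
  then show "conn D \<omega> x y = conn D \<omega>' x y" unfolding conn_def by simp
qed

section \<open>Crossing events\<close>

definition crossing :: "(int \<times> int) set \<Rightarrow> (int \<times> int) set \<Rightarrow> (int \<times> int) set \<Rightarrow> ((int \<times> int) set \<Rightarrow> bool) \<Rightarrow> bool" where
  "crossing D X Y \<omega> \<longleftrightarrow> (\<exists>x\<in>X. \<exists>y\<in>Y. conn D \<omega> x y)"

lemma crossing_determined: "determined (edges_in D) (crossing D X Y)"
  unfolding determined_def crossing_def
proof (intro allI impI)
  fix \<omega> \<omega>' :: "(int \<times> int) set \<Rightarrow> bool" assume "\<forall>e\<in>edges_in D. \<omega> e = \<omega>' e"
  then have "conn D \<omega> x y = conn D \<omega>' x y" for x y by (intro determinedD[OF conn_determined]) simp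
  then show "(\<exists>x\<in>X. \<exists>y\<in>Y. conn D \<omega> x y) = (\<exists>x\<in>X. \<exists>y\<in>Y. conn D \<omega>' x y)" by simp
qed

lemma up_event_crossing:
  assumes "finite D" shows "up_event (crossing D X Y)"
  unfolding up_event_def
proof
  show "finitary (crossing D X Y)"
    by (rule finitaryI[OF finite_edges_in[OF assms] edges_in_lattice crossing_determined])
  show "increasing (crossing D X Y)"
    unfolding increasing_def
  proof (intro allI impI)
    fix \<omega> \<omega>' :: "(int \<times> int) set \<Rightarrow> bool" assume *: "\<omega> \<le> \<omega>'" and "crossing D X Y \<omega>"
    then obtain x y where "x \<in> X" "y \<in> Y" "conn D \<omega> x y" unfolding crossing_def by blast
    moreover have "conn D \<omega>' x y" using \<open>conn D \<omega> x y\<close>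
      by (rule conn_mono) (use * in \<open>auto simp: le_fun_def\<close>)
    ultimately show "crossing D X Y \<omega>'" unfolding crossing_def by blast
  qed
qed

lemma crossing_mono: "crossing D X Y \<omega> \<Longrightarrow> D \<subseteq> D' \<Longrightarrow> X \<subseteq> X' \<Longrightarrow> Y \<subseteq> Y' \<Longrightarrow> crossing D' X' Y' \<omega>"
  unfolding crossing_def by (meson conn_subset subsetD)

lemma pr_crossing_mono:
  "finite D' \<Longrightarrow> D \<subseteq> D' \<Longrightarrow> X \<subseteq> X' \<Longrightarrow> Y \<subseteq> Y' \<Longrightarrow> pr (crossing D X Y) \<le> pr (crossing D' X' Y')"
  by (rule pr_mono) (auto intro: up_event_event up_event_crossing crossing_mono)

lemma pr_crossing_image:
  assumes "inj \<sigma>" "\<And>x y. adj (\<sigma> x) (\<sigma> y) \<longleftrightarrow> adj x y" "finite D"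
  shows "pr (crossing (\<sigma> ` D) (\<sigma> ` X) (\<sigma> ` Y)) = pr (crossing D X Y)"
proof -
  have "crossing (\<sigma> ` D) (\<sigma> ` X) (\<sigma> ` Y) \<omega> = crossing D X Y (\<lambda>e. \<omega> (\<sigma> ` e))" for \<omega>
    unfolding crossing_def by (simp add: conn_image[OF assms(1,2)])
  then have "crossing (\<sigma> ` D) (\<sigma> ` X) (\<sigma> ` Y) = (\<lambda>\<omega>. crossing D X Y (\<lambda>e. \<omega> (\<sigma> ` e)))" by blast
  moreover have "pr (\<lambda>\<omega>. crossing D X Y (\<lambda>e. \<omega> (\<sigma> ` e))) = pr (crossing D X Y)"
  proof (rule pr_map[OF finite_edges_in[OF assms(3)] edges_in_lattice crossing_determined])
    show "inj_on ((`) \<sigma>) (edges_in D)"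
      using assms(1) by (auto intro!: inj_onI dest: inj_image_eq_iff[THEN iffD1])
    show "(`) \<sigma> ` edges_in D \<subseteq> lattice_edges"
    proof clarify
      fix e assume "e \<in> edges_in D"
      then have "e \<in> lattice_edges" unfolding edges_in_def by blast
      moreover from this obtain x y where "e = {x, y}" unfolding lattice_edges_def by blast
      ultimately show "\<sigma> ` e \<in> lattice_edges" by (simp add: lattice_edge_iff assms(2))
    qed
  qed
  ultimately show ?thesis by simp
qed

section \<open>Intersecting lattice paths\<close>

definition rect :: "int \<Rightarrow> int \<Rightarrow> int \<Rightarrow> int \<Rightarrow> (int \<times> int) set" where
  "rect a b c d = {a..b} \<times> {c..d}"

lemma finite_rect [simp]: "finite (rect a b c d)"
  unfolding rect_def by simp

lemma in_rect: "v \<in> rect a b c d \<longleftrightarrow> a \<le> fst v \<and> fst v \<le> b \<and> c \<le> snd v \<and> snd v \<le> d"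
  unfolding rect_def by (cases v) auto

lemma rect_mono: "a' \<le> a \<Longrightarrow> b \<le> b' \<Longrightarrow> c' \<le> c \<Longrightarrow> d \<le> d' \<Longrightarrow> rect a b c d \<subseteq> rect a' b' c' d'"
  unfolding rect_def by auto

definition emb :: "int \<times> int \<Rightarrow> real^2" where
  "emb v = vector [of_int (fst v), of_int (snd v)]"

lemma emb_nth: "emb v $ 1 = of_int (fst v)" "emb v $ 2 = of_int (snd v)"
  unfolding emb_def by (simp_all add: vector_2)

lemma joined_polygonal:
  assumes "joined P x y"
  shows "\<exists>g. path g \<and> pathstart g = emb x \<and> pathfinish g = emb y \<and>
    path_image g \<subseteq> {z. \<exists>u\<in>P. \<exists>v\<in>P. (adj u v \<or> u = v) \<and> z \<in> closed_segment (emb u) (emb v)}"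
    (is "\<exists>g. _ \<and> _ \<and> _ \<and> path_image g \<subseteq> ?S")
  using assms
proof (induction rule: conn_induct)
  case refl
  then show ?case by (intro exI[of _ "linepath (emb x) (emb x)"]) (simp only: path_linepath
      pathstart_linepath pathfinish_linepath path_image_linepath simp_thms, blast)
next
  case (step y z)
  then obtain g where g: "path g" "pathstart g = emb x" "pathfinish g = emb y" "path_image g \<subseteq> ?S"
    by blast
  have "y \<in> P" using conn_in(2)[OF step(1)] .
  then have "closed_segment (emb y) (emb z) \<subseteq> ?S" using step(2,3) by blast
  with g(4) have "path_image g \<union> closed_segment (emb y) (emb z) \<subseteq> ?S" by (rule Un_least)
  with g(1-3) show ?case
    by (intro exI[of _ "g +++ linepath (emb y) (emb z)"]) (simp only: path_image_join path_join
      pathstart_join pathfinish_join path_linepath pathstart_linepath pathfinish_linepath path_image_linepath simp_thms)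
qed

lemma closed_segment_nth:
  fixes a b z :: "real^'n"
  assumes "z \<in> closed_segment a b"
  shows "min (a$i) (b$i) \<le> z$i" "z$i \<le> max (a$i) (b$i)"
proof -
  obtain t where t: "0 \<le> t" "t \<le> 1" "z = (1 - t) *\<^sub>R a + t *\<^sub>R b"
    using assms unfolding in_segment by blast
  then have z: "z$i = (1 - t) * a$i + t * b$i" by simp
  show "z$i \<le> max (a$i) (b$i)" unfolding z by (rule convex_bound_le) (use t in auto)
  have "- (z$i) \<le> - min (a$i) (b$i)" unfolding z minus_add_distrib minus_mult_right
    by (rule convex_bound_le) (use t in auto)
  then show "min (a$i) (b$i) \<le> z$i" by simp
qed

text \<open>Both segments are axis-parallel with integer end points and length at most 1, so overlap
  of their coordinate ranges already forces a common end point.\<close>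

lemma lattice_segments_meet:
  assumes "adj u v \<or> u = v" "adj u' v' \<or> u' = v'"
    and "z \<in> closed_segment (emb u) (emb v)" "z \<in> closed_segment (emb u') (emb v')"
  shows "{u, v} \<inter> {u', v'} \<noteq> {}"
proof -
  obtain u1 u2 v1 v2 p1 p2 q1 q2 where eq: "u = (u1, u2)" "v = (v1, v2)" "u' = (p1, p2)" "v' = (q1, q2)"
    by (metis surj_pair)
  have "min (emb u $ i) (emb v $ i) \<le> max (emb u' $ i) (emb v' $ i)"
    "min (emb u' $ i) (emb v' $ i) \<le> max (emb u $ i) (emb v $ i)" for i
    using closed_segment_nth[OF assms(3), of i] closed_segment_nth[OF assms(4), of i] by linarith+
  from this[of 1] this[of 2]
  have "min u1 v1 \<le> max p1 q1" "min p1 q1 \<le> max u1 v1" "min u2 v2 \<le> max p2 q2" "min p2 q2 \<le> max u2 v2"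
    unfolding eq emb_nth by (simp_all add: min_le_iff_disj le_max_iff_disj)
  moreover have "\<bar>u1 - v1\<bar> + \<bar>u2 - v2\<bar> \<le> 1" "\<bar>p1 - q1\<bar> + \<bar>p2 - q2\<bar> \<le> 1"
    using assms(1,2) unfolding eq adj_def by auto
  ultimately have "(u1 = p1 \<and> u2 = p2) \<or> (u1 = q1 \<and> u2 = q2) \<or> (v1 = p1 \<and> v2 = p2) \<or> (v1 = q1 \<and> v2 = q2)"
    by (smt (verit))
  then show ?thesis unfolding eq by auto
qed

text \<open>The Fashoda theorem, applied to polygonal curves through the vertices: a common point of
  the curves lies on two lattice segments, which then share a vertex.\<close>

lemma paths_meet:
  assumes "joined P x y" "P \<subseteq> rect a b c d" "fst x = a" "fst y = b"
    and "joined Q u v" "Q \<subseteq> rect a b c d" "snd u = c" "snd v = d"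
  shows "P \<inter> Q \<noteq> {}"
proof -
  have box: "closed_segment (emb u) (emb v) \<subseteq> cbox (emb (a, c)) (emb (b, d))"
    if "u \<in> rect a b c d" "v \<in> rect a b c d" for u v
    using that by (intro closed_segment_subset convex_box)
      (auto simp: mem_box_cart forall_2 emb_nth in_rect)
  obtain g where g: "path g" "pathstart g = emb x" "pathfinish g = emb y"
    "path_image g \<subseteq> {z. \<exists>u\<in>P. \<exists>v\<in>P. (adj u v \<or> u = v) \<and> z \<in> closed_segment (emb u) (emb v)}"
    using joined_polygonal[OF assms(1)] by blast
  obtain h where h: "path h" "pathstart h = emb u" "pathfinish h = emb v"
    "path_image h \<subseteq> {z. \<exists>u\<in>Q. \<exists>v\<in>Q. (adj u v \<or> u = v) \<and> z \<in> closed_segment (emb u) (emb v)}"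
    using joined_polygonal[OF assms(5)] by blast
  have in_box: "K \<subseteq> cbox (emb (a, c)) (emb (b, d))"
    if K: "K \<subseteq> {z. \<exists>u\<in>R. \<exists>v\<in>R. (adj u v \<or> u = v) \<and> z \<in> closed_segment (emb u) (emb v)}"
      and R: "R \<subseteq> rect a b c d" for K R
  proof
    fix z assume "z \<in> K"
    then obtain u v where "u \<in> R" "v \<in> R" "z \<in> closed_segment (emb u) (emb v)" using K by blast
    then show "z \<in> cbox (emb (a, c)) (emb (b, d))" using box[of u v] R by blast
  qed
  from fashoda[OF g(1) h(1) in_box[OF g(4) assms(2)] in_box[OF h(4) assms(6)]]
  obtain z where z: "z \<in> path_image g" "z \<in> path_image h"
    unfolding g(2,3) h(2,3) emb_nth using assms(3,4,7,8) by auto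
  from z(1) g(4) obtain u1 v1 where 1: "u1 \<in> P" "v1 \<in> P" "adj u1 v1 \<or> u1 = v1" "z \<in> closed_segment (emb u1) (emb v1)"
    by fast
  from z(2) h(4) obtain u2 v2 where 2: "u2 \<in> Q" "v2 \<in> Q" "adj u2 v2 \<or> u2 = v2" "z \<in> closed_segment (emb u2) (emb v2)"
    by fast
  from lattice_segments_meet[OF 1(3) 2(3) 1(4) 2(4)] 1 2 show ?thesis by auto
qed

lemma joined_column:
  assumes "\<And>j. c \<le> j \<Longrightarrow> j \<le> d \<Longrightarrow> (i, j) \<in> D" "c \<le> d"
  shows "joined D (i, c) (i, d)"
  using assms(2,1)
proof (induction d rule: int_ge_induct)
  case base
  then show ?case by (auto intro: conn_refl)
next
  case (step d)
  then have "joined D (i, c) (i, d)" by auto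
  then show ?case by (rule conn_step) (use step in \<open>auto simp: adj_def\<close>)
qed

lemma joined_row:
  assumes "\<And>i. a \<le> i \<Longrightarrow> i \<le> b \<Longrightarrow> (i, j) \<in> D" "a \<le> b"
  shows "joined D (a, j) (b, j)"
  using assms(2,1)
proof (induction b rule: int_ge_induct)
  case base
  then show ?case by (auto intro: conn_refl)
next
  case (step b)
  then have "joined D (a, j) (b, j)" by auto
  then show ?case by (rule conn_step) (use step in \<open>auto simp: adj_def\<close>)
qed

text \<open>Extend both paths into an additional column to the right of the rectangle, where the
  extensions are disjoint because the end of the first path lies between the ends of the second.\<close>

lemma arch_meets:
  assumes P: "joined P x y" "P \<subseteq> rect a b c d" "fst x = a" "fst y = b"
    and Q: "joined Q u v" "Q \<subseteq> rect a b c d" "fst u = b" "fst v = b" "snd u \<le> snd y" "snd y \<le> snd v"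
  shows "P \<inter> Q \<noteq> {}"
proof (cases "snd u = snd y \<or> snd y = snd v")
  case True
  then have "y = u \<or> y = v" using P(4) Q(3,4) by (auto simp: prod_eq_iff)
  then show ?thesis using conn_in[OF P(1)] conn_in[OF Q(1)] by auto
next
  case False
  then have lt: "snd u < snd y" "snd y < snd v" using Q by auto
  define P' where "P' = insert (b + 1, snd y) P"
  define Q' where "Q' = Q \<union> {b + 1} \<times> {c..snd u} \<union> {b + 1} \<times> {snd v..d}"
  have in1: "y \<in> rect a b c d" "u \<in> rect a b c d" "v \<in> rect a b c d" using conn_in P Q by blast+
  have "joined P' x (b + 1, snd y)"
    by (rule conn_step[OF conn_subset[OF P(1)]]) (auto simp: P'_def adj_def P(4))
  moreover have "P' \<subseteq> rect a (b + 1) c d"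
    using P(2) in1 rect_mono[of a a b "b+1" c c d d] by (auto simp: P'_def in_rect)
  moreover have "joined Q' (b + 1, c) (b + 1, d)"
  proof -
    have "joined Q' (b + 1, c) (b + 1, snd u)" "joined Q' (b + 1, snd v) (b + 1, d)"
      by (rule joined_column; use in1 in \<open>auto simp: Q'_def in_rect\<close>)+
    moreover have "joined Q' u v" by (rule conn_subset[OF Q(1)]) (auto simp: Q'_def)
    moreover have "u \<in> Q'" "v \<in> Q'" using conn_in[OF Q(1)] by (auto simp: Q'_def)
    moreover have "joined Q' (b + 1, snd u) u"
      by (rule conn_step[OF conn_refl]) (use in1 Q \<open>u \<in> Q'\<close> in \<open>auto simp: Q'_def adj_def in_rect\<close>)
    moreover have "joined Q' v (b + 1, snd v)"
      by (rule conn_step[OF conn_refl]) (use in1 Q \<open>v \<in> Q'\<close> in \<open>auto simp: Q'_def adj_def in_rect\<close>)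
    ultimately show ?thesis by (meson conn_trans)
  qed
  moreover have "Q' \<subseteq> rect a (b + 1) c d"
    using Q(2) in1 rect_mono[of a a b "b+1" c c d d] by (auto simp: Q'_def in_rect)
  ultimately have "P' \<inter> Q' \<noteq> {}"
    using P(3) by (intro paths_meet[of P' x "(b + 1, snd y)" a "b + 1" c d Q']) auto
  moreover have "(b + 1, j) \<notin> P" "(b + 1, j) \<notin> Q" for j
    using P(2) Q(2) by (auto simp: in_rect)
  ultimately show ?thesis using lt by (auto simp: P'_def Q'_def)
qed

text \<open>Here additional rows above and below turn the first path into a left-right crossing.\<close>

lemma swapped_paths_meet:
  assumes P: "joined P p p'" "P \<subseteq> rect a b c d" "snd p = d" "snd p' = c"
    and Q: "joined Q q q'" "Q \<subseteq> rect a b c d" "snd q = d" "snd q' = c"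
    and order: "fst q \<le> fst p" "fst p' \<le> fst q'"
  shows "P \<inter> Q \<noteq> {}"
proof (cases "fst q = fst p \<or> fst p' = fst q'")
  case True
  then have "q = p \<or> q' = p'" using P Q by (auto simp: prod_eq_iff)
  then show ?thesis using conn_in[OF P(1)] conn_in[OF Q(1)] by auto
next
  case False
  then have lt: "fst q < fst p" "fst p' < fst q'" using order by auto
  define P' where "P' = P \<union> {a..fst p'} \<times> {c - 1} \<union> {fst p..b} \<times> {d + 1}"
  define Q' where "Q' = insert (fst q', c - 1) (insert (fst q, d + 1) Q)"
  have in1: "p \<in> rect a b c d" "p' \<in> rect a b c d" "q \<in> rect a b c d" "q' \<in> rect a b c d"
    using conn_in P Q by blast+
  have in2: "p \<in> P'" "p' \<in> P'" "q \<in> Q'" "q' \<in> Q'"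
    using conn_in[OF P(1)] conn_in[OF Q(1)] by (auto simp: P'_def Q'_def)
  have "joined P' (a, c - 1) (b, d + 1)"
  proof -
    have "joined P' (a, c - 1) (fst p', c - 1)" "joined P' (fst p, d + 1) (b, d + 1)"
      by (rule joined_row; use in1 in \<open>auto simp: P'_def in_rect\<close>)+
    moreover have "joined P' p' p" by (rule conn_sym[OF conn_subset[OF P(1)]]) (auto simp: P'_def)
    moreover have "joined P' (fst p', c - 1) p'"
      by (rule conn_step[OF conn_refl]) (use in1 P in2 in \<open>auto simp: P'_def adj_def in_rect\<close>)
    moreover have "joined P' p (fst p, d + 1)"
      by (rule conn_step[OF conn_refl]) (use in1 P in2 in \<open>auto simp: P'_def adj_def in_rect\<close>)
    ultimately show ?thesis by (meson conn_trans)
  qed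
  moreover have "P' \<subseteq> rect a b (c - 1) (d + 1)"
    using P(2) in1 rect_mono[of a a b b "c - 1" c d "d + 1"] by (auto simp: P'_def in_rect)
  moreover have "joined Q' (fst q', c - 1) (fst q, d + 1)"
  proof -
    have "joined Q' q' q" by (rule conn_sym[OF conn_subset[OF Q(1)]]) (auto simp: Q'_def)
    moreover have "joined Q' (fst q', c - 1) q'"
      by (rule conn_step[OF conn_refl]) (use in1 Q in2 in \<open>auto simp: Q'_def adj_def in_rect\<close>)
    moreover have "joined Q' q (fst q, d + 1)"
      by (rule conn_step[OF conn_refl]) (use in1 Q in2 in \<open>auto simp: Q'_def adj_def in_rect\<close>)
    ultimately show ?thesis by (meson conn_trans)
  qed
  moreover have "Q' \<subseteq> rect a b (c - 1) (d + 1)"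
    using Q(2) in1 rect_mono[of a a b b "c - 1" c d "d + 1"] by (auto simp: Q'_def in_rect)
  ultimately have "P' \<inter> Q' \<noteq> {}"
    by (intro paths_meet[of P' "(a, c - 1)" "(b, d + 1)" a b "c - 1" "d + 1" Q']) auto
  moreover have "(i, c - 1) \<notin> P" "(i, c - 1) \<notin> Q" "(i, d + 1) \<notin> P" "(i, d + 1) \<notin> Q" for i
    using P(2) Q(2) by (auto simp: in_rect)
  moreover have "c \<le> d" using in1 by (auto simp: in_rect)
  ultimately show ?thesis using lt by (auto simp: P'_def Q'_def)
qed

section \<open>Symmetry and self-duality\<close>

lemma pr_crossing_vimage:
  assumes "bij \<tau>" "\<And>x y. adj (\<tau> x) (\<tau> y) \<longleftrightarrow> adj x y" "finite D"
  shows "pr (crossing (\<tau> -` D) (\<tau> -` X) (\<tau> -` Y)) = pr (crossing D X Y)"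
proof -
  have "adj (inv \<tau> x) (inv \<tau> y) \<longleftrightarrow> adj x y" for x y
    using assms(2)[of "inv \<tau> x" "inv \<tau> y"] assms(1) by (simp add: bij_is_surj surj_f_inv_f)
  then show ?thesis unfolding bij_vimage_eq_inv_image[OF assms(1)]
    by (intro pr_crossing_image) (use assms in \<open>auto intro: bij_is_inj bij_imp_bij_inv\<close>)
qed

text \<open>\<open>s\<close> and \<open>t\<close> are signs, so this covers translations and
  reflections. Stating the new sets as preimages lets them be verified by linear arithmetic.\<close>

lemma pr_crossing_affine:
  assumes "finite D" "\<bar>s\<bar> = 1" "\<bar>t\<bar> = 1" "D' = {v. (s * fst v + k, t * snd v + l) \<in> D}"
    "X' = {v. (s * fst v + k, t * snd v + l) \<in> X}" "Y' = {v. (s * fst v + k, t * snd v + l) \<in> Y}"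
  shows "pr (crossing D' X' Y') = pr (crossing D X Y)"
proof -
  let ?\<tau> = "\<lambda>v::int\<times>int. (s * fst v + k, t * snd v + l)"
  have "s * (s * x) = x" "t * (t * x) = x" for x using assms(2,3) by (auto simp: abs_if split: if_splits)
  note st = this
  have "bij ?\<tau>"
    by (rule bij_betw_byWitness[where f' = "\<lambda>v. (s * (fst v - k), t * (snd v - l))"])
      (simp_all add: st)
  moreover have "adj (?\<tau> x) (?\<tau> y) \<longleftrightarrow> adj x y" for x y
    using assms(2,3) by (simp add: adj_def abs_mult flip: right_diff_distrib)
  ultimately show ?thesis
    using pr_crossing_vimage[of ?\<tau> D X Y] assms(1) unfolding assms(4-) by (simp add: vimage_def)
qed

lemma pr_crossing_affine_swap:
  assumes "finite D" "\<bar>s\<bar> = 1" "\<bar>t\<bar> = 1" "D' = {v. (s * snd v + k, t * fst v + l) \<in> D}"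
    "X' = {v. (s * snd v + k, t * fst v + l) \<in> X}" "Y' = {v. (s * snd v + k, t * fst v + l) \<in> Y}"
  shows "pr (crossing D' X' Y') = pr (crossing D X Y)"
proof -
  let ?A = "\<lambda>A. {v. (s * fst v + k, t * snd v + l) \<in> A}"
  have "inj (\<lambda>v::int\<times>int. (s * fst v + k, t * snd v + l))"
    using assms(2,3) by (intro injI) (auto simp: prod_eq_iff)
  from finite_vimageI[OF assms(1) this] have fin: "finite (?A D)" by (simp add: vimage_def)
  have "pr (crossing D' X' Y') = pr (crossing (prod.swap -` ?A D) (prod.swap -` ?A X) (prod.swap -` ?A Y))"
    unfolding assms(4-) by (simp add: vimage_def)
  also have "\<dots> = pr (crossing (?A D) (?A X) (?A Y))"
    by (rule pr_crossing_vimage[OF _ _ fin]) (auto simp: adj_def add.commute)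
  also have "\<dots> = pr (crossing D X Y)"
    by (rule pr_crossing_affine[OF assms(1-3)]) auto
  finally show ?thesis .
qed

section \<open>Planar self-duality\<close>

lemma summation_by_parts:
  fixes a d :: "nat \<Rightarrow> int"
  shows "(\<Sum>j\<le>n. a j * (d (Suc j) - d j)) =
    a n * d (Suc n) - a 0 * d 0 - (\<Sum>j<n. (a (Suc j) - a j) * d (Suc j))"
  by (induction n) (simp_all add: algebra_simps)

lemma summation_by_parts':
  fixes b e :: "nat \<Rightarrow> int"
  shows "(\<Sum>i\<le>n. (b (Suc i) - b i) * e i) =
    b (Suc n) * e n - b 0 * e 0 - (\<Sum>i<n. b (Suc i) * (e (Suc i) - e i))"
  by (induction n) (simp_all add: algebra_simps)

text \<open>A discrete Stokes theorem: the integral of \<open>dc \<and> dd\<close> over a rectangle is determined by the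
  boundary values of \<open>c\<close> and \<open>d\<close>.\<close>

lemma discrete_Stokes:
  fixes c d :: "nat \<Rightarrow> nat \<Rightarrow> int"
  assumes "\<And>j. j \<le> n \<Longrightarrow> c 0 j = 1" "\<And>j. j \<le> n \<Longrightarrow> c (Suc n) j = 0"
    and "\<And>i. i \<le> n \<Longrightarrow> d i 0 = 1" "\<And>i. i \<le> n \<Longrightarrow> d i (Suc n) = 0"
    and hor: "\<And>i j. i \<le> n \<Longrightarrow> j \<le> n \<Longrightarrow> (c (Suc i) j - c i j) * (d i (Suc j) - d i j) = 0"
    and ver: "\<And>i j. i < n \<Longrightarrow> j < n \<Longrightarrow>
      (c (Suc i) (Suc j) - c (Suc i) j) * (d (Suc i) (Suc j) - d i (Suc j)) = 0"
  shows False
proof -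
  let ?b = "\<lambda>j i. c i (Suc j) - c i j"
  have "0 = (\<Sum>i\<le>n. \<Sum>j\<le>n. (c (Suc i) j - c i j) * (d i (Suc j) - d i j))"
    by (rule sum.neutral[symmetric], intro ballI sum.neutral hor) auto
  \<comment> \<open>Summation by parts in \<open>j\<close>: the boundary values of \<open>d\<close>
    leave only the term of the bottom row, besides mixed differences of \<open>c\<close> times
    interior values of \<open>d\<close>.\<close>
  also have "\<dots> = (\<Sum>i\<le>n. c i 0 - c (Suc i) 0 - (\<Sum>j<n. (?b j (Suc i) - ?b j i) * d i (Suc j)))"
  proof (rule sum.cong)
    fix i assume "i \<in> {..n}"
    then have "i \<le> n" by simp
    have "(\<Sum>j<n. (c (Suc i) (Suc j) - c i (Suc j) - (c (Suc i) j - c i j)) * d i (Suc j)) =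
        (\<Sum>j<n. (?b j (Suc i) - ?b j i) * d i (Suc j))"
      by (rule sum.cong) (simp_all add: algebra_simps)
    then show "(\<Sum>j\<le>n. (c (Suc i) j - c i j) * (d i (Suc j) - d i j)) =
        c i 0 - c (Suc i) 0 - (\<Sum>j<n. (?b j (Suc i) - ?b j i) * d i (Suc j))"
      unfolding summation_by_parts[of "\<lambda>j. c (Suc i) j - c i j"]
      using assms(3,4)[OF \<open>i \<le> n\<close>] by simp
  qed simp
  also have "\<dots> = (\<Sum>i\<le>n. c i 0 - c (Suc i) 0) - (\<Sum>i\<le>n. \<Sum>j<n. (?b j (Suc i) - ?b j i) * d i (Suc j))"
    by (rule sum_subtractf)
  also have "(\<Sum>i\<le>n. c i 0 - c (Suc i) 0) = c 0 0 - c (Suc n) 0"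
    by (rule sum_telescope)
  also have "\<dots> = 1" using assms by simp
  also have "(\<Sum>i\<le>n. \<Sum>j<n. (?b j (Suc i) - ?b j i) * d i (Suc j)) =
      (\<Sum>j<n. \<Sum>i\<le>n. (?b j (Suc i) - ?b j i) * d i (Suc j))"
    by (rule sum.swap)
  also have "\<dots> = (\<Sum>j<n. 0)"
  proof (rule sum.cong)
    fix j assume "j \<in> {..<n}"
    then have j: "j < n" by simp
    \<comment> \<open>Summation by parts in \<open>i\<close>: the boundary terms vanish because
      \<open>c\<close> is constant on the left and on the right side.\<close>
    have "(\<Sum>i\<le>n. (?b j (Suc i) - ?b j i) * d i (Suc j)) =
      ?b j (Suc n) * d n (Suc j) - ?b j 0 * d 0 (Suc j) - (\<Sum>i<n. ?b j (Suc i) * (d (Suc i) (Suc j) - d i (Suc j)))"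
      by (rule summation_by_parts')
    also have "(\<Sum>i<n. ?b j (Suc i) * (d (Suc i) (Suc j) - d i (Suc j))) = 0"
      by (intro sum.neutral ballI ver) (use j in auto)
    finally show "(\<Sum>i\<le>n. (?b j (Suc i) - ?b j i) * d i (Suc j)) = 0"
      using j assms by simp
  qed simp
  finally show False by simp
qed

text \<open>The edge of the dual lattice that crosses \<open>e\<close>, composed with the reflection in the diagonal that maps
  the dual of the rectangle \<open>[0, n + 1] \<times> [0, n]\<close> back to this rectangle.\<close>

definition dual_edge :: "(int \<times> int) set \<Rightarrow> (int \<times> int) set" where
  "dual_edge e = (let i = Min (fst ` e); j = Min (snd ` e) in
    if card (snd ` e) = 1 then {(j, i), (j + 1, i)} else {(j + 1, i - 1), (j + 1, i)})"

lemma dual_edge_hor: "dual_edge {(i, j), (i + 1, j)} = {(j, i), (j + 1, i)}"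
  unfolding dual_edge_def by simp

lemma dual_edge_ver: "dual_edge {(i, j), (i, j + 1)} = {(j + 1, i - 1), (j + 1, i)}"
  unfolding dual_edge_def by simp

lemma lattice_edge_cases:
  assumes "e \<in> lattice_edges"
  obtains (hor) i j where "e = {(i, j), (i + 1, j)}" | (ver) i j where "e = {(i, j), (i, j + 1)}"
proof -
  obtain x1 x2 y1 y2 where e: "e = {(x1, x2), (y1, y2)}" and "\<bar>x1 - y1\<bar> + \<bar>x2 - y2\<bar> = 1"
    using assms unfolding lattice_edges_def by auto
  then consider "y1 = x1 + 1" "y2 = x2" | "x1 = y1 + 1" "y2 = x2" | "y1 = x1" "y2 = x2 + 1" | "y1 = x1" "x2 = y2 + 1"
    by linarith
  then show ?thesis using hor ver unfolding e by cases (auto simp: insert_commute)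
qed

lemma dual_edge_lattice: "e \<in> lattice_edges \<Longrightarrow> dual_edge e \<in> lattice_edges"
  by (erule lattice_edge_cases) (simp_all add: dual_edge_hor dual_edge_ver lattice_edge_iff adj_def)

lemma dual_edge_involution: "e \<in> lattice_edges \<Longrightarrow> dual_edge (dual_edge e) = e"
proof (erule lattice_edge_cases)
  fix i j assume "e = {(i, j), (i, j + 1)}"
  then show ?thesis using dual_edge_ver[of "j + 1" "i - 1"] by (simp add: dual_edge_ver)
qed (simp add: dual_edge_hor)

definition lr :: "int \<Rightarrow> int \<Rightarrow> int \<Rightarrow> int \<Rightarrow> ((int \<times> int) set \<Rightarrow> bool) \<Rightarrow> bool" where
  "lr a b c d = crossing (rect a b c d) {v. fst v = a} {v. fst v = b}"

definition tb :: "int \<Rightarrow> int \<Rightarrow> int \<Rightarrow> int \<Rightarrow> ((int \<times> int) set \<Rightarrow> bool) \<Rightarrow> bool" where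
  "tb a b c d = crossing (rect a b c d) {v. snd v = c} {v. snd v = d}"

text \<open>If both crossings fail, the indicators \<open>c\<close> and \<open>d\<close> of being
  joined to the left side, in \<open>\<omega>\<close> and (with transposed coordinates) in
  \<open>\<omega>'\<close>, have the boundary values of \<open>discrete_Stokes\<close>. Each edge
  kills one factor: an open edge makes \<open>c\<close> agree at its ends, a closed one makes
  \<open>d\<close> agree at the ends of its dual.\<close>

lemma lr_or_dual_lr:
  fixes n :: nat and \<omega> :: "(int \<times> int) set \<Rightarrow> bool"
  defines "\<omega>' \<equiv> \<lambda>e. \<not> \<omega> (dual_edge e)"
  shows "lr 0 (int n + 1) 0 (int n) \<omega> \<or> lr 0 (int n + 1) 0 (int n) \<omega>'"
proof (rule ccontr)
  assume no: "\<not> ?thesis"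
  let ?R = "rect 0 (int n + 1) 0 (int n)"
  define L where "L \<omega> v \<longleftrightarrow> (\<exists>u. fst u = 0 \<and> conn ?R \<omega> u v)" for \<omega> v
  have L_edge: "L \<omega> u \<longleftrightarrow> L \<omega> v" if "u \<in> ?R" "v \<in> ?R" "adj u v" "\<omega> {u, v}" for u v \<omega>
    using that unfolding L_def by (metis conn_step adj_sym insert_commute)
  have L0: "L \<omega> (0, j)" if "0 \<le> j" "j \<le> int n" for j \<omega>
    unfolding L_def using that by (intro exI[of _ "(0, j)"]) (auto simp: in_rect intro: conn_refl)
  have Ln: "\<not> L \<omega> (int n + 1, j)" "\<not> L \<omega>' (int n + 1, j)" for j
    using no unfolding L_def lr_def crossing_def by auto
  define c :: "nat \<Rightarrow> nat \<Rightarrow> int" where "c i j = of_bool (L \<omega> (int i, int j))" for i j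
  define d :: "nat \<Rightarrow> nat \<Rightarrow> int" where "d i j = of_bool (L \<omega>' (int j, int i))" for i j
  show False
  proof (rule discrete_Stokes[of n c d])
    fix i j assume ij: "i \<le> n" "j \<le> n"
    show "(c (Suc i) j - c i j) * (d i (Suc j) - d i j) = 0"
    proof (cases "\<omega> {(int i, int j), (int i + 1, int j)}")
      case True
      then have "L \<omega> (int i, int j) \<longleftrightarrow> L \<omega> (int i + 1, int j)"
        using ij by (intro L_edge) (auto simp: in_rect adj_def)
      then show ?thesis by (simp add: c_def add.commute)
    next
      case False
      then have "\<omega>' {(int j, int i), (int j + 1, int i)}" unfolding \<omega>'_def dual_edge_hor .
      then have "L \<omega>' (int j, int i) \<longleftrightarrow> L \<omega>' (int j + 1, int i)"
        using ij by (intro L_edge) (auto simp: in_rect adj_def)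
      then show ?thesis by (simp add: d_def add.commute)
    qed
  next
    fix i j assume ij: "i < n" "j < n"
    show "(c (Suc i) (Suc j) - c (Suc i) j) * (d (Suc i) (Suc j) - d i (Suc j)) = 0"
    proof (cases "\<omega> {(int i + 1, int j), (int i + 1, int j + 1)}")
      case True
      then have "L \<omega> (int i + 1, int j) \<longleftrightarrow> L \<omega> (int i + 1, int j + 1)"
        using ij by (intro L_edge) (auto simp: in_rect adj_def)
      then show ?thesis by (simp add: c_def add.commute)
    next
      case False
      then have "\<omega>' {(int j + 1, int i), (int j + 1, int i + 1)}"
        unfolding \<omega>'_def dual_edge_ver by simp
      then have "L \<omega>' (int j + 1, int i) \<longleftrightarrow> L \<omega>' (int j + 1, int i + 1)"
        using ij by (intro L_edge) (auto simp: in_rect adj_def)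
      then show ?thesis by (simp add: d_def add.commute)
    qed
  qed (use Ln in \<open>auto simp: c_def d_def L0 add.commute\<close>)
qed

lemma up_event_lr: "up_event (lr a b c d)" and up_event_tb: "up_event (tb a b c d)"
  unfolding lr_def tb_def by (simp_all add: up_event_crossing)

text \<open>Flipping all edges and passing to dual edges preserves the probability of the crossing,
  and one of the two versions always occurs.\<close>

lemma pr_lr_wide:
  fixes n :: nat
  shows "1 / 2 \<le> pr (lr 0 (int n + 1) 0 (int n))"
proof -
  let ?R = "rect 0 (int n + 1) 0 (int n)" and ?P = "lr 0 (int n + 1) 0 (int n)"
  let ?Q = "\<lambda>\<omega>. ?P (\<lambda>e. \<not> \<omega> (dual_edge e))"
  have fin: "finite (edges_in ?R)" by (simp add: finite_edges_in)
  have det: "determined (edges_in ?R) ?P" unfolding lr_def by (rule crossing_determined)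
  then have det': "determined (edges_in ?R) (\<lambda>\<omega>. ?P (\<lambda>e. \<not> \<omega> e))" unfolding determined_def by simp
  have detQ: "determined (dual_edge ` edges_in ?R) ?Q"
    using det unfolding determined_def by simp
  have lat: "dual_edge ` edges_in ?R \<subseteq> lattice_edges"
    using edges_in_lattice dual_edge_lattice by blast
  have "inj_on dual_edge (edges_in ?R)"
    by (rule inj_on_inverseI[of _ dual_edge]) (use edges_in_lattice dual_edge_involution in blast)
  then have "pr ?Q = pr ?P"
    using pr_map[OF fin edges_in_lattice det' _ lat] pr_compl[OF fin edges_in_lattice det] by simp
  moreover have "event ?P" by (rule up_event_event[OF up_event_lr])
  moreover have "event ?Q" by (rule finitary_event[OF finitaryI[OF _ lat detQ]]) (simp add: fin)
  moreover have "(\<lambda>\<omega>. ?P \<omega> \<or> ?Q \<omega>) = (\<lambda>_. True)" using lr_or_dual_lr by blast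
  ultimately show ?thesis using pr_disj[of ?P ?Q] by (simp add: pr_True)
qed

lemma arg_cong4: "a = a' \<Longrightarrow> b = b' \<Longrightarrow> c = c' \<Longrightarrow> d = d' \<Longrightarrow> f a b c d = f a' b' c' d'"
  by simp

lemma lr_shift: "pr (lr (a + k) (b + k) (c + l) (d + l)) = pr (lr a b c d)"
  unfolding lr_def by (rule pr_crossing_affine[of _ 1 1 _ "-k" "-l"]) (auto simp: in_rect)

lemma pr_tb: "pr (tb a b c d) = pr (lr c d a b)"
  unfolding lr_def tb_def by (rule pr_crossing_affine_swap[of _ 1 1 _ 0 0]) (auto simp: in_rect)

lemma lr_shorten:
  assumes "lr a b c d \<omega>" "a \<le> b'" "b' \<le> b"
  shows "lr a b' c d \<omega>"
proof -
  obtain x y where xy: "fst x = a" "fst y = b" "conn (rect a b c d) \<omega> x y"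
    using assms(1) unfolding lr_def crossing_def by auto
  have "\<exists>w. - fst w = - b' \<and> conn (rect a b c d \<inter> {v. - b' \<le> - fst v}) \<omega> x w"
    by (rule conn_level[OF xy(3)]) (use assms xy in \<open>auto simp: adj_def\<close>)
  then obtain w where w: "- fst w = - b'" "conn (rect a b c d \<inter> {v. - b' \<le> - fst v}) \<omega> x w"
    by blast
  have "conn (rect a b' c d) \<omega> x w"
    by (rule conn_subset[OF w(2)]) (use assms in \<open>auto simp: in_rect\<close>)
  then show ?thesis using xy(1) w(1) unfolding lr_def crossing_def
    by (intro bexI[of _ x] bexI[of _ w]) auto
qed

lemma pr_lr_shorten: "a \<le> b' \<Longrightarrow> b' \<le> b \<Longrightarrow> pr (lr a b c d) \<le> pr (lr a b' c d)"
  by (rule pr_mono) (auto intro: up_event_event up_event_lr lr_shorten)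

lemma pr_lr_square:
  assumes "b - a = d - c" "a \<le> b"
  shows "1 / 2 \<le> pr (lr a b c d)"
proof -
  define n where "n = nat (b - a)"
  have "1 / 2 \<le> pr (lr 0 (int n) 0 (int n))"
    using pr_lr_wide[of n] pr_lr_shorten[of 0 "int n" "int n + 1" 0 "int n"] by simp
  also have "\<dots> = pr (lr (0 + a) (int n + a) (0 + c) (int n + c))" by (rule lr_shift[symmetric])
  also have "\<dots> = pr (lr a b c d)"
    by (rule arg_cong[where f = pr], rule arg_cong4[where f = lr]) (use assms in \<open>auto simp: n_def\<close>)
  finally show ?thesis .
qed

lemma pr_tb_square: "b - a = d - c \<Longrightarrow> a \<le> b \<Longrightarrow> 1 / 2 \<le> pr (tb a b c d)"
  unfolding pr_tb by (rule pr_lr_square) auto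

section \<open>Open circuits from long crossings\<close>

definition box :: "int \<times> int \<Rightarrow> int \<Rightarrow> (int \<times> int) set" where
  "box z n = rect (fst z - n) (fst z + n) (snd z - n) (snd z + n)"

lemma finite_box [simp]: "finite (box z n)"
  unfolding box_def by simp

lemma in_box: "v \<in> box z n \<longleftrightarrow> \<bar>fst v - fst z\<bar> \<le> n \<and> \<bar>snd v - snd z\<bar> \<le> n"
  unfolding box_def in_rect by auto

lemma conn_meet:
  assumes "{v. conn D1 \<omega> x v} \<inter> {v. conn D2 \<omega> u v} \<noteq> {}" "D1 \<subseteq> D" "D2 \<subseteq> D"
  shows "conn D \<omega> x u"
proof -
  obtain w where "conn D1 \<omega> x w" "conn D2 \<omega> u w" using assms(1) by blast
  then have "conn D \<omega> x w" "conn D \<omega> u w" using assms(2,3) by (auto intro: conn_subset)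
  then show ?thesis using conn_sym conn_trans by blast
qed

lemma conn_reach_subset: "{v. conn D \<omega> x v} \<subseteq> D"
  using conn_in(2) by blast

lemma lr_tb_conn:
  assumes "conn D1 \<omega> x y" "D1 \<subseteq> rect a b c d" "fst x = a" "fst y = b"
    and "conn D2 \<omega> u v" "D2 \<subseteq> rect a b c d" "snd u = c" "snd v = d"
    and "D1 \<subseteq> D" "D2 \<subseteq> D"
  shows "conn D \<omega> x u"
proof (rule conn_meet[OF _ assms(9,10)])
  show "{v. conn D1 \<omega> x v} \<inter> {v. conn D2 \<omega> u v} \<noteq> {}"
    using assms conn_reach_subset
    by (intro paths_meet[OF conn_joined[OF assms(1)] _ assms(3,4) conn_joined[OF assms(5)] _ assms(7,8)]) blast+
qed

lemma lr_extend:
  assumes "lr a b c d \<omega>" "lr a' b' c d \<omega>" "tb a' b c d \<omega>" "a \<le> a'" "b \<le> b'"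
  shows "lr a b' c d \<omega>"
proof -
  obtain x y where 1: "fst x = a" "fst y = b" "conn (rect a b c d) \<omega> x y"
    using assms(1) unfolding lr_def crossing_def by auto
  obtain x' y' where 2: "fst x' = a'" "fst y' = b'" "conn (rect a' b' c d) \<omega> x' y'"
    using assms(2) unfolding lr_def crossing_def by auto
  obtain u v where 3: "snd u = c" "snd v = d" "conn (rect a' b c d) \<omega> u v"
    using assms(3) unfolding tb_def crossing_def by auto
  have sub: "rect a b c d \<subseteq> rect a b' c d" "rect a' b' c d \<subseteq> rect a b' c d"
    "rect a' b c d \<subseteq> rect a b c d" "rect a' b c d \<subseteq> rect a' b' c d" "rect a' b c d \<subseteq> rect a b' c d"
    using assms(4,5) by (auto simp: in_rect)
  have "conn (rect a b' c d) \<omega> x u"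
    using lr_tb_conn[OF 1(3) order_refl 1(1,2) 3(3) sub(3) 3(1,2) sub(1) sub(5)] .
  moreover have "conn (rect a b' c d) \<omega> x' u"
    using lr_tb_conn[OF 2(3) order_refl 2(1,2) 3(3) sub(4) 3(1,2) sub(2) sub(5)] .
  moreover have "conn (rect a b' c d) \<omega> x' y'" using conn_subset[OF 2(3) sub(2)] .
  ultimately have "conn (rect a b' c d) \<omega> x y'" using conn_sym conn_trans by blast
  then show ?thesis using 1(1) 2(2) unfolding lr_def crossing_def
    by (intro bexI[of _ x] bexI[of _ y']) auto
qed

text \<open>Two \<open>l\<close> by \<open>h\<close> rectangles, shifted by \<open>l - h\<close>,
  overlap in an \<open>h\<close> by \<open>h\<close> square, whose vertical crossing costs the
  factor \<open>1 / 2\<close>. The excess \<open>l - h\<close> of length over height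
  doubles.\<close>

lemma pr_lr_double:
  assumes "p \<le> pr (lr 0 l 0 h)" "0 \<le> p" "0 \<le> h" "h \<le> l"
  shows "p\<^sup>2 / 2 \<le> pr (lr 0 (2 * l - h) 0 h)"
proof -
  have "p \<le> pr (lr (l - h) (2 * l - h) 0 h)"
    using lr_shift[of 0 "l - h" l 0 0 h] assms(1) by (simp add: algebra_simps)
  then have "p * p \<le> pr (\<lambda>\<omega>. lr 0 l 0 h \<omega> \<and> lr (l - h) (2 * l - h) 0 h \<omega>)"
    by (intro Harris_ge up_event_lr assms)
  then have "p * p * (1 / 2) \<le> pr (\<lambda>\<omega>. (lr 0 l 0 h \<omega> \<and> lr (l - h) (2 * l - h) 0 h \<omega>) \<and> tb (l - h) l 0 h \<omega>)"
    by (rule Harris_ge[rotated 2])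
      (use assms in \<open>auto simp del: le_divide_eq_numeral1 divide_le_eq_numeral1 intro!: up_event_lr up_event_tb up_event_conj pr_tb_square\<close>)
  also have "\<dots> \<le> pr (lr 0 (2 * l - h) 0 h)"
    by (rule pr_mono) (use assms in \<open>auto intro: up_event_event up_event_lr lr_extend\<close>)
  finally show ?thesis by (simp add: power2_eq_square)
qed

text \<open>An open cluster inside \<open>box z (3 * n)\<close> that blocks all lattice paths, open or not, which cross the annulus
  \<open>box z (3 * n) - box z n\<close>. This is how an open circuit in the annulus will be used.\<close>

definition circ :: "int \<times> int \<Rightarrow> int \<Rightarrow> ((int \<times> int) set \<Rightarrow> bool) \<Rightarrow> bool" where
  "circ z n \<omega> \<longleftrightarrow> (\<exists>x. \<forall>P u v. joined P u v \<longrightarrow> u \<in> box z n \<longrightarrow> v \<notin> box z (3 * n) \<longrightarrow>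
     (\<exists>w\<in>P. conn (box z (3 * n)) \<omega> x w))"

lemma up_event_circ: "up_event (circ z n)"
  unfolding up_event_def
proof
  have "determined (edges_in (box z (3 * n))) (circ z n)"
    unfolding determined_def
  proof (intro allI impI)
    fix \<omega> \<omega>' :: "(int \<times> int) set \<Rightarrow> bool" assume "\<forall>e\<in>edges_in (box z (3 * n)). \<omega> e = \<omega>' e"
    then have "conn (box z (3 * n)) \<omega> x y = conn (box z (3 * n)) \<omega>' x y" for x y
      by (intro determinedD[OF conn_determined]) simp
    then show "circ z n \<omega> = circ z n \<omega>'" unfolding circ_def by simp
  qed
  then show "finitary (circ z n)"
    by (rule finitaryI[OF finite_edges_in[OF finite_box] edges_in_lattice])
  show "increasing (circ z n)"
    unfolding increasing_def
  proof (intro allI impI)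
    fix \<omega> \<omega>' :: "(int \<times> int) set \<Rightarrow> bool" assume *: "\<omega> \<le> \<omega>'" and "circ z n \<omega>"
    then obtain x where x: "\<And>P u v. joined P u v \<Longrightarrow> u \<in> box z n \<Longrightarrow> v \<notin> box z (3 * n) \<Longrightarrow>
     (\<exists>w\<in>P. conn (box z (3 * n)) \<omega> x w)" unfolding circ_def by blast
    have up: "conn (box z (3 * n)) \<omega> x w \<Longrightarrow> conn (box z (3 * n)) \<omega>' x w" for w
      by (erule conn_mono) (use * in \<open>auto simp: le_fun_def\<close>)
    show "circ z n \<omega>'" unfolding circ_def
    proof (intro exI[of _ x] allI impI)
      fix P u v assume "joined P u v" "u \<in> box z n" "v \<notin> box z (3 * n)"
      from x[OF this] up show "\<exists>w\<in>P. conn (box z (3 * n)) \<omega>' x w" by blast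
    qed
  qed
qed

text \<open>The vertex \<open>x\<close> depends on \<open>\<omega>\<close> only, so all open
  connections across the annulus are joined to the same cluster. This is how several arms or
  crossings are glued at once.\<close>

lemma circ_hit:
  assumes "circ z n \<omega>"
  obtains x where "\<And>D D' u v. conn D \<omega> u v \<Longrightarrow> u \<in> box z n \<Longrightarrow> v \<notin> box z (3 * n) \<Longrightarrow>
    D \<subseteq> D' \<Longrightarrow> box z (3 * n) \<subseteq> D' \<Longrightarrow> conn D' \<omega> x u"
proof -
  obtain x where x: "\<And>P u v. joined P u v \<Longrightarrow> u \<in> box z n \<Longrightarrow> v \<notin> box z (3 * n) \<Longrightarrow>
     (\<exists>w\<in>P. conn (box z (3 * n)) \<omega> x w)" using assms unfolding circ_def by blast
  have "conn D' \<omega> x u"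
    if c: "conn D \<omega> u v" and "u \<in> box z n" "v \<notin> box z (3 * n)" and sub: "D \<subseteq> D'" "box z (3 * n) \<subseteq> D'" for D D' u v
  proof -
    have "{w. conn (box z (3 * n)) \<omega> x w} \<inter> {w. conn D \<omega> u w} \<noteq> {}"
      using x[OF conn_joined[OF c] that(2,3)] by auto
    from conn_meet[OF this sub(2,1)] show ?thesis .
  qed
  then show ?thesis by (rule that)
qed

lemma sup_dist_lipschitz:
  "adj u v \<Longrightarrow> \<bar>- max \<bar>fst u - fst z\<bar> \<bar>snd u - snd z\<bar> - - max \<bar>fst v - fst z\<bar> \<bar>snd v - snd z\<bar>\<bar> \<le> 1"
  unfolding adj_def by (smt (verit))

text \<open>The left crossing meets both horizontal ones and the right crossing meets the top one,
  so all four lie in one cluster. A path leaving \<open>box z (3 * n)\<close> hits one of its four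
  sides, and its part between that side and distance \<open>n\<close> crosses the adjacent strip in
  the short direction, against the long open crossing.\<close>

lemma circ_of_crossings:
  assumes "0 \<le> n"
    and top: "lr (fst z - 3 * n) (fst z + 3 * n) (snd z + n) (snd z + 3 * n) \<omega>"
    and bot: "lr (fst z - 3 * n) (fst z + 3 * n) (snd z - 3 * n) (snd z - n) \<omega>"
    and left: "tb (fst z - 3 * n) (fst z - n) (snd z - 3 * n) (snd z + 3 * n) \<omega>"
    and right: "tb (fst z + n) (fst z + 3 * n) (snd z - 3 * n) (snd z + 3 * n) \<omega>"
  shows "circ z n \<omega>"
proof -
  let ?a = "fst z - 3 * n" and ?b = "fst z + 3 * n" and ?c = "snd z - 3 * n" and ?d = "snd z + 3 * n"
  let ?B = "box z (3 * n)"
  have B: "?B = rect ?a ?b ?c ?d" unfolding box_def by simp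
  let ?T = "rect ?a ?b (snd z + n) ?d" and ?Bo = "rect ?a ?b ?c (snd z - n)"
    and ?L = "rect ?a (fst z - n) ?c ?d" and ?R = "rect (fst z + n) ?b ?c ?d"
  obtain t t' where t: "fst t = ?a" "fst t' = ?b" "conn ?T \<omega> t t'"
    using top unfolding lr_def crossing_def by auto
  obtain s s' where s: "fst s = ?a" "fst s' = ?b" "conn ?Bo \<omega> s s'"
    using bot unfolding lr_def crossing_def by auto
  obtain l l' where l: "snd l = ?c" "snd l' = ?d" "conn ?L \<omega> l l'"
    using left unfolding tb_def crossing_def by auto
  obtain r r' where r: "snd r = ?c" "snd r' = ?d" "conn ?R \<omega> r r'"
    using right unfolding tb_def crossing_def by auto
  have sub: "?T \<subseteq> rect ?a ?b ?c ?d" "?Bo \<subseteq> rect ?a ?b ?c ?d" "?L \<subseteq> rect ?a ?b ?c ?d" "?R \<subseteq> rect ?a ?b ?c ?d"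
    using assms(1) by (auto simp: in_rect)
  have tl: "conn ?B \<omega> t l" unfolding B by (rule lr_tb_conn[OF t(3) sub(1) t(1,2) l(3) sub(3) l(1,2) sub(1,3)])
  have "conn ?B \<omega> t r" unfolding B by (rule lr_tb_conn[OF t(3) sub(1) t(1,2) r(3) sub(4) r(1,2) sub(1,4)])
  have "conn ?B \<omega> s l" unfolding B by (rule lr_tb_conn[OF s(3) sub(2) s(1,2) l(3) sub(3) l(1,2) sub(2,3)])
  then have ts: "conn ?B \<omega> t s" using tl conn_sym conn_trans by blast
  have "t \<in> ?B" using conn_in(1)[OF tl] .
  have hit: "\<exists>w\<in>P. conn ?B \<omega> t w"
    if "conn ?B \<omega> t g" "D \<subseteq> ?B" "{v. conn D \<omega> g v} \<inter> P' \<noteq> {}" "P' \<subseteq> P" for g D P P'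
  proof -
    obtain w where "w \<in> P" "conn D \<omega> g w" using \<open>_ \<noteq> {}\<close> \<open>P' \<subseteq> P\<close> by blast
    then have "conn ?B \<omega> g w" using conn_subset \<open>D \<subseteq> ?B\<close> by blast
    then show ?thesis using conn_trans \<open>conn ?B \<omega> t g\<close> \<open>w \<in> P\<close> by blast
  qed
  have "\<exists>w\<in>P. conn ?B \<omega> t w" if P: "joined P u v" and u: "u \<in> box z n" and v: "v \<notin> ?B" for P u v
  proof -
    let ?h = "\<lambda>w. - max \<bar>fst w - fst z\<bar> \<bar>snd w - snd z\<bar>"
    have "\<exists>w. ?h w = - 3 * n \<and> joined (P \<inter> {v. - 3 * n \<le> ?h v}) u w"
      by (rule conn_level[OF P sup_dist_lipschitz]) (use u v \<open>0 \<le> n\<close> in \<open>auto simp: in_box\<close>)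
    then obtain w where w: "?h w = - 3 * n" "joined (P \<inter> {v. - 3 * n \<le> ?h v}) u w" by blast
    have "P \<inter> {v. - 3 * n \<le> ?h v} = P \<inter> ?B" by (auto simp: in_box)
    with w(2) have c: "joined (P \<inter> ?B) w u" using conn_sym by simp
    have wB: "w \<in> ?B" using conn_in(1)[OF c] by blast
    note bnd = u wB w(1)
    consider "snd w = ?d" | "snd w = ?c" | "fst w = ?a" | "fst w = ?b"
      using w(1) by linarith
    then show ?thesis
    proof cases
      case 1
      have "\<exists>w'. snd w' = snd z + n \<and> joined (P \<inter> ?B \<inter> {v. snd z + n \<le> snd v}) w w'"
        by (rule conn_level[OF c]) (use 1 bnd in \<open>auto simp: in_box adj_def\<close>)
      then obtain w' where w': "snd w' = snd z + n" "joined (P \<inter> ?B \<inter> {v. snd z + n \<le> snd v}) w w'" by blast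
      have "{v. conn ?T \<omega> t v} \<inter> (P \<inter> ?B \<inter> {v. snd z + n \<le> snd v}) \<noteq> {}"
        by (rule paths_meet[OF conn_joined[OF t(3)] conn_reach_subset t(1,2) conn_sym[OF w'(2)] _ w'(1) 1])
          (auto simp: in_rect in_box)
      then show ?thesis using sub(1) B by (intro hit[OF conn_refl[OF \<open>t \<in> ?B\<close>]]) auto
    next
      case 2
      have "\<exists>w'. - snd w' = - (snd z - n) \<and> joined (P \<inter> ?B \<inter> {v. - (snd z - n) \<le> - snd v}) w w'"
        by (rule conn_level[OF c]) (use 2 bnd in \<open>auto simp: in_box adj_def\<close>)
      then obtain w' where "- snd w' = - (snd z - n)" and w'2: "joined (P \<inter> ?B \<inter> {v. - (snd z - n) \<le> - snd v}) w w'" by blast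
      then have w'1: "snd w' = snd z - n" by linarith
      have "{v. conn ?Bo \<omega> s v} \<inter> (P \<inter> ?B \<inter> {v. - (snd z - n) \<le> - snd v}) \<noteq> {}"
        by (rule paths_meet[OF conn_joined[OF s(3)] conn_reach_subset s(1,2) w'2 _ 2 w'1])
          (auto simp: in_rect in_box)
      then show ?thesis using sub(2) B by (intro hit[OF ts]) auto
    next
      case 3
      have "\<exists>w'. - fst w' = - (fst z - n) \<and> joined (P \<inter> ?B \<inter> {v. - (fst z - n) \<le> - fst v}) w w'"
        by (rule conn_level[OF c]) (use 3 bnd in \<open>auto simp: in_box adj_def\<close>)
      then obtain w' where "- fst w' = - (fst z - n)" and w'2: "joined (P \<inter> ?B \<inter> {v. - (fst z - n) \<le> - fst v}) w w'" by blast
      then have w'1: "fst w' = fst z - n" by linarith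
      have "(P \<inter> ?B \<inter> {v. - (fst z - n) \<le> - fst v}) \<inter> {v. conn ?L \<omega> l v} \<noteq> {}"
        by (rule paths_meet[OF w'2 _ 3 w'1 conn_joined[OF l(3)] conn_reach_subset l(1,2)])
          (auto simp: in_rect in_box)
      then have "{v. conn ?L \<omega> l v} \<inter> (P \<inter> ?B \<inter> {v. - (fst z - n) \<le> - fst v}) \<noteq> {}" by (simp only: Int_commute not_False_eq_True)
      then show ?thesis using sub(3) B by (intro hit[OF tl]) auto
    next
      case 4
      have "\<exists>w'. fst w' = fst z + n \<and> joined (P \<inter> ?B \<inter> {v. fst z + n \<le> fst v}) w w'"
        by (rule conn_level[OF c]) (use 4 bnd in \<open>auto simp: in_box adj_def\<close>)
      then obtain w' where w': "fst w' = fst z + n" "joined (P \<inter> ?B \<inter> {v. fst z + n \<le> fst v}) w w'" by blast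
      have "(P \<inter> ?B \<inter> {v. fst z + n \<le> fst v}) \<inter> {v. conn ?R \<omega> r v} \<noteq> {}"
        by (rule paths_meet[OF conn_sym[OF w'(2)] _ w'(1) 4 conn_joined[OF r(3)] conn_reach_subset r(1,2)])
          (auto simp: in_rect in_box)
      then have "{v. conn ?R \<omega> r v} \<inter> (P \<inter> ?B \<inter> {v. fst z + n \<le> fst v}) \<noteq> {}" by (simp only: Int_commute not_False_eq_True)
      then show ?thesis using sub(4) B by (intro hit[OF \<open>conn ?B \<omega> t r\<close>]) auto
    qed
  qed
  then show ?thesis unfolding circ_def by blast
qed

text \<open>Three uses of \<open>pr_lr_double\<close>, then the fourth power for the four crossings
  around an annulus.\<close>

definition circ_const :: "real \<Rightarrow> real" where
  "circ_const p = ((((p\<^sup>2 / 2)\<^sup>2 / 2)\<^sup>2 / 2)\<^sup>2)\<^sup>2"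

lemma circ_const_pos: "0 < p \<Longrightarrow> 0 < circ_const p"
  unfolding circ_const_def by simp

text \<open>Three doublings turn the excess \<open>e\<close> into \<open>8 * e\<close>, which is at
  least \<open>4 * n\<close>; this gives the \<open>6 * n\<close> by \<open>2 * n\<close> strips of
  the annulus.\<close>

lemma pr_circ_of_wide_lr:
  assumes "p \<le> pr (lr 0 (2 * n + e) 0 (2 * n))" "0 \<le> p" "0 \<le> n" "n \<le> 2 * e"
  shows "circ_const p \<le> pr (circ z n)"
proof -
  define q where "q = ((p\<^sup>2 / 2)\<^sup>2 / 2)\<^sup>2 / 2"
  have q0: "0 \<le> q" unfolding q_def by simp
  have "p\<^sup>2 / 2 \<le> pr (lr 0 (2 * n + 2 * e) 0 (2 * n))"
    using pr_lr_double[OF assms(1,2)] assms by (simp add: algebra_simps)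
  then have "(p\<^sup>2 / 2)\<^sup>2 / 2 \<le> pr (lr 0 (2 * n + 4 * e) 0 (2 * n))"
    using pr_lr_double[of "p\<^sup>2 / 2" "2 * n + 2 * e" "2 * n"] assms by (simp add: algebra_simps)
  then have "q \<le> pr (lr 0 (2 * n + 8 * e) 0 (2 * n))"
    using pr_lr_double[of "(p\<^sup>2 / 2)\<^sup>2 / 2" "2 * n + 4 * e" "2 * n"] assms by (simp add: algebra_simps q_def)
  also have "\<dots> \<le> pr (lr 0 (6 * n) 0 (2 * n))"
    by (rule pr_lr_shorten) (use assms in auto)
  finally have q: "q \<le> pr (lr 0 (6 * n) 0 (2 * n))" .
  have lr: "q \<le> pr (lr a b c d)" if "b - a = 6 * n" "d - c = 2 * n" for a b c d
  proof -
    have "pr (lr (0 + a) (6 * n + a) (0 + c) (2 * n + c)) = pr (lr 0 (6 * n) 0 (2 * n))" by (rule lr_shift)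
    moreover have "6 * n + a = b" "2 * n + c = d" using that by auto
    ultimately show ?thesis using q by simp
  qed
  have tb: "q \<le> pr (tb c d a b)" if "b - a = 6 * n" "d - c = 2 * n" for a b c d
    unfolding pr_tb by (rule lr[OF that])
  let ?P1 = "lr (fst z - 3 * n) (fst z + 3 * n) (snd z + n) (snd z + 3 * n)"
  let ?P2 = "lr (fst z - 3 * n) (fst z + 3 * n) (snd z - 3 * n) (snd z - n)"
  let ?P3 = "tb (fst z - 3 * n) (fst z - n) (snd z - 3 * n) (snd z + 3 * n)"
  let ?P4 = "tb (fst z + n) (fst z + 3 * n) (snd z - 3 * n) (snd z + 3 * n)"
  have "(q * q) * (q * q) \<le> pr (\<lambda>\<omega>. (?P1 \<omega> \<and> ?P2 \<omega>) \<and> (?P3 \<omega> \<and> ?P4 \<omega>))"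
    by (intro Harris_ge up_event_conj up_event_lr up_event_tb lr tb q0 mult_nonneg_nonneg) auto
  also have "\<dots> \<le> pr (circ z n)"
    by (rule pr_mono[OF up_event_event[OF up_event_circ]]) (rule circ_of_crossings; use assms in auto)
  finally show ?thesis by (simp add: circ_const_def q_def power2_eq_square)
qed

section \<open>Crossings at comparable scales\<close>

text \<open>The position of the end point on the right side decides how crossings can be
  prolonged.\<close>

definition hev :: "int \<Rightarrow> int \<Rightarrow> int \<Rightarrow> ((int \<times> int) set \<Rightarrow> bool) \<Rightarrow> bool" where
  "hev n a b = crossing (rect (-n) n (-n) n) {v. fst v = - n} {v. fst v = n \<and> a \<le> snd v \<and> snd v \<le> b}"

lemma up_event_hev: "up_event (hev n a b)"
  unfolding hev_def by (simp add: up_event_crossing)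

lemma hev_mono: "a' \<le> a \<Longrightarrow> b \<le> b' \<Longrightarrow> pr (hev n a b) \<le> pr (hev n a' b')"
  unfolding hev_def by (rule pr_crossing_mono) auto

lemma hev_split:
  assumes "b \<le> c + 1"
  shows "pr (hev n a d) \<le> pr (hev n a c) + pr (hev n b d)"
proof -
  have "pr (hev n a d) \<le> pr (\<lambda>\<omega>. hev n a c \<omega> \<or> hev n b d \<omega>)"
  proof (rule pr_mono)
    show "event (\<lambda>\<omega>. hev n a c \<omega> \<or> hev n b d \<omega>)"
      using up_event_hev by (intro finitary_event finitary_disj) (simp_all add: up_event_def)
    fix \<omega> assume "hev n a d \<omega>"
    then obtain x y where xy: "fst x = -n" "fst y = n" "a \<le> snd y" "snd y \<le> d" "conn (rect (-n) n (-n) n) \<omega> x y"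
      unfolding hev_def crossing_def by auto
    show "hev n a c \<omega> \<or> hev n b d \<omega>"
    proof (cases "snd y \<le> c")
      case True
      then have "hev n a c \<omega>" unfolding hev_def crossing_def using xy
        by (intro bexI[of _ x] bexI[of _ y]) auto
      then show ?thesis ..
    next
      case False
      then have "hev n b d \<omega>" unfolding hev_def crossing_def using xy assms
        by (intro bexI[of _ x] bexI[of _ y]) auto
      then show ?thesis ..
    qed
  qed
  also have "\<dots> \<le> pr (hev n a c) + pr (hev n b d)"
    by (intro pr_disj up_event_event up_event_hev)
  finally show ?thesis .
qed

text \<open>Reflection exchanges the halves of the right side, and a left-right crossing, of
  probability at least \<open>1 / 2\<close>, ends in one of them.\<close>

lemma hev_half:
  assumes "0 \<le> n" shows "1 / 4 \<le> pr (hev n 0 n)"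
proof -
  have "pr (hev n (-n) 0) = pr (hev n 0 n)"
    unfolding hev_def by (rule pr_crossing_affine[of _ 1 "-1" _ 0 0]) (auto simp: in_rect)
  moreover have "1 / 2 \<le> pr (lr (-n) n (-n) n)" by (rule pr_lr_square) (use assms in auto)
  moreover have "lr (-n) n (-n) n = hev n (-n) n"
    unfolding lr_def hev_def crossing_def by (rule ext) (fastforce dest: conn_in(2) simp: in_rect)
  ultimately show ?thesis using hev_split[of 0 0 n "-n" n] by simp
qed

text \<open>The box and its translate by \<open>(2 * a, 0)\<close> contain clusters with a top-bottom connection each whose end
  points are in opposite order on the two sides, so that the clusters meet.\<close>

lemma pr_lr_of_spread:
  assumes "0 \<le> a" "a \<le> n" "1 / 8 \<le> pr (hev n a n)"
  shows "(1 / 8) ^ 4 / 4 \<le> pr (lr (-n) (n + 2 * a) (-n) n)"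
proof -
  \<comment> \<open>The shift is \<open>2 * a\<close> so that the threshold \<open>2 * a - a\<close>
    for top end points in \<open>?B'\<close> coincides with the threshold \<open>a\<close> in
    \<open>?B\<close>. The bottom end points are separated by \<open>- a\<close> and
    \<open>3 * a\<close>.\<close>
  let ?B = "rect (-n) n (-n) n" and ?B' = "rect (2 * a - n) (2 * a + n) (-n) n"
  let ?D = "rect (-n) (n + 2 * a) (-n) n"
  let ?T1 = "crossing ?B {v. snd v = - n} {v. snd v = n \<and> a \<le> fst v}"
  let ?T2 = "crossing ?B {v. snd v = n} {v. snd v = - n \<and> fst v \<le> - a}"
  let ?T3 = "crossing ?B' {v. snd v = - n} {v. snd v = n \<and> fst v \<le> a}"
  let ?T4 = "crossing ?B' {v. snd v = n} {v. snd v = - n \<and> 3 * a \<le> fst v}"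
  let ?V1 = "lr (-n) n (-n) n" and ?V2 = "lr (2 * a - n) (2 * a + n) (-n) n"
  let ?h = "crossing ?B {v. fst v = - n} {v. fst v = n \<and> a \<le> snd v}"
  have h: "1 / 8 \<le> pr ?h"
    by (rule order_trans[OF assms(3)]) (auto simp: hev_def intro!: pr_crossing_mono)
  have "pr ?T1 = pr ?h" by (rule pr_crossing_affine_swap[of _ 1 1 _ 0 0]) (auto simp: in_rect)
  then have T1: "1 / 8 \<le> pr ?T1" using h by simp
  have "pr ?T2 = pr ?h" by (rule pr_crossing_affine_swap[of _ "-1" "-1" _ 0 0]) (auto simp: in_rect)
  then have T2: "1 / 8 \<le> pr ?T2" using h by simp
  have "pr ?T3 = pr ?h" by (rule pr_crossing_affine_swap[of _ 1 "-1" _ 0 "2 * a"]) (auto simp: in_rect)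
  then have T3: "1 / 8 \<le> pr ?T3" using h by simp
  have "pr ?T4 = pr ?h" by (rule pr_crossing_affine_swap[of _ "-1" 1 _ 0 "- 2 * a"]) (auto simp: in_rect)
  then have T4: "1 / 8 \<le> pr ?T4" using h by simp
  have V1: "1 / 2 \<le> pr ?V1" and V2: "1 / 2 \<le> pr ?V2"
    by (rule pr_lr_square; use assms in simp)+
  let ?E = "\<lambda>\<omega>. ((?T1 \<omega> \<and> ?T2 \<omega>) \<and> (?T3 \<omega> \<and> ?T4 \<omega>)) \<and> (?V1 \<omega> \<and> ?V2 \<omega>)"
  have up: "up_event ?T1" "up_event ?T2" "up_event ?T3" "up_event ?T4" by (simp_all add: up_event_crossing)
  have "((1 / 8) * (1 / 8)) * ((1 / 8) * (1 / 8)) * ((1 / 2) * (1 / 2)) \<le> pr ?E"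
    by (rule Harris_ge Harris_ge[OF _ _ T1 T2] Harris_ge[OF _ _ T3 T4] Harris_ge[OF _ _ V1 V2]
      up_event_conj up_event_lr up | simp)+
  also have "pr ?E \<le> pr (lr (-n) (n + 2 * a) (-n) n)"
  proof (rule pr_mono)
    fix \<omega> assume E: "?E \<omega>"
    have sub: "?B \<subseteq> ?D" "?B' \<subseteq> ?D" using assms by (auto simp: in_rect)
    from E obtain x y where g: "fst x = - n" "fst y = n" "conn ?B \<omega> x y"
      unfolding lr_def crossing_def by auto
    from E obtain x' y' where g': "fst x' = 2 * a - n" "fst y' = 2 * a + n" "conn ?B' \<omega> x' y'"
      unfolding lr_def crossing_def by auto
    from E obtain s1 t1 where 1: "snd s1 = - n" "snd t1 = n" "a \<le> fst t1" "conn ?B \<omega> s1 t1"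
      unfolding crossing_def by auto
    from E obtain t2 s2 where 2: "snd t2 = n" "snd s2 = - n" "fst s2 \<le> - a" "conn ?B \<omega> t2 s2"
      unfolding crossing_def by auto
    from E obtain s3 t3 where 3: "snd s3 = - n" "snd t3 = n" "fst t3 \<le> a" "conn ?B' \<omega> s3 t3"
      unfolding crossing_def by auto
    from E obtain t4 s4 where 4: "snd t4 = n" "snd s4 = - n" "3 * a \<le> fst s4" "conn ?B' \<omega> t4 s4"
      unfolding crossing_def by auto
    have c1: "conn ?B \<omega> x s1"
      by (rule lr_tb_conn[OF g(3) order_refl g(1,2) 1(4) order_refl 1(1,2) order_refl order_refl])
    have c2: "conn ?B \<omega> x s2"
      by (rule lr_tb_conn[OF g(3) order_refl g(1,2) conn_sym[OF 2(4)] order_refl 2(2,1) order_refl order_refl])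
    have c3: "conn ?B' \<omega> x' s3"
      by (rule lr_tb_conn[OF g'(3) order_refl g'(1,2) 3(4) order_refl 3(1,2) order_refl order_refl])
    have c4: "conn ?B' \<omega> x' s4"
      by (rule lr_tb_conn[OF g'(3) order_refl g'(1,2) conn_sym[OF 4(4)] order_refl 4(2,1) order_refl order_refl])
    have d: "conn ?B \<omega> t1 s2" "conn ?B' \<omega> t3 s4"
      using c1 c2 c3 c4 1(4) 3(4) by (meson conn_sym conn_trans)+
    have "{v. conn ?B \<omega> t1 v} \<inter> {v. conn ?B' \<omega> t3 v} \<noteq> {}"
      by (rule swapped_paths_meet[OF conn_joined[OF d(1)] order_trans[OF conn_reach_subset sub(1)] 1(2) 2(2)
        conn_joined[OF d(2)] order_trans[OF conn_reach_subset sub(2)] 3(2) 4(2)])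
        (use 1 2 3 4 assms in auto)
    then have "conn ?D \<omega> t1 t3" using sub by (rule conn_meet)
    moreover have "conn ?D \<omega> x t1" "conn ?D \<omega> t3 y'"
      using c1 1(4) c3 3(4) g'(3) sub by (meson conn_sym conn_trans conn_subset)+
    ultimately have "conn ?D \<omega> x y'" using conn_trans by blast
    then show "lr (-n) (n + 2 * a) (-n) n \<omega>" unfolding lr_def crossing_def using g g'
      by (intro bexI[of _ x] bexI[of _ y']) auto
  qed (rule up_event_event[OF up_event_lr])
  finally show ?thesis by (simp add: power_divide)
qed

lemma arch_meets_left:
  assumes P: "joined P x y" "P \<subseteq> rect a b c d" "fst x = b" "fst y = a"
    and Q: "joined Q u v" "Q \<subseteq> rect a b c d" "fst u = a" "fst v = a" "snd u \<le> snd y" "snd y \<le> snd v"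
  shows "P \<inter> Q \<noteq> {}"
proof -
  let ?\<sigma> = "\<lambda>v::int\<times>int. (- fst v, snd v)"
  have inj: "inj ?\<sigma>" by (auto intro!: injI simp: prod_eq_iff)
  have adj: "adj (?\<sigma> x) (?\<sigma> y) \<longleftrightarrow> adj x y" for x y by (simp add: adj_def abs_minus_commute)
  have "?\<sigma> ` P \<inter> ?\<sigma> ` Q \<noteq> {}"
  proof (rule arch_meets[of _ "?\<sigma> x" "?\<sigma> y" "- b" "- a" c d _ "?\<sigma> u" "?\<sigma> v"])
    show "joined (?\<sigma> ` P) (?\<sigma> x) (?\<sigma> y)" "joined (?\<sigma> ` Q) (?\<sigma> u) (?\<sigma> v)"
      using P(1) Q(1) by (simp_all add: conn_image[OF inj adj])
  qed (use P Q in \<open>auto simp: in_rect\<close>)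
  then show ?thesis by (auto simp: prod_eq_iff)
qed

text \<open>Crossings of two boxes of radius \<open>n\<close> that end in opposite vertical sides of a smaller box are joined by a
  cluster of the smaller box which touches both of these sides above and below the end points.
  Since the smaller box has radius \<open>m < n\<close>, the resulting crossing is longer than \<open>2 * n\<close>.\<close>

lemma pr_lr_of_concentrated:
  assumes "0 \<le> a" "a + m \<le> n" "0 \<le> m" "0 \<le> b" "b \<le> 2 * a"
    and "1 / 8 \<le> pr (hev m a m)" "1 / 8 \<le> pr (hev n 0 b)"
  shows "(1 / 8) ^ 6 / 2 \<le> pr (lr (-n) (3 * n - 2 * m) (-n) n)"
proof -
  let ?B = "rect (-n) n (-n) n" and ?B' = "rect (n - 2 * m) (3 * n - 2 * m) (-n) n"
  \<comment> \<open>The small box is centred at height \<open>a\<close>: by symmetry it has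
    crossings that end above \<open>2 * a\<close> and others that end below \<open>0\<close>, so
    their end points enclose the window \<open>[0, b]\<close> on either side.\<close>
  let ?Q = "rect (n - 2 * m) n (a - m) (a + m)"
  let ?D = "rect (-n) (3 * n - 2 * m) (-n) n"
  let ?G = "hev n 0 b"
  let ?G' = "crossing ?B' {v. fst v = 3 * n - 2 * m} {v. fst v = n - 2 * m \<and> 0 \<le> snd v \<and> snd v \<le> b}"
  let ?H1 = "crossing ?Q {v. fst v = n - 2 * m} {v. fst v = n \<and> 2 * a \<le> snd v \<and> snd v \<le> a + m}"
  let ?H2 = "crossing ?Q {v. fst v = n - 2 * m} {v. fst v = n \<and> a - m \<le> snd v \<and> snd v \<le> 0}"
  let ?H3 = "crossing ?Q {v. fst v = n} {v. fst v = n - 2 * m \<and> 2 * a \<le> snd v \<and> snd v \<le> a + m}"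
  let ?H4 = "crossing ?Q {v. fst v = n} {v. fst v = n - 2 * m \<and> a - m \<le> snd v \<and> snd v \<le> 0}"
  let ?V = "tb (n - 2 * m) n (a - m) (a + m)"
  have "pr ?G' = pr ?G" unfolding hev_def
    by (rule pr_crossing_affine[of _ "-1" 1 _ "2 * n - 2 * m" 0]) (auto simp: in_rect)
  then have G': "1 / 8 \<le> pr ?G'" using assms by simp
  note G = assms(7)
  have "pr ?H1 = pr (hev m a m)" unfolding hev_def
    by (rule pr_crossing_affine[of _ 1 1 _ "m - n" "- a"]) (auto simp: in_rect)
  then have H1: "1 / 8 \<le> pr ?H1" using assms by simp
  have "pr ?H2 = pr (hev m a m)" unfolding hev_def
    by (rule pr_crossing_affine[of _ 1 "-1" _ "m - n" a]) (auto simp: in_rect)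
  then have H2: "1 / 8 \<le> pr ?H2" using assms by simp
  have "pr ?H3 = pr (hev m a m)" unfolding hev_def
    by (rule pr_crossing_affine[of _ "-1" 1 _ "n - m" "- a"]) (auto simp: in_rect)
  then have H3: "1 / 8 \<le> pr ?H3" using assms by simp
  have "pr ?H4 = pr (hev m a m)" unfolding hev_def
    by (rule pr_crossing_affine[of _ "-1" "-1" _ "n - m" a]) (auto simp: in_rect)
  then have H4: "1 / 8 \<le> pr ?H4" using assms by simp
  have V: "1 / 2 \<le> pr ?V" by (rule pr_tb_square) (use assms in auto)
  let ?E = "\<lambda>\<omega>. ((?H1 \<omega> \<and> ?H2 \<omega>) \<and> (?H3 \<omega> \<and> ?H4 \<omega>)) \<and> ((?G \<omega> \<and> ?G' \<omega>) \<and> ?V \<omega>)"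
  have up: "up_event ?H1" "up_event ?H2" "up_event ?H3" "up_event ?H4" "up_event ?G'"
    by (simp_all add: up_event_crossing)
  have "((1 / 8) * (1 / 8)) * ((1 / 8) * (1 / 8)) * (((1 / 8) * (1 / 8)) * (1 / 2)) \<le> pr ?E"
    by (rule V Harris_ge Harris_ge[OF _ _ H1 H2] Harris_ge[OF _ _ H3 H4] Harris_ge[OF _ _ G G'] 
      up_event_conj up_event_lr up_event_tb up_event_hev up | simp)+
  also have "pr ?E \<le> pr (lr (-n) (3 * n - 2 * m) (-n) n)"
  proof (rule pr_mono)
    fix \<omega> assume E: "?E \<omega>"
    have sub: "?B \<subseteq> ?D" "?B' \<subseteq> ?D" "?Q \<subseteq> ?B" "?Q \<subseteq> ?B'" "?Q \<subseteq> ?D" using assms by (auto simp: in_rect)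
    from E obtain u v where v: "snd u = a - m" "snd v = a + m" "conn ?Q \<omega> u v"
      unfolding tb_def crossing_def by auto
    from E obtain x y where g: "fst x = - n" "fst y = n" "0 \<le> snd y" "snd y \<le> b" "conn ?B \<omega> x y"
      unfolding hev_def crossing_def by auto
    from E obtain x' y' where g': "fst x' = 3 * n - 2 * m" "fst y' = n - 2 * m" "0 \<le> snd y'" "snd y' \<le> b" "conn ?B' \<omega> x' y'"
      unfolding crossing_def by auto
    from E obtain x1 y1 where 1: "fst x1 = n - 2 * m" "fst y1 = n" "2 * a \<le> snd y1" "conn ?Q \<omega> x1 y1"
      unfolding crossing_def by auto
    from E obtain x2 y2 where 2: "fst x2 = n - 2 * m" "fst y2 = n" "snd y2 \<le> 0" "conn ?Q \<omega> x2 y2"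
      unfolding crossing_def by auto
    from E obtain x3 y3 where 3: "fst x3 = n" "fst y3 = n - 2 * m" "2 * a \<le> snd y3" "conn ?Q \<omega> x3 y3"
      unfolding crossing_def by auto
    from E obtain x4 y4 where 4: "fst x4 = n" "fst y4 = n - 2 * m" "snd y4 \<le> 0" "conn ?Q \<omega> x4 y4"
      unfolding crossing_def by auto
    have glue: "conn ?Q \<omega> x u" if "fst x = n - 2 * m" "fst y = n" "conn ?Q \<omega> x y" for x y
      by (rule lr_tb_conn[OF that(3) order_refl that(1,2) v(3) order_refl v(1,2) order_refl order_refl])
    have c: "conn ?Q \<omega> y1 u" "conn ?Q \<omega> y2 u" "conn ?Q \<omega> y3 u" "conn ?Q \<omega> y4 u"
      using glue[OF 1(1,2,4)] glue[OF 2(1,2,4)] glue[OF 3(2,1) conn_sym[OF 3(4)]] glue[OF 4(2,1) conn_sym[OF 4(4)]] 1(4) 2(4)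
      by (meson conn_sym conn_trans)+
    have d: "conn ?Q \<omega> y2 y1" "conn ?Q \<omega> y4 y3" using c by (meson conn_sym conn_trans)+
    have "{w. conn ?B \<omega> x w} \<inter> {w. conn ?Q \<omega> y2 w} \<noteq> {}"
      by (rule arch_meets[OF conn_joined[OF g(5)] conn_reach_subset g(1,2) conn_joined[OF d(1)]
          order_trans[OF conn_reach_subset sub(3)] 2(2) 1(2)]) (use g 1 2 assms in auto)
    from conn_meet[OF this sub(1,5)] have "conn ?D \<omega> x y2" .
    moreover have "{w. conn ?B' \<omega> x' w} \<inter> {w. conn ?Q \<omega> y4 w} \<noteq> {}"
      by (rule arch_meets_left[OF conn_joined[OF g'(5)] conn_reach_subset g'(1,2) conn_joined[OF d(2)]
          order_trans[OF conn_reach_subset sub(4)] 4(2) 3(2)]) (use g' 3 4 assms in auto)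
    from conn_meet[OF this sub(2,5)] have "conn ?D \<omega> x' y4" .
    moreover have "conn ?D \<omega> y2 u" "conn ?D \<omega> y4 u" using c sub conn_subset by blast+
    ultimately have "conn ?D \<omega> x x'" by (meson conn_sym conn_trans)
    then show "lr (-n) (3 * n - 2 * m) (-n) n \<omega>" unfolding lr_def crossing_def using g g'
      by (intro bexI[of _ x] bexI[of _ x']) auto
  qed (rule up_event_event[OF up_event_lr])
  finally show ?thesis by (simp add: power_divide)
qed

text \<open>The box and its mirror image in the right side have crossings ending in the same window
  \<open>[0, r]\<close>. A circuit of scale \<open>r\<close> around \<open>(n, 0)\<close> joins
  them, at a cost that does not depend on \<open>n / r\<close>.\<close>

lemma pr_lr_of_circ:
  assumes "0 \<le> r" "3 * r \<le> n" "0 < n" "p \<le> pr (circ (n, 0) r)" "0 \<le> p" "1 / 8 \<le> pr (hev n 0 r)"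
  shows "p / 64 \<le> pr (lr (-n) (3 * n) (-n) n)"
proof -
  let ?B = "rect (-n) n (-n) n" and ?B' = "rect n (3 * n) (-n) n"
  let ?D = "rect (-n) (3 * n) (-n) n"
  let ?G = "hev n 0 r" and ?C = "circ (n, 0) r"
  let ?G' = "crossing ?B' {v. fst v = 3 * n} {v. fst v = n \<and> 0 \<le> snd v \<and> snd v \<le> r}"
  have "pr ?G' = pr ?G" unfolding hev_def
    by (rule pr_crossing_affine[of _ "-1" 1 _ "2 * n" 0]) (auto simp: in_rect)
  then have G': "1 / 8 \<le> pr ?G'" using assms by simp
  let ?E = "\<lambda>\<omega>. ?C \<omega> \<and> (?G \<omega> \<and> ?G' \<omega>)"
  have "p * ((1 / 8) * (1 / 8)) \<le> pr ?E"
    by (rule Harris_ge[OF _ _ assms(4)] Harris_ge[OF _ _ assms(6) G']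
      up_event_conj up_event_circ up_event_hev up_event_crossing | simp add: assms)+
  also have "pr ?E \<le> pr (lr (-n) (3 * n) (-n) n)"
  proof (rule pr_mono)
    fix \<omega> assume E: "?E \<omega>"
    obtain c where c: "\<And>D D' u v. conn D \<omega> u v \<Longrightarrow> u \<in> box (n, 0) r \<Longrightarrow> v \<notin> box (n, 0) (3 * r) \<Longrightarrow>
      D \<subseteq> D' \<Longrightarrow> box (n, 0) (3 * r) \<subseteq> D' \<Longrightarrow> conn D' \<omega> c u"
      by (rule circ_hit[of "(n, 0)" r \<omega>]) (use E in blast)+
    have sub: "?B \<subseteq> ?D" "?B' \<subseteq> ?D" "box (n, 0) (3 * r) \<subseteq> ?D" using assms by (auto simp: in_rect in_box)
    from E obtain x y where g: "fst x = - n" "fst y = n" "0 \<le> snd y" "snd y \<le> r" "conn ?B \<omega> x y"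
      unfolding hev_def crossing_def by auto
    from E obtain x' y' where g': "fst x' = 3 * n" "fst y' = n" "0 \<le> snd y'" "snd y' \<le> r" "conn ?B' \<omega> x' y'"
      unfolding crossing_def by auto
    have "conn ?D \<omega> c y"
      by (rule c[OF conn_sym[OF g(5)] _ _ sub(1,3)]) (use g assms in \<open>auto simp: in_box\<close>)
    moreover have "conn ?D \<omega> c y'"
      by (rule c[OF conn_sym[OF g'(5)] _ _ sub(2,3)]) (use g' assms in \<open>auto simp: in_box\<close>)
    moreover have "conn ?D \<omega> x y" "conn ?D \<omega> x' y'" using g(5) g'(5) sub conn_subset by blast+
    ultimately have "conn ?D \<omega> x x'" by (meson conn_sym conn_trans)
    then show "lr (-n) (3 * n) (-n) n \<omega>" unfolding lr_def crossing_def using g g'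
      by (intro bexI[of _ x] bexI[of _ x']) auto
  qed (rule up_event_event[OF up_event_lr])
  finally show ?thesis by simp
qed

lemma pr_circ_of_lr:
  assumes "p \<le> pr (lr (-n) (n + e) (-n) n)" "0 \<le> p" "0 \<le> n" "n \<le> 2 * e"
  shows "circ_const p \<le> pr (circ z n)"
proof -
  have "pr (lr (-n + n) (n + e + n) (-n + n) (n + n)) = pr (lr (-n) (n + e) (-n) n)" by (rule lr_shift)
  moreover have "n + e + n = 2 * n + e" "n + n = 2 * n" by auto
  ultimately show ?thesis using assms by (intro pr_circ_of_wide_lr[of p n e]) simp_all
qed

text \<open>Below \<open>alpha n\<close>, crossings of \<open>[-n, n]\<^sup>2\<close> reach the upper part of the right side with decent probability;
  if \<open>alpha n\<close> is below the cap \<open>n div 2\<close>, they also end in \<open>[0, alpha n]\<close> with decent probability.\<close>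

definition alpha :: "int \<Rightarrow> int" where
  "alpha n = Max {a. 0 \<le> a \<and> a \<le> n div 2 \<and> 1 / 8 \<le> pr (hev n a n)}"

text \<open>The threshold \<open>1 / 8\<close> is half the bound of \<open>hev_half\<close>: by
  maximality, ending above \<open>alpha n\<close> has probability less than \<open>1 / 8\<close>,
  which leaves at least \<open>1 / 8\<close> for the window \<open>[0, alpha n]\<close>.\<close>

lemma alpha:
  assumes "0 \<le> n"
  shows "0 \<le> alpha n" "alpha n \<le> n div 2" "1 / 8 \<le> pr (hev n (alpha n) n)"
    "alpha n < n div 2 \<Longrightarrow> 1 / 8 \<le> pr (hev n 0 (alpha n))"
proof -
  let ?A = "{a. 0 \<le> a \<and> a \<le> n div 2 \<and> 1 / 8 \<le> pr (hev n a n)}"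
  have fin: "finite ?A" by (rule finite_subset[of _ "{0..n div 2}"]) auto
  have "0 \<in> ?A" using hev_half[OF assms] assms by simp
  then have "Max ?A \<in> ?A" using fin by (intro Max_in) blast+
  then show *: "0 \<le> alpha n" "alpha n \<le> n div 2" "1 / 8 \<le> pr (hev n (alpha n) n)" unfolding alpha_def by auto
  assume "alpha n < n div 2"
  moreover have "alpha n + 1 \<notin> ?A" using Max_ge[OF fin, of "alpha n + 1"] unfolding alpha_def by auto
  ultimately have "pr (hev n (alpha n + 1) n) < 1 / 8" using * by auto
  moreover have "pr (hev n 0 n) \<le> pr (hev n 0 (alpha n)) + pr (hev n (alpha n + 1) n)"
    by (rule hev_split) simp
  ultimately show "1 / 8 \<le> pr (hev n 0 (alpha n))" using hev_half[OF assms] by simp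
qed

text \<open>Circuits from the bound of \<open>pr_lr_of_concentrated\<close>, which is smaller than
  that of \<open>pr_lr_of_spread\<close>.\<close>

definition good_const :: real where
  "good_const = circ_const ((1 / 8) ^ 6 / 2)"

lemma circ_const_mono: "0 \<le> p \<Longrightarrow> p \<le> q \<Longrightarrow> circ_const p \<le> circ_const q"
  unfolding circ_const_def by (intro power_mono divide_right_mono) auto

text \<open>At the cap the end points are spread over a macroscopic part of the side. Below it,
  crossings end in \<open>[0, alpha n]\<close>, and a box of radius \<open>2 * n div 3\<close>
  encloses this window if \<open>alpha\<close> has at most doubled between the two scales.\<close>

lemma pr_circ_of_good_scale:
  assumes "2 \<le> n" "alpha n \<le> 2 * alpha (2 * n div 3) \<or> alpha n = n div 2"
  shows "good_const \<le> pr (circ z n)"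
proof (cases "alpha n = n div 2")
  case True
  have "(1 / 8) ^ 4 / 4 \<le> pr (lr (-n) (n + 2 * alpha n) (-n) n)"
    by (rule pr_lr_of_spread) (use alpha[of n] assms in auto)
  moreover have "(1 / 8 :: real) ^ 6 / 2 \<le> (1 / 8) ^ 4 / 4" by (simp add: power_divide)
  ultimately have "(1 / 8) ^ 6 / 2 \<le> pr (lr (-n) (n + 2 * alpha n) (-n) n)" by (rule order_trans[rotated])
  then show ?thesis unfolding good_const_def
    by (intro pr_circ_of_lr[of _ n "2 * alpha n"]) (use assms True in \<open>auto\<close>)
next
  case False
  define m where "m = 2 * n div 3"
  have m: "0 \<le> m" "3 * m \<le> 2 * n" using assms unfolding m_def by auto
  note am = alpha(1-3)[OF m(1)]
  have n: "0 \<le> n" "alpha n < n div 2" using assms(1) False alpha(2)[of n] by auto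
  note an = alpha(1)[OF n(1)] alpha(4)[OF n]
  have good: "alpha n \<le> 2 * alpha m" using assms(2) False unfolding m_def by simp
  \<comment> \<open>The cap \<open>m div 2\<close> on \<open>alpha m\<close> fits the ratio
    \<open>2 / 3\<close> of the radii: three halves of \<open>m\<close> are at most
    \<open>n\<close>.\<close>
  have "alpha m + m \<le> n" using am(2) m by linarith
  have "(1 / 8) ^ 6 / 2 \<le> pr (lr (-n) (3 * n - 2 * m) (-n) n)"
    by (rule pr_lr_of_concentrated[OF am(1) \<open>alpha m + m \<le> n\<close> m(1) an(1) good am(3) an(2)])
  also have "3 * n - 2 * m = n + (2 * n - 2 * m)" by simp
  finally have "(1 / 8) ^ 6 / 2 \<le> pr (lr (-n) (n + (2 * n - 2 * m)) (-n) n)" .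
  then show ?thesis unfolding good_const_def
    by (rule pr_circ_of_lr) (use n(1) m in auto)
qed

text \<open>The new constant depends on \<open>p\<close> but not on \<open>n / r\<close>: circuits
  of a small scale are carried over to a much larger one if \<open>alpha n\<close> is at most
  \<open>r\<close>.\<close>

lemma pr_circ_of_circ:
  assumes "1 \<le> r" "4 * r \<le> n" "\<And>z. p \<le> pr (circ z r)" "0 \<le> p" "alpha n \<le> r"
  shows "circ_const (p / 64) \<le> pr (circ z n)"
proof -
  have "1 / 8 \<le> pr (hev n 0 (alpha n))" by (rule alpha) (use assms in auto)
  also have "\<dots> \<le> pr (hev n 0 r)" using assms by (intro hev_mono) auto
  finally have "p / 64 \<le> pr (lr (-n) (3 * n) (-n) n)"
    by (intro pr_lr_of_circ[of r]) (use assms in auto)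
  then show ?thesis by (intro pr_circ_of_lr[of _ n "2 * n"]) (use assms in auto)
qed

section \<open>Arms and connection probabilities\<close>

definition linked :: "(int \<times> int) set \<Rightarrow> (int \<times> int) set \<Rightarrow> ((int \<times> int) set \<Rightarrow> bool) \<Rightarrow> bool" where
  "linked D X \<omega> \<longleftrightarrow> (\<forall>x\<in>X. \<forall>y\<in>X. conn D \<omega> x y)"

lemma up_event_conn: "finite D \<Longrightarrow> up_event (\<lambda>\<omega>. conn D \<omega> x y)"
  using up_event_crossing[of D "{x}" "{y}"] unfolding crossing_def by simp

lemma up_event_linked: "finite D \<Longrightarrow> finite X \<Longrightarrow> up_event (linked D X)"
  unfolding linked_def by (intro up_event_ball up_event_conn)

lemma linked_via:
  assumes "\<And>x. x \<in> X \<Longrightarrow> conn D \<omega> c x" shows "linked D X \<omega>"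
  unfolding linked_def using conn_trans[OF conn_sym[OF assms] assms] by blast

lemma linked_subset: "linked D X \<omega> \<Longrightarrow> D \<subseteq> D' \<Longrightarrow> linked D' X \<omega>"
  unfolding linked_def using conn_subset by blast

lemma linked_imp_same_cluster:
  assumes "linked D X \<omega>" shows "same_cluster \<omega> X"
proof (cases "X = {}")
  case True
  then show ?thesis unfolding same_cluster_def by simp
next
  case False
  then obtain x where "x \<in> X" by blast
  have "step D \<omega> \<subseteq> open_adj \<omega>" unfolding step_def open_adj_def by (auto simp: lattice_edge_iff)
  then have "X \<subseteq> cluster \<omega> x"
    using assms \<open>x \<in> X\<close> rtrancl_mono unfolding linked_def conn_def cluster_def by blast
  then show ?thesis unfolding same_cluster_def by blast
qed

section \<open>Connections in the plane as limits of connections in boxes\<close>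

lemma box_mono: "n \<le> m \<Longrightarrow> box z n \<subseteq> box z m"
  by (auto simp: in_box)

lemma in_large_box: "\<exists>N::nat. v \<in> box (0, 0) (int N)"
  by (rule exI[of _ "nat (max \<bar>fst v\<bar> \<bar>snd v\<bar>)"]) (auto simp: in_box)

lemma finite_subset_large_box:
  assumes "finite X" shows "\<exists>N::nat. X \<subseteq> box (0, 0) (int N)"
  using assms
proof (induction rule: finite_induct)
  case (insert x X)
  then obtain N where "X \<subseteq> box (0, 0) (int N)" by blast
  moreover obtain N' where "x \<in> box (0, 0) (int N')" using in_large_box by blast
  ultimately show ?case
    using box_mono[of "int N" "int (max N N')" "(0, 0)"] box_mono[of "int N'" "int (max N N')" "(0, 0)"]
    by (intro exI[of _ "max N N'"]) auto
qed simp

lemma cluster_conn: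
  assumes "(x, y) \<in> (open_adj \<omega>)\<^sup>*"
  shows "\<exists>N::nat. conn (box (0, 0) (int N)) \<omega> x y"
  using assms
proof induction
  case base
  then show ?case using in_large_box[of x] conn_refl by blast
next
  case (step y z)
  then obtain N where N: "conn (box (0, 0) (int N)) \<omega> x y" by blast
  obtain N' where N': "z \<in> box (0, 0) (int N')" using in_large_box by blast
  have "conn (box (0, 0) (int (max N N'))) \<omega> x y"
    by (rule conn_subset[OF N box_mono]) simp
  moreover have "z \<in> box (0, 0) (int (max N N'))"
    using N' box_mono[of "int N'" "int (max N N')"] by auto
  moreover have "adj y z" "\<omega> {y, z}" using step(2) unfolding open_adj_def by (auto simp: lattice_edge_iff)
  ultimately have "conn (box (0, 0) (int (max N N'))) \<omega> x z" by (rule conn_step)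
  then show ?case ..
qed

lemma same_cluster_imp_linked:
  assumes "same_cluster \<omega> X" "finite X"
  shows "\<exists>N::nat. linked (box (0, 0) (int N)) X \<omega>"
proof -
  obtain z where z: "X \<subseteq> cluster \<omega> z" using assms(1) unfolding same_cluster_def by blast
  have "\<forall>x\<in>X. \<exists>N::nat. conn (box (0, 0) (int N)) \<omega> z x"
    using z cluster_conn unfolding cluster_def by blast
  then obtain f where f: "\<And>x. x \<in> X \<Longrightarrow> conn (box (0, 0) (int (f x))) \<omega> z x" by metis
  define N where "N = Max (insert 0 (f ` X))"
  have "conn (box (0, 0) (int N)) \<omega> z x" if "x \<in> X" for x
  proof (rule conn_subset[OF f[OF that]])
    have "f x \<le> N" unfolding N_def using that assms(2) by (intro Max_ge) auto
    then show "box (0, 0) (int (f x)) \<subseteq> box (0, 0) (int N)" by (intro box_mono) simp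
  qed
  then have "linked (box (0, 0) (int N)) X \<omega>" by (rule linked_via)
  then show ?thesis ..
qed

lemma same_cluster_UN:
  assumes "finite X"
  shows "{\<omega> \<in> space (percolation (1/2)). same_cluster \<omega> X} =
    (\<Union>N::nat. {\<omega> \<in> space (percolation (1/2)). linked (box (0, 0) (int N)) X \<omega>})"
proof -
  have "same_cluster \<omega> X \<longleftrightarrow> (\<exists>N::nat. linked (box (0, 0) (int N)) X \<omega>)" for \<omega>
    using same_cluster_imp_linked[of \<omega> X] assms linked_imp_same_cluster[of _ X \<omega>] by auto
  then show ?thesis by auto
qed

lemma event_same_cluster:
  assumes "finite X" shows "event (\<lambda>\<omega>. same_cluster \<omega> X)"
  unfolding event_def same_cluster_UN[OF assms]
  using up_event_event[OF up_event_linked[OF finite_box assms], unfolded event_def]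
  by (intro sets.countable_UN') auto

lemma pr_le_same_cluster:
  assumes "finite X" "\<And>\<omega>. P \<omega> \<Longrightarrow> linked D X \<omega>"
  shows "pr P \<le> pr (\<lambda>\<omega>. same_cluster \<omega> X)"
  by (rule pr_mono[OF event_same_cluster[OF assms(1)] linked_imp_same_cluster[OF assms(2)]])

text \<open>The event is the increasing union of its versions in boxes, so a bound for all large
  boxes survives in the limit. Independence of finitary events is brought to bear on
  \<open>same_cluster\<close> through this rule.\<close>

lemma pr_same_cluster_le:
  assumes "finite X" "\<And>N::nat. N \<ge> N0 \<Longrightarrow> pr (linked (box (0, 0) (int N)) X) \<le> B"
  shows "pr (\<lambda>\<omega>. same_cluster \<omega> X) \<le> B"
proof -
  let ?M = "percolation (1/2)" 
  let ?A = "\<lambda>N::nat. {\<omega> \<in> space ?M. linked (box (0, 0) (int N)) X \<omega>}"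
  have "range ?A \<subseteq> sets ?M"
    using up_event_event[OF up_event_linked[OF finite_box assms(1)]] unfolding event_def by blast
  moreover have "incseq ?A"
    unfolding incseq_def using linked_subset[OF _ box_mono[of "int m" "int n" for m n]] by auto
  ultimately have "(\<lambda>N. measure ?M (?A N)) \<longlonglongrightarrow> measure ?M (\<Union>N. ?A N)"
    by (rule percolation.finite_Lim_measure_incseq)
  then have "(\<lambda>N. pr (linked (box (0, 0) (int N)) X)) \<longlonglongrightarrow> pr (\<lambda>\<omega>. same_cluster \<omega> X)"
    unfolding pr_def same_cluster_UN[OF assms(1)] .
  then show ?thesis
    by (rule LIMSEQ_le_const2) (use assms(2) in blast)
qed

section \<open>One-arm events\<close>

text \<open>Inside \<open>box z n\<close>, the complement of \<open>box z (n - 1)\<close> is the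
  boundary; for \<open>n = 0\<close> the inner box is empty and the event is sure.\<close>

definition arm :: "int \<times> int \<Rightarrow> int \<Rightarrow> ((int \<times> int) set \<Rightarrow> bool) \<Rightarrow> bool" where
  "arm z n = crossing (box z n) {z} (- box z (n - 1))"

lemma up_event_arm: "up_event (arm z n)"
  unfolding arm_def by (simp add: up_event_crossing)

lemma arm_determined: "determined (edges_in (box z n)) (arm z n)"
  unfolding arm_def by (rule crossing_determined)

lemma armE:
  assumes "arm z n \<omega>"
  obtains y where "conn (box z n) \<omega> z y" "y \<notin> box z (n - 1)"
  using assms unfolding arm_def crossing_def by auto

lemma arm_of_conn:
  assumes "conn D \<omega> z y" "y \<notin> box z (n - 1)" "0 \<le> n"
  shows "arm z n \<omega>"
proof -
  let ?h = "\<lambda>w. - max \<bar>fst w - fst z\<bar> \<bar>snd w - snd z\<bar>"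
  have "\<exists>w. ?h w = - n \<and> conn (D \<inter> {v. - n \<le> ?h v}) \<omega> z w"
    by (rule conn_level[OF assms(1) sup_dist_lipschitz]) (use assms in \<open>auto simp: in_box\<close>)
  then obtain w where w: "?h w = - n" "conn (D \<inter> {v. - n \<le> ?h v}) \<omega> z w" by blast
  have "conn (box z n) \<omega> z w" by (rule conn_subset[OF w(2)]) (auto simp: in_box)
  moreover have "w \<notin> box z (n - 1)" using w(1) by (auto simp: in_box)
  ultimately show ?thesis unfolding arm_def crossing_def by blast
qed

definition arm_pr :: "int \<Rightarrow> real" where
  "arm_pr n = pr (arm (0, 0) n)"

lemma pr_arm: "pr (arm z n) = arm_pr n"
  unfolding arm_pr_def arm_def
  by (rule pr_crossing_affine[of _ 1 1 _ "- fst z" "- snd z"]) (auto simp: in_box prod_eq_iff)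

lemma arm_antimono:
  assumes "0 \<le> m" "m \<le> n" shows "arm_pr n \<le> arm_pr m"
  unfolding arm_pr_def
proof (rule pr_mono[OF up_event_event[OF up_event_arm]])
  fix \<omega> assume "arm (0, 0) n \<omega>"
  then obtain y where "conn (box (0, 0) n) \<omega> (0, 0) y" "y \<notin> box (0, 0) (n - 1)" by (rule armE)
  moreover have "y \<notin> box (0, 0) (m - 1)" using box_mono[of "m - 1" "n - 1" "(0, 0)"] calculation(2) assms by auto
  ultimately show "arm (0, 0) m \<omega>" using assms by (intro arm_of_conn)
qed

text \<open>A connection contains an arm in each of the two disjoint boxes, and these arms are
  independent.\<close>

lemma pr_same_cluster_le_arm:
  assumes "0 \<le> n" "box x n \<inter> box y n = {}"
  shows "pr (\<lambda>\<omega>. same_cluster \<omega> {x, y}) \<le> (arm_pr n)\<^sup>2"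
proof (rule pr_same_cluster_le)
  fix N :: nat
  have out: "y \<notin> box x (n - 1)" "x \<notin> box y (n - 1)"
  proof -
    have "x \<in> box x n" "y \<in> box y n" using assms(1) by (auto simp: in_box)
    then have "y \<notin> box x n" "x \<notin> box y n" using assms(2) by blast+
    then show "y \<notin> box x (n - 1)" "x \<notin> box y (n - 1)" using box_mono[of "n - 1" n x] box_mono[of "n - 1" n y] by auto
  qed
  have "pr (linked (box (0, 0) (int N)) {x, y}) \<le> pr (\<lambda>\<omega>. arm x n \<omega> \<and> arm y n \<omega>)"
  proof (rule pr_mono[OF up_event_event[OF up_event_conj[OF up_event_arm up_event_arm]]])
    fix \<omega> assume "linked (box (0, 0) (int N)) {x, y} \<omega>"
    then have "conn (box (0, 0) (int N)) \<omega> x y" "conn (box (0, 0) (int N)) \<omega> y x" unfolding linked_def by auto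
    then show "arm x n \<omega> \<and> arm y n \<omega>" using out assms(1) by (auto intro: arm_of_conn)
  qed
  also have "\<dots> = pr (arm x n) * pr (arm y n)"
    by (rule pr_indep[OF finite_edges_in[OF finite_box] edges_in_lattice arm_determined
      finite_edges_in[OF finite_box] edges_in_lattice arm_determined edges_in_disjoint[OF assms(2)]])
  finally show "pr (linked (box (0, 0) (int N)) {x, y}) \<le> (arm_pr n)\<^sup>2"
    by (simp add: pr_arm power2_eq_square)
qed simp

text \<open>A circuit around \<open>x\<close> joins the arms of both points. As \<open>y\<close> may
  be at sup-distance \<open>r\<close> from \<open>x\<close>, the arm length \<open>4 * r + 1\<close>
  guarantees that both arms leave \<open>box x (3 * r)\<close>.\<close>

lemma arm_le_pr_same_cluster:
  assumes "y \<in> box x r" "0 \<le> r" "p \<le> pr (circ x r)" "0 \<le> p"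
  shows "(arm_pr (4 * r + 1))\<^sup>2 * p \<le> pr (\<lambda>\<omega>. same_cluster \<omega> {x, y})"
proof -
  let ?E = "\<lambda>\<omega>. (arm x (4 * r + 1) \<omega> \<and> arm y (4 * r + 1) \<omega>) \<and> circ x r \<omega>"
  have a: "arm_pr (4 * r + 1) \<le> pr (arm z (4 * r + 1))" for z by (simp add: pr_arm)
  have a0: "0 \<le> arm_pr (4 * r + 1)" unfolding arm_pr_def by (rule pr_nonneg)
  have "arm_pr (4 * r + 1) * arm_pr (4 * r + 1) * p \<le> pr ?E"
    by (rule Harris_ge[OF _ _ Harris_ge[OF _ _ a a] assms(3)])
      (simp_all add: up_event_conj up_event_arm up_event_circ a0 assms)
  also have "\<dots> \<le> pr (\<lambda>\<omega>. same_cluster \<omega> {x, y})"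
  proof (rule pr_le_same_cluster)
    fix \<omega> assume E: "?E \<omega>"
    let ?D = "box x (6 * r + 1)"
    obtain c where c: "\<And>D D' u v. conn D \<omega> u v \<Longrightarrow> u \<in> box x r \<Longrightarrow> v \<notin> box x (3 * r) \<Longrightarrow>
      D \<subseteq> D' \<Longrightarrow> box x (3 * r) \<subseteq> D' \<Longrightarrow> conn D' \<omega> c u"
      by (rule circ_hit[of x r \<omega>]) (use E in blast)+
    have "conn ?D \<omega> c u" if u: "u \<in> box x r" "arm u (4 * r + 1) \<omega>" for u
    proof -
      obtain v where v: "conn (box u (4 * r + 1)) \<omega> u v" "v \<notin> box u (4 * r)" using u(2) by (auto elim: armE)
      show ?thesis by (rule c[OF v(1) u(1)]) (use v(2) u(1) assms(2) in \<open>auto simp: in_box\<close>)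
    qed
    then have "conn ?D \<omega> c x" "conn ?D \<omega> c y" using E assms by (auto simp: in_box)
    then show "linked ?D {x, y} \<omega>" by (intro linked_via[of _ _ _ c]) auto
  qed simp
  finally show ?thesis by (simp add: power2_eq_square)
qed

text \<open>Around each point a circuit of scale \<open>r\<close> attaches the arm to a long
  crossing that ends near the point, and the circuit of scale \<open>n\<close> joins the two long
  crossings. Apart from the arms, the cost does not depend on \<open>n / r\<close>.\<close>

lemma far_pr_same_cluster:
  assumes "1 \<le> r" "4 * r \<le> n" "0 \<le> p" "0 \<le> q"
    and p: "\<And>z. p \<le> pr (circ z r)" and q: "q \<le> pr (circ (0, 0) n)" and h: "1 / 8 \<le> pr (hev (3 * n) 0 r)"
  shows "(arm_pr (3 * r + 1))\<^sup>2 * (p\<^sup>2 * q / 64) \<le> pr (\<lambda>\<omega>. same_cluster \<omega> {(0, 0), (n, 0)})"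
proof -
  let ?o = "(0, 0) :: int \<times> int" and ?x = "(n, 0) :: int \<times> int"
  \<comment> \<open>The right side passes through \<open>(k, 0)\<close>. For \<open>k = 0\<close>
    and \<open>k = n\<close> the left side is at distance at least \<open>5 * n\<close> from the
    origin, hence outside \<open>box ?o (3 * n)\<close>.\<close>
  let ?R = "\<lambda>k. rect (k - 6 * n) k (- 3 * n) (3 * n)"
  let ?G = "\<lambda>k. crossing (?R k) {v. fst v = k - 6 * n} {v. fst v = k \<and> 0 \<le> snd v \<and> snd v \<le> r}"
  let ?a = "arm_pr (3 * r + 1)"
  have "pr (?G k) = pr (hev (3 * n) 0 r)" for k
    unfolding hev_def by (rule pr_crossing_affine[of _ 1 1 _ "3 * n - k" 0]) (auto simp: in_rect)
  then have G: "1 / 8 \<le> pr (?G k)" for k using h by simp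
  have a: "?a \<le> pr (arm z (3 * r + 1))" for z by (simp add: pr_arm)
  have a0: "0 \<le> ?a" unfolding arm_pr_def by (rule pr_nonneg)
  let ?E = "\<lambda>\<omega>. (arm ?o (3 * r + 1) \<omega> \<and> arm ?x (3 * r + 1) \<omega>) \<and>
    (((circ ?o r \<omega> \<and> circ ?x r \<omega>) \<and> circ ?o n \<omega>) \<and> (?G 0 \<omega> \<and> ?G n \<omega>))"
  have "(?a * ?a) * (((p * p) * q) * ((1 / 8) * (1 / 8))) \<le> pr ?E"
    by (rule Harris_ge[OF _ _ Harris_ge[OF _ _ a a] Harris_ge[OF _ _ Harris_ge[OF _ _ Harris_ge[OF _ _ p p] q] Harris_ge[OF _ _ G G]]])
      (simp_all add: up_event_arm up_event_circ up_event_crossing up_event_conj a0 assms)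
  also have "\<dots> \<le> pr (\<lambda>\<omega>. same_cluster \<omega> {?o, ?x})"
  proof (rule pr_le_same_cluster)
    fix \<omega> assume E: "?E \<omega>"
    let ?D = "box ?o (10 * n)"
    obtain c0 where c0: "\<And>D D' u v. conn D \<omega> u v \<Longrightarrow> u \<in> box ?o r \<Longrightarrow> v \<notin> box ?o (3 * r) \<Longrightarrow>
      D \<subseteq> D' \<Longrightarrow> box ?o (3 * r) \<subseteq> D' \<Longrightarrow> conn D' \<omega> c0 u"
      by (rule circ_hit[of ?o r \<omega>]) (use E in blast)+
    obtain c1 where c1: "\<And>D D' u v. conn D \<omega> u v \<Longrightarrow> u \<in> box ?x r \<Longrightarrow> v \<notin> box ?x (3 * r) \<Longrightarrow>
      D \<subseteq> D' \<Longrightarrow> box ?x (3 * r) \<subseteq> D' \<Longrightarrow> conn D' \<omega> c1 u"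
      by (rule circ_hit[of ?x r \<omega>]) (use E in blast)+
    obtain c2 where c2: "\<And>D D' u v. conn D \<omega> u v \<Longrightarrow> u \<in> box ?o n \<Longrightarrow> v \<notin> box ?o (3 * n) \<Longrightarrow>
      D \<subseteq> D' \<Longrightarrow> box ?o (3 * n) \<subseteq> D' \<Longrightarrow> conn D' \<omega> c2 u"
      by (rule circ_hit[of ?o n \<omega>]) (use E in blast)+
    have sub: "?R 0 \<subseteq> ?D" "?R n \<subseteq> ?D" "box ?o (3 * r) \<subseteq> ?D" "box ?x (3 * r) \<subseteq> ?D" "box ?o (3 * n) \<subseteq> ?D"
      "box ?o (3 * r + 1) \<subseteq> ?D" "box ?x (3 * r + 1) \<subseteq> ?D"
      using assms(1,2) by (auto simp: in_box in_rect)
    from E obtain e0 s0 where g0: "fst e0 = - 6 * n" "fst s0 = 0" "0 \<le> snd s0" "snd s0 \<le> r" "conn (?R 0) \<omega> e0 s0"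
      unfolding crossing_def by auto
    from E obtain e1 s1 where g1: "fst e1 = n - 6 * n" "fst s1 = n" "0 \<le> snd s1" "snd s1 \<le> r" "conn (?R n) \<omega> e1 s1"
      unfolding crossing_def by auto
    from E obtain v0 where v0: "conn (box ?o (3 * r + 1)) \<omega> ?o v0" "v0 \<notin> box ?o (3 * r)" by (auto elim: armE)
    from E obtain v1 where v1: "conn (box ?x (3 * r + 1)) \<omega> ?x v1" "v1 \<notin> box ?x (3 * r)" by (auto elim: armE)
    have 1: "conn ?D \<omega> c0 ?o" by (rule c0[OF v0(1) _ v0(2) sub(6,3)]) (use assms in \<open>auto simp: in_box\<close>)
    have 2: "conn ?D \<omega> c1 ?x" by (rule c1[OF v1(1) _ v1(2) sub(7,4)]) (use assms in \<open>auto simp: in_box\<close>)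
    have 3: "conn ?D \<omega> c0 s0" by (rule c0[OF conn_sym[OF g0(5)] _ _ sub(1,3)]) (use assms g0 in \<open>auto simp: in_box\<close>)
    have 4: "conn ?D \<omega> c1 s1" by (rule c1[OF conn_sym[OF g1(5)] _ _ sub(2,4)]) (use assms g1 in \<open>auto simp: in_box\<close>)
    have 5: "conn ?D \<omega> c2 s0" by (rule c2[OF conn_sym[OF g0(5)] _ _ sub(1,5)]) (use assms g0 in \<open>auto simp: in_box\<close>)
    have 6: "conn ?D \<omega> c2 s1" by (rule c2[OF conn_sym[OF g1(5)] _ _ sub(2,5)]) (use assms g1 in \<open>auto simp: in_box\<close>)
    have "conn ?D \<omega> c2 ?o" using conn_trans[OF 5 conn_trans[OF conn_sym[OF 3] 1]] .
    moreover have "conn ?D \<omega> c2 ?x" using conn_trans[OF 6 conn_trans[OF conn_sym[OF 4] 2]] .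
    ultimately show "linked ?D {?o, ?x} \<omega>" by (intro linked_via[of _ _ _ c2]) auto
  qed simp
  finally show ?thesis by (simp add: power2_eq_square mult_ac)
qed

section \<open>Consequences of the power law\<close>

lemma norm_plane_axis: "norm (plane (0, 0) - plane (n, 0)) = \<bar>of_int n\<bar>"
  unfolding plane_def by (simp add: norm_Pair)

locale power_law =
  fixes \<eta> c C :: real
  assumes eta: "0 < \<eta>" and c_pos: "0 < c" and C_pos: "0 < C"
    and lower: "x \<noteq> y \<Longrightarrow> c * norm (plane x - plane y) powr (- \<eta>) \<le> pr (\<lambda>\<omega>. same_cluster \<omega> {x, y})"
    and upper: "x \<noteq> y \<Longrightarrow> pr (\<lambda>\<omega>. same_cluster \<omega> {x, y}) \<le> C * norm (plane x - plane y) powr (- \<eta>)"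
begin

text \<open>\<open>2 * n + 1\<close> is the smallest horizontal distance at which two boxes of
  radius \<open>n\<close> are disjoint.\<close>

lemma arm_sq_lower:
  assumes "0 \<le> n" shows "c * of_int (2 * n + 1) powr (- \<eta>) \<le> (arm_pr n)\<^sup>2"
proof -
  have "c * norm (plane (0, 0) - plane (2 * n + 1, 0)) powr (- \<eta>) \<le>
      pr (\<lambda>\<omega>. same_cluster \<omega> {(0, 0), (2 * n + 1, 0)})"
    by (rule lower) (use assms in auto)
  also have "\<dots> \<le> (arm_pr n)\<^sup>2"
    by (rule pr_same_cluster_le_arm) (use assms in \<open>auto simp: in_box\<close>)
  finally show ?thesis unfolding norm_plane_axis using assms by simp
qed

text \<open>If \<open>alpha\<close> were at most \<open>r\<close> at the scales \<open>K * r\<close> and \<open>3 * (K * r)\<close>, then \<open>(0, 0)\<close> and \<open>(K * r, 0)\<close> would be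
  connected with probability comparable to that of two points at distance of order \<open>r\<close>,
  against the power law.\<close>

lemma spread_scale:
  assumes "0 < p"
  shows "\<exists>K\<ge>4. \<forall>r\<ge>1. (\<forall>z. p \<le> pr (circ z r)) \<longrightarrow> r < alpha (K * r) \<or> r < alpha (3 * (K * r))"
proof -
  define q where "q = circ_const (p / 64)"
  have q: "0 < q" unfolding q_def using assms by (intro circ_const_pos) simp
  \<comment> \<open>\<open>A\<close> collects the constants of the two estimates, which contradict
    each other once \<open>of_int K powr \<eta>\<close> exceeds it; \<open>9\<close> comes from
    \<open>2 * (3 * r + 1) + 1 \<le> 9 * r\<close>.\<close>
  define A where "A = C * 64 * 9 powr \<eta> / (c * p\<^sup>2 * q)"
  have A: "0 < A" unfolding A_def using q assms c_pos C_pos by simp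
  define K where "K = max 4 (\<lceil>A powr (1 / \<eta>)\<rceil> + 1)"
  have K: "4 \<le> K" unfolding K_def by simp
  have "A powr (1 / \<eta>) < of_int K" unfolding K_def by linarith
  then have "(A powr (1 / \<eta>)) powr \<eta> < of_int K powr \<eta>"
    using eta by (intro powr_less_mono2) auto
  then have AK: "A < of_int K powr \<eta>" using eta A by (simp add: powr_powr)
  have "r < alpha (K * r) \<or> r < alpha (3 * (K * r))" if r: "1 \<le> r" and circ: "\<And>z. p \<le> pr (circ z r)" for r
  proof (rule ccontr)
    assume "\<not> ?thesis"
    \<comment> \<open>The first bound yields the circuit of scale \<open>K * r\<close>, the second
      the crossings of boxes of radius \<open>3 * (K * r)\<close> in
      \<open>far_pr_same_cluster\<close>.\<close>
    then have al: "alpha (K * r) \<le> r" "alpha (3 * (K * r)) \<le> r" by auto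
    define n where "n = K * r"
    have "4 * r \<le> K * r" by (rule mult_right_mono) (use K r in auto)
    then have n: "4 * r \<le> n" unfolding n_def .
    have cn: "q \<le> pr (circ (0, 0) n)"
      unfolding q_def by (rule pr_circ_of_circ[OF r n circ]) (use al assms in \<open>auto simp: n_def\<close>)
    have "1 / 8 \<le> pr (hev (3 * n) 0 (alpha (3 * n)))"
    proof (rule alpha(4))
      have "r < 3 * n div 2" using n r by linarith
      then show "alpha (3 * n) < 3 * n div 2" using al(2) unfolding n_def by linarith
    qed (use n r in linarith)
    also have "\<dots> \<le> pr (hev (3 * n) 0 r)" by (rule hev_mono) (use al in \<open>auto simp: n_def\<close>)
    finally have "(arm_pr (3 * r + 1))\<^sup>2 * (p\<^sup>2 * q / 64) \<le> pr (\<lambda>\<omega>. same_cluster \<omega> {(0, 0), (n, 0)})"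
      by (intro far_pr_same_cluster[OF r n _ _ circ cn]) (use q assms in auto)
    also have "\<dots> \<le> C * norm (plane (0, 0) - plane (n, 0)) powr (- \<eta>)"
      by (rule upper) (use n r in auto)
    also have "\<dots> = C * (of_int K * of_int r) powr (- \<eta>)"
      unfolding norm_plane_axis n_def using K r by (simp add: abs_mult)
    also have "\<dots> = C * of_int K powr (- \<eta>) * of_int r powr (- \<eta>)"
      using K r by (simp add: powr_mult)
    finally have 1: "(arm_pr (3 * r + 1))\<^sup>2 * (p\<^sup>2 * q / 64) \<le> C * of_int K powr (- \<eta>) * of_int r powr (- \<eta>)" .
    have "c * (9 * of_int r) powr (- \<eta>) \<le> c * of_int (2 * (3 * r + 1) + 1) powr (- \<eta>)"
      using r eta c_pos by (intro mult_left_mono powr_mono2') auto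
    also have "\<dots> \<le> (arm_pr (3 * r + 1))\<^sup>2" by (rule arm_sq_lower) (use r in auto)
    finally have "c * (9 * of_int r) powr (- \<eta>) * (p\<^sup>2 * q / 64) \<le> (arm_pr (3 * r + 1))\<^sup>2 * (p\<^sup>2 * q / 64)"
      by (rule mult_right_mono) (use q in auto)
    also note 1
    finally have "c * 9 powr (- \<eta>) * (p\<^sup>2 * q / 64) * of_int r powr (- \<eta>) \<le> C * of_int K powr (- \<eta>) * of_int r powr (- \<eta>)"
      using r by (simp add: powr_mult mult_ac)
    then have "c * 9 powr (- \<eta>) * (p\<^sup>2 * q / 64) \<le> C * of_int K powr (- \<eta>)"
      by (rule mult_right_le_imp_le) (use r in simp)
    then have "of_int K powr \<eta> \<le> A"
      unfolding A_def using K q assms c_pos by (simp add: powr_minus field_simps)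
    then show False using AK by simp
  qed
  then show ?thesis using K by blast
qed

text \<open>Along \<open>n \<mapsto> (3 * n + 1) div 2\<close> the value of \<open>alpha\<close> cannot double at every step, as \<open>alpha n \<le> n\<close>.\<close>

lemma next_scale:
  assumes "0 < p" "p \<le> good_const"
  shows "\<exists>M\<ge>1. \<forall>r\<ge>1. (\<forall>z. p \<le> pr (circ z r)) \<longrightarrow> (\<exists>r'>r. r' \<le> M * r \<and> (\<forall>z. p \<le> pr (circ z r')))"
proof -
  obtain K where K: "4 \<le> K" "\<And>r. 1 \<le> r \<Longrightarrow> (\<forall>z. p \<le> pr (circ z r)) \<Longrightarrow> r < alpha (K * r) \<or> r < alpha (3 * (K * r))"
    using spread_scale[OF assms(1)] by blast
  \<comment> \<open>After \<open>I\<close> doublings \<open>alpha\<close> would be at least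
    \<open>2 ^ I * r\<close>, whereas the scale has grown only by about \<open>(3 / 2) ^ I\<close>
    from at most \<open>3 * K * r\<close>. This choice of \<open>I\<close> makes that
    impossible.\<close>
  obtain I :: nat where I: "4 * of_int K < (4 / 3 :: real) ^ I" using real_arch_pow[of "4 / 3"] by auto
  define M where "M = 2 ^ I * (3 * K)"
  have "\<exists>r'>r. r' \<le> M * r \<and> (\<forall>z. p \<le> pr (circ z r'))"
    if r: "1 \<le> r" and circ: "\<forall>z. p \<le> pr (circ z r)" for r
  proof -
    obtain n0 where n0: "r < alpha n0" "n0 = K * r \<or> n0 = 3 * (K * r)" using K(2)[OF r circ] by blast
    have "4 * r \<le> K * r" by (rule mult_right_mono) (use K r in auto)
    then have n0r: "4 * r \<le> n0" "n0 \<le> 3 * K * r" using n0(2) r by auto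
    \<comment> \<open>The rounding is such that \<open>2 * s (Suc i) div 3 = s i\<close>, which is
      the pair of scales in \<open>pr_circ_of_good_scale\<close>.\<close>
    define s where "s i = ((\<lambda>x. (3 * x + 1) div 2) ^^ i) n0" for i
    have s0: "s 0 = n0" and sSuc: "s (Suc i) = (3 * s i + 1) div 2" for i unfolding s_def by auto
    have s_lower: "n0 \<le> s i" for i
    proof (induction i)
      case (Suc i)
      then show ?case using n0r r unfolding sSuc by linarith
    qed (simp add: s0)
    have s_upper: "s i \<le> 2 ^ i * n0" for i
    proof (induction i)
      case (Suc i)
      have "s (Suc i) \<le> 2 * s i" using s_lower[of i] n0r r unfolding sSuc by linarith
      then show ?case using Suc by simp
    qed (simp add: s0)
    have s_upper': "of_int (s i) + 1 \<le> (3 / 2 :: real) ^ i * (of_int n0 + 1)" for i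
    proof (induction i)
      case (Suc i)
      have "2 * s (Suc i) \<le> 3 * s i + 1" unfolding sSuc by linarith
      then have "2 * real_of_int (s (Suc i)) \<le> 3 * real_of_int (s i) + 1"
        by (metis (mono_tags) of_int_1 of_int_add of_int_le_iff of_int_mult of_int_numeral)
      then show ?case using Suc by simp
    qed (simp add: s0)
    have "\<exists>i<I. alpha (s (Suc i)) \<le> 2 * alpha (s i) \<or> alpha (s (Suc i)) = s (Suc i) div 2"
    proof (rule ccontr)
      assume "\<not> ?thesis"
      then have bad: "2 * alpha (s i) < alpha (s (Suc i))" if "i < I" for i using that by force
      have grow: "i \<le> I \<Longrightarrow> 2 ^ i * r \<le> alpha (s i)" for i
      proof (induction i)
        case (Suc i)
        then show ?case using bad[of i] by simp
      qed (use n0 in \<open>simp add: s0\<close>)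
      have "2 ^ I * r \<le> alpha (s I)" by (rule grow) simp
      also have "\<dots> \<le> s I div 2" by (rule alpha(2)) (use s_lower[of I] n0r r in linarith)
      also have "\<dots> \<le> s I" using s_lower[of I] n0r r by linarith
      finally have "real_of_int (2 ^ I * r) \<le> of_int (s I)" by (simp only: of_int_le_iff)
      then have "2 ^ I * of_int r \<le> (3 / 2 :: real) ^ I * (of_int n0 + 1)"
        using s_upper'[of I] by simp
      also have "real_of_int n0 + 1 \<le> 4 * of_int K * of_int r"
      proof -
        have "1 * 1 \<le> K * r" by (rule mult_mono) (use K r in auto)
        then have "n0 + 1 \<le> 4 * K * r" using n0r by simp
        then show ?thesis by (metis (mono_tags) of_int_1 of_int_add of_int_le_iff of_int_mult of_int_numeral)
      qed
      finally have "2 ^ I * of_int r \<le> (3 / 2 :: real) ^ I * (4 * of_int K) * of_int r"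
        by (simp add: mult_ac)
      then have "2 ^ I \<le> (3 / 2 :: real) ^ I * (4 * of_int K)" using r by simp
      moreover have "(2 :: real) ^ I = (3 / 2) ^ I * (4 / 3) ^ I" by (simp flip: power_mult_distrib)
      ultimately have "(4 / 3 :: real) ^ I \<le> 4 * of_int K" by simp
      then show False using I by simp
    qed
    then obtain i where i: "i < I" "alpha (s (Suc i)) \<le> 2 * alpha (s i) \<or> alpha (s (Suc i)) = s (Suc i) div 2"
      by blast
    have "2 * s (Suc i) div 3 = s i" unfolding sSuc by presburger
    then have "p \<le> pr (circ z (s (Suc i)))" for z
      using pr_circ_of_good_scale[of "s (Suc i)" z] i(2) s_lower[of "Suc i"] n0r r assms(2) by simp
    moreover have "r < s (Suc i)" using s_lower[of "Suc i"] n0r r by linarith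
    moreover have "s (Suc i) \<le> M * r"
    proof -
      have "s (Suc i) \<le> 2 ^ Suc i * n0" by (rule s_upper)
      also have "\<dots> \<le> 2 ^ I * (3 * K * r)"
        by (intro mult_mono power_increasing) (use i(1) n0r r in auto)
      finally show ?thesis unfolding M_def by (simp add: mult_ac)
    qed
    ultimately show ?thesis by blast
  qed
  moreover have "1 \<le> M"
  proof -
    have "1 * 1 \<le> M" unfolding M_def by (rule mult_mono) (use K in auto)
    then show ?thesis by simp
  qed
  ultimately show ?thesis by blast
qed

text \<open>Starting from scale 1, \<open>next_scale\<close> produces good scales with bounded
  ratios. The induction on \<open>n\<close> keeps the current scale until \<open>n\<close> has
  caught up with it.\<close>

lemma circ_scales:
  "\<exists>p>0. \<exists>M\<ge>1. \<forall>n\<ge>1. \<exists>r\<ge>n. r \<le> M * n \<and> (\<forall>z. p \<le> pr (circ z r))"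
proof -
  define p where "p = good_const"
  have p: "0 < p" unfolding p_def good_const_def by (rule circ_const_pos) simp
  obtain M where M: "1 \<le> M" "\<And>r. 1 \<le> r \<Longrightarrow> (\<forall>z. p \<le> pr (circ z r)) \<Longrightarrow> \<exists>r'>r. r' \<le> M * r \<and> (\<forall>z. p \<le> pr (circ z r'))"
    using next_scale[OF p] unfolding p_def by blast
  have "\<exists>r\<ge>n. r \<le> M * n \<and> (\<forall>z. p \<le> pr (circ z r))" if "1 \<le> n" for n
    using that
  proof (induction n rule: int_ge_induct)
    case base
    \<comment> \<open>At scale 1 the 3 by 2 rectangle of \<open>pr_lr_wide\<close> is already wide
      enough.\<close>
    have "p \<le> pr (circ z 1)" for z
    proof -
      have "p \<le> circ_const (1 / 2)"
        unfolding p_def good_const_def by (rule circ_const_mono) (simp_all add: power_divide)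
      also have "\<dots> \<le> pr (circ z 1)"
        by (rule pr_circ_of_wide_lr[of _ 1 1]) (use pr_lr_wide[of 2] in auto)
      finally show ?thesis .
    qed
    then show ?case using M(1) by (intro exI[of _ 1]) auto
  next
    case (step n)
    then obtain r where r: "n \<le> r" "r \<le> M * n" "\<forall>z. p \<le> pr (circ z r)" by blast
    show ?case
    proof (cases "r = n")
      case True
      then obtain r' where "r < r'" "r' \<le> M * r" "\<forall>z. p \<le> pr (circ z r')" using M(2)[OF _ r(3)] step by auto
      then show ?thesis using True M(1) by (intro exI[of _ r']) (auto simp: algebra_simps)
    next
      case False
      then show ?thesis using r M(1) by (intro exI[of _ r]) (auto simp: algebra_simps)
    qed
  qed
  then show ?thesis using p M(1) by blast
qed

lemma arm_lower: "\<exists>a>0. \<forall>n\<ge>1. a * of_int n powr (- \<eta> / 2) \<le> arm_pr n"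
proof (intro exI conjI allI impI)
  show "0 < sqrt c * 3 powr (- \<eta> / 2)" using c_pos by simp
  fix n :: int assume n: "1 \<le> n"
  have sq: "(x powr (- (\<eta> / 2)))\<^sup>2 = x powr (- \<eta>)" for x :: real
    by (simp add: power2_eq_square flip: powr_add)
  have "(sqrt c * 3 powr (- \<eta> / 2) * of_int n powr (- \<eta> / 2))\<^sup>2 = c * (3 * of_int n) powr (- \<eta>)"
    using c_pos n by (simp add: power_mult_distrib sq powr_mult)
  also have "\<dots> \<le> c * of_int (2 * n + 1) powr (- \<eta>)"
    using n eta c_pos by (intro mult_left_mono powr_mono2') auto
  also have "\<dots> \<le> (arm_pr n)\<^sup>2" by (rule arm_sq_lower) (use n in auto)
  finally show "sqrt c * 3 powr (- \<eta> / 2) * of_int n powr (- \<eta> / 2) \<le> arm_pr n"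
    by (rule power2_le_imp_le) (simp add: arm_pr_def pr_nonneg)
qed

text \<open>Two points at distance \<open>k\<close> are joined by their arms and a circuit of scale
  between \<open>k\<close> and \<open>M * k\<close>, so the squared arm probability is at most a
  constant times \<open>k powr (- \<eta>)\<close>.\<close>

lemma arm_upper: "\<exists>A>0. \<forall>n\<ge>1. arm_pr n \<le> A * of_int n powr (- \<eta> / 2)"
proof -
  obtain p M where p: "0 < p" and M: "1 \<le> M"
    and scale: "\<And>n. 1 \<le> n \<Longrightarrow> \<exists>r\<ge>n. r \<le> M * n \<and> (\<forall>z. p \<le> pr (circ z r))"
    using circ_scales by blast
  have sq: "(x powr (- (\<eta> / 2)))\<^sup>2 = x powr (- \<eta>)" for x :: real
    by (simp add: power2_eq_square flip: powr_add)
  define B where "B = max 1 (sqrt (C / p))"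
  define A where "A = B * (10 * of_int M) powr (\<eta> / 2)"
  have "0 < A" unfolding A_def B_def using M by (simp add: less_max_iff_disj)
  moreover have "arm_pr n \<le> A * of_int n powr (- \<eta> / 2)" if n: "1 \<le> n" for n
  proof -
    have A_eq: "A * of_int n powr (- \<eta> / 2) = B * (of_int n / (10 * of_int M)) powr (- \<eta> / 2)"
    proof -
      have "(of_int n / (10 * of_int M)) powr (- \<eta> / 2) =
          of_int n powr (- \<eta> / 2) / (10 * real_of_int M) powr (- \<eta> / 2)"
        by (rule powr_divide)
      also have "(10 * real_of_int M) powr (- \<eta> / 2) = inverse ((10 * of_int M) powr (\<eta> / 2))"
        using powr_minus[of "10 * real_of_int M" "\<eta> / 2"] by (simp only: minus_divide_left)
      finally show ?thesis unfolding A_def by (simp only: divide_inverse inverse_inverse_eq mult_ac)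
    qed
    show ?thesis
    proof (cases "n < 5 * M")
      case True
      then have "real_of_int n \<le> 10 * of_int M" using M by linarith
      then have "(of_int n / (10 * of_int M)) powr (- \<eta> / 2) \<ge> (1 :: real)"
        using n M eta powr_mono2'[of "- \<eta> / 2" "of_int n / (10 * of_int M)" 1] by simp
      moreover have "1 \<le> B" unfolding B_def by simp
      ultimately have "1 * 1 \<le> B * (of_int n / (10 * of_int M)) powr (- \<eta> / 2)" by (intro mult_mono) auto
      then show ?thesis using A_eq pr_le_1[of "arm (0, 0) n"] unfolding arm_pr_def by simp
    next
      case False
      \<comment> \<open>As \<open>r \<le> M * k\<close>, the arm length \<open>4 * r + 1\<close> is
        at most \<open>n\<close>, while \<open>k\<close> is at least \<open>n / (10 * M)\<close>.
        Smaller \<open>n\<close> are covered by the \<open>1\<close> in \<open>B\<close>.\<close>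
      define k where "k = n div (5 * M)"
      have "5 * M * k + n mod (5 * M) = n" unfolding k_def by (rule mult_div_mod_eq)
      moreover have "0 \<le> n mod (5 * M)" "n mod (5 * M) < 5 * M" using M by auto
      moreover have k: "1 \<le> k" unfolding k_def using False M by (simp add: pos_imp_zdiv_pos_iff int_one_le_iff_zero_less)
      moreover have "M * 1 \<le> M * k" by (rule mult_left_mono) (use k M in auto)
      ultimately have nk: "5 * M * k \<le> n" "n \<le> 10 * (M * k)" by linarith+
      obtain r where r: "k \<le> r" "r \<le> M * k" "\<forall>z. p \<le> pr (circ z r)" using scale[OF k] by blast
      have "(arm_pr (4 * r + 1))\<^sup>2 * p \<le> pr (\<lambda>\<omega>. same_cluster \<omega> {(0, 0), (k, 0)})"
        by (rule arm_le_pr_same_cluster) (use r k p in \<open>auto simp: in_box\<close>)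
      also have "\<dots> \<le> C * norm (plane (0, 0) - plane (k, 0)) powr (- \<eta>)"
        by (rule upper) (use k in auto)
      also have "\<dots> = C * of_int k powr (- \<eta>)" unfolding norm_plane_axis using k by simp
      finally have "(arm_pr (4 * r + 1))\<^sup>2 \<le> C / p * of_int k powr (- \<eta>)" using p by (simp add: field_simps)
      also have "\<dots> = (sqrt (C / p) * of_int k powr (- \<eta> / 2))\<^sup>2"
        using p C_pos by (simp add: power_mult_distrib sq)
      finally have "arm_pr (4 * r + 1) \<le> sqrt (C / p) * of_int k powr (- \<eta> / 2)"
        by (rule power2_le_imp_le) (use p C_pos in auto)
      also have "\<dots> \<le> B * (of_int n / (10 * of_int M)) powr (- \<eta> / 2)"
      proof (intro mult_mono powr_mono2')
        have "real_of_int n \<le> of_int (10 * (M * k))" using nk(2) by (simp only: of_int_le_iff)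
        then show "of_int n / (10 * of_int M) \<le> real_of_int k" using M by (simp add: field_simps)
      qed (use n M eta in \<open>auto simp: B_def\<close>)
      finally have "arm_pr (4 * r + 1) \<le> A * of_int n powr (- \<eta> / 2)" unfolding A_eq .
      moreover have "4 * r + 1 \<le> n"
      proof -
        have "1 * 1 \<le> M * k" by (rule mult_mono) (use M k in auto)
        then show ?thesis using r(2) nk(1) by simp
      qed
      then have "arm_pr n \<le> arm_pr (4 * r + 1)" by (intro arm_antimono) (use r k in auto)
      ultimately show ?thesis by simp
    qed
  qed
  ultimately show ?thesis by blast
qed

end

section \<open>Estimates for \<open>S\<close>\<close>

lemma tripartition_card:
  assumes "(A1, A2, A3) \<in> tripartitions A" "finite A"
  shows "finite A1" "finite A2" "finite A3" "1 \<le> card A1" "1 \<le> card A2" "1 \<le> card A3"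
    "card (A1 \<union> A2) = card A1 + card A2" "card (A2 \<union> A3) = card A2 + card A3" "card (A3 \<union> A1) = card A3 + card A1"
    "card A = card A1 + card A2 + card A3"
proof -
  have A: "A1 \<noteq> {}" "A2 \<noteq> {}" "A3 \<noteq> {}" "A1 \<inter> A2 = {}" "A2 \<inter> A3 = {}" "A3 \<inter> A1 = {}" "A = A1 \<union> A2 \<union> A3"
    using assms(1) unfolding tripartitions_def by auto
  show fin: "finite A1" "finite A2" "finite A3" using assms(2) A(7) by auto
  show "1 \<le> card A1" "1 \<le> card A2" "1 \<le> card A3" using fin A by (simp_all add: Suc_leI card_gt_0_iff)
  show c: "card (A1 \<union> A2) = card A1 + card A2" "card (A2 \<union> A3) = card A2 + card A3" "card (A3 \<union> A1) = card A3 + card A1"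
    using fin A by (simp_all add: card_Un_disjoint)
  have "(A1 \<union> A2) \<inter> A3 = {}" using A by auto
  then show "card A = card A1 + card A2 + card A3" unfolding A(7) using fin c by (simp add: card_Un_disjoint)
qed

lemma Sfun_le:
  assumes "finite A" "3 \<le> card A" "(A1, A2, A3) \<in> tripartitions A"
  shows "Sfun A \<le> sqrt (Sfun (A1 \<union> A2) * Sfun (A2 \<union> A3) * Sfun (A3 \<union> A1))"
proof -
  let ?f = "\<lambda>(A1, A2, A3). sqrt (Sfun (A1 \<union> A2) * Sfun (A2 \<union> A3) * Sfun (A3 \<union> A1))"
  have "Sfun A = Min (?f ` tripartitions A)" using assms(2) by (subst Sfun.simps) simp
  also have "\<dots> \<le> ?f (A1, A2, A3)"
    using finite_tripartitions[OF assms(1)] assms(3) by (intro Min_le finite_imageI imageI)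
  finally show ?thesis by simp
qed

text \<open>The product is invariant under rotation of the parts, so the part that contains
  \<open>b\<close> can be put first.\<close>

lemma Sfun_attained:
  assumes "finite A" "3 \<le> card A" "b \<in> A"
  obtains A1 A2 A3 where "(A1, A2, A3) \<in> tripartitions A" "b \<in> A1"
    "Sfun A = sqrt (Sfun (A1 \<union> A2) * Sfun (A2 \<union> A3) * Sfun (A3 \<union> A1))"
proof -
  let ?f = "\<lambda>(A1, A2, A3). sqrt (Sfun (A1 \<union> A2) * Sfun (A2 \<union> A3) * Sfun (A3 \<union> A1))"
  have "Sfun A = Min (?f ` tripartitions A)" using assms(2) by (subst Sfun.simps) simp
  also have "\<dots> \<in> ?f ` tripartitions A"
    using finite_tripartitions[OF assms(1)] tripartitions_nonempty[OF assms(2)] by (intro Min_in) auto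
  finally obtain A1 A2 A3 where A: "(A1, A2, A3) \<in> tripartitions A"
    and S: "Sfun A = sqrt (Sfun (A1 \<union> A2) * Sfun (A2 \<union> A3) * Sfun (A3 \<union> A1))" by auto
  have rot: "(A2, A3, A1) \<in> tripartitions A" "(A3, A1, A2) \<in> tripartitions A"
    using A unfolding tripartitions_def by auto
  from A assms(3) consider "b \<in> A1" | "b \<in> A2" | "b \<in> A3" unfolding tripartitions_def by blast
  then show ?thesis
  proof cases
    case 1
    then show ?thesis using that[OF A] S by blast
  next
    case 2
    show ?thesis by (rule that[OF rot(1) 2]) (simp add: S mult_ac)
  next
    case 3
    show ?thesis by (rule that[OF rot(2) 3]) (simp add: S mult_ac)
  qed
qed

lemma Sfun_pos:
  assumes "finite A" "2 \<le> card A" shows "0 < Sfun A"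
  using assms
proof (induction "card A" arbitrary: A rule: less_induct)
  case less
  show ?case
  proof (cases "card A = 2")
    case True
    then obtain x y where "A = {x, y}" "x \<noteq> y" by (meson card_2_iff)
    then show ?thesis by (simp add: Sfun_pair)
  next
    case False
    then have c: "3 \<le> card A" using less.prems by simp
    then obtain b where "b \<in> A" by (metis card.empty ex_in_conv not_numeral_le_zero)
    then obtain A1 A2 A3 where A: "(A1, A2, A3) \<in> tripartitions A"
      and S: "Sfun A = sqrt (Sfun (A1 \<union> A2) * Sfun (A2 \<union> A3) * Sfun (A3 \<union> A1))"
      using Sfun_attained[OF less.prems(1) c] by metis
    note t = tripartition_card[OF A less.prems(1)]
    have "0 < Sfun (A1 \<union> A2)" "0 < Sfun (A2 \<union> A3)" "0 < Sfun (A3 \<union> A1)"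
      by (rule less.hyps; use t in simp)+
    then show ?thesis unfolding S by simp
  qed
qed

text \<open>In the inductions on \<open>S\<close>, changing one part affects two of the three
  factors by the same ratio; under the square root this ratio appears once.\<close>

lemma sqrt_product_mono:
  fixes k :: real
  assumes "X \<le> sqrt (u * v * w)" "k * u \<le> u' * t" "k * w \<le> w' * t"
    "0 \<le> k" "0 \<le> t" "0 \<le> u" "0 \<le> v" "0 \<le> w" "0 \<le> u'" "0 \<le> w'"
  shows "k * X \<le> sqrt (u' * v * w') * t"
proof -
  have "k * X \<le> k * sqrt (u * v * w)" by (rule mult_left_mono) (use assms in auto)
  also have "\<dots> = sqrt ((k * u) * v * (k * w))"
    using assms by (simp add: real_sqrt_mult algebra_simps)
  also have "\<dots> \<le> sqrt ((u' * t) * v * (w' * t))"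
    by (rule real_sqrt_le_mono) (intro mult_mono[OF mult_right_mono] mult_nonneg_nonneg assms)
  also have "\<dots> = sqrt (u' * v * w') * t"
    using assms by (simp add: real_sqrt_mult algebra_simps)
  finally show ?thesis .
qed

text \<open>The induction step takes an optimal partition \<open>(B1, B2, B3)\<close> of \<open>insert b B\<close> with \<open>b \<in> B1\<close> and uses
  \<open>(C \<union> (B1 - {b}), B2, B3)\<close> as a partition of \<open>B \<union> C\<close>.\<close>

lemma Sfun_join:
  assumes "finite B" "finite C" "B \<noteq> {}" "C \<noteq> {}" "B \<inter> C = {}" "b \<notin> B \<union> C" "0 \<le> d"
    "\<And>x. x \<in> B \<union> C \<Longrightarrow> d \<le> norm (x - b)"
  shows "d\<^sup>2 / 4 * Sfun (B \<union> C) \<le> Sfun (insert b B) * Sfun (insert b C)"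
  using assms
proof (induction "card B + card C" arbitrary: B C rule: less_induct)
  case less
  \<comment> \<open>Stated for arbitrary \<open>B\<close> and \<open>C\<close>, since it is used
    again with their roles exchanged.\<close>
  have split: "d\<^sup>2 / 4 * Sfun (B \<union> C) \<le> Sfun (insert b B) * Sfun (insert b C)"
    if fin: "finite B" "finite C" and ne: "B \<noteq> {}" "C \<noteq> {}" and disj: "B \<inter> C = {}" and b: "b \<notin> B \<union> C"
      and d: "\<And>x. x \<in> B \<union> C \<Longrightarrow> d \<le> norm (x - b)" and c2: "2 \<le> card B"
      and IH: "\<And>B'. B' \<subset> B \<Longrightarrow> B' \<noteq> {} \<Longrightarrow> d\<^sup>2 / 4 * Sfun (B' \<union> C) \<le> Sfun (insert b B') * Sfun (insert b C)" for B C
  proof -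
    have c3: "3 \<le> card (insert b B)" using c2 b fin by simp
    obtain B1 B2 B3 where B: "(B1, B2, B3) \<in> tripartitions (insert b B)" and bB: "b \<in> B1"
      and S: "Sfun (insert b B) = sqrt (Sfun (B1 \<union> B2) * Sfun (B2 \<union> B3) * Sfun (B3 \<union> B1))"
      by (rule Sfun_attained[OF _ c3]) (use fin in auto)
    have p: "B2 \<noteq> {}" "B3 \<noteq> {}" "B1 \<inter> B2 = {}" "B2 \<inter> B3 = {}" "B3 \<inter> B1 = {}" "B1 \<union> B2 \<union> B3 = insert b B"
      using B unfolding tripartitions_def by auto
    note t = tripartition_card[OF B finite.insertI[OF fin(1)]]
    define B' where "B' = B1 - {b}"
    have B': "insert b (B' \<union> B2) = B1 \<union> B2" "insert b (B3 \<union> B') = B3 \<union> B1" "b \<notin> B2" "b \<notin> B3"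
      "B' \<union> B2 \<union> B3 = B" using bB p b unfolding B'_def by auto
    have dis: "B' \<inter> B2 = {}" "B3 \<inter> B' = {}" using p unfolding B'_def by auto
    have sub: "B' \<union> B2 \<subset> B" "B3 \<union> B' \<subset> B" using p(1,2,4) B'(5) dis by blast+
    have "(C \<union> B', B2, B3) \<in> tripartitions (B \<union> C)"
      unfolding tripartitions_def using p(1,2,4) disj ne(2) B'(5) dis by blast
    moreover have "3 \<le> card (B \<union> C)"
    proof -
      have "1 \<le> card C" using ne fin by (simp add: Suc_leI card_gt_0_iff)
      then show ?thesis using c2 fin disj by (simp add: card_Un_disjoint)
    qed
    ultimately have "Sfun (B \<union> C) \<le> sqrt (Sfun (C \<union> B' \<union> B2) * Sfun (B2 \<union> B3) * Sfun (B3 \<union> (C \<union> B')))"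
      using fin by (intro Sfun_le) auto
    moreover have "d\<^sup>2 / 4 * Sfun (C \<union> B' \<union> B2) \<le> Sfun (B1 \<union> B2) * Sfun (insert b C)"
      using IH[OF sub(1)] p(1) unfolding B'(1) by (simp add: Un_ac)
    moreover have "d\<^sup>2 / 4 * Sfun (B3 \<union> (C \<union> B')) \<le> Sfun (B3 \<union> B1) * Sfun (insert b C)"
      using IH[OF sub(2)] p(2) unfolding B'(2) by (simp add: Un_ac)
    moreover have "0 < Sfun (B2 \<union> B3)" "0 < Sfun (B1 \<union> B2)" "0 < Sfun (B3 \<union> B1)"
      by (rule Sfun_pos; use t in simp)+
    moreover have "0 < Sfun (insert b C)"
    proof (rule Sfun_pos)
      have "1 \<le> card C" using ne fin by (simp add: Suc_leI card_gt_0_iff)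
      then show "2 \<le> card (insert b C)" using b fin by simp
    qed (use fin in simp)
    moreover have "0 \<le> Sfun (C \<union> B' \<union> B2)" "0 \<le> Sfun (B3 \<union> (C \<union> B'))"
    proof -
      have Spos: "0 \<le> Sfun (D \<union> C)" if "D \<noteq> {}" "D \<subseteq> B" for D
      proof (rule less_imp_le[OF Sfun_pos])
        show "finite (D \<union> C)" using fin finite_subset[OF that(2)] by simp
        have "1 \<le> card C" using ne fin by (simp add: Suc_leI card_gt_0_iff)
        moreover have "1 \<le> card D" using that fin finite_subset[OF that(2)] by (simp add: Suc_leI card_gt_0_iff)
        moreover have "card (D \<union> C) = card D + card C"
          using that fin disj finite_subset[OF that(2)] by (intro card_Un_disjoint) auto
        ultimately show "2 \<le> card (D \<union> C)" by simp
      qed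
      show "0 \<le> Sfun (C \<union> B' \<union> B2)" "0 \<le> Sfun (B3 \<union> (C \<union> B'))"
        using Spos[of "B' \<union> B2"] Spos[of "B3 \<union> B'"] psubset_imp_subset[OF sub(1)] psubset_imp_subset[OF sub(2)] p(1,2)
        by (simp_all add: Un_ac)
    qed
    ultimately have "d\<^sup>2 / 4 * Sfun (B \<union> C) \<le>
        sqrt (Sfun (B1 \<union> B2) * Sfun (B2 \<union> B3) * Sfun (B3 \<union> B1)) * Sfun (insert b C)"
      by (intro sqrt_product_mono[of _ "Sfun (C \<union> B' \<union> B2)" _ "Sfun (B3 \<union> (C \<union> B'))"]) auto
    then show ?thesis unfolding S .
  qed
  have c1: "1 \<le> card B" "1 \<le> card C" using less.prems by (simp_all add: Suc_leI card_gt_0_iff)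
  consider "2 \<le> card B" | "2 \<le> card C" | "card B = 1" "card C = 1" using c1 by linarith
  then show ?case
  proof cases
    case 1
    show ?thesis
    proof (rule split[OF less.prems(1-6,8) 1])
      fix B' assume B': "B' \<subset> B" "B' \<noteq> {}"
      have "card B' < card B" using psubset_card_mono[OF less.prems(1) B'(1)] .
      then show "d\<^sup>2 / 4 * Sfun (B' \<union> C) \<le> Sfun (insert b B') * Sfun (insert b C)"
        using less.prems B' finite_subset[of B' B] by (intro less.hyps) auto
    qed
  next
    case 2
    have "d\<^sup>2 / 4 * Sfun (C \<union> B) \<le> Sfun (insert b C) * Sfun (insert b B)"
    proof (rule split[OF less.prems(2,1,4,3) _ _ _ 2])
      show "C \<inter> B = {}" "b \<notin> C \<union> B" using less.prems by auto
      show "d \<le> norm (x - b)" if "x \<in> C \<union> B" for x by (rule less.prems(8)) (use that in blast)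
      fix C' assume C': "C' \<subset> C" "C' \<noteq> {}"
      have "card C' < card C" using psubset_card_mono[OF less.prems(2) C'(1)] .
      then show "d\<^sup>2 / 4 * Sfun (C' \<union> B) \<le> Sfun (insert b C') * Sfun (insert b B)"
        using less.prems C' finite_subset[of C' C] by (intro less.hyps) auto
    qed
    then show ?thesis by (simp add: Un_commute mult.commute)
  next
    case 3
    then obtain x y where xy: "B = {x}" "C = {y}" by (metis card_1_singletonE)
    have ne: "b \<noteq> x" "b \<noteq> y" "x \<noteq> y" using less.prems xy by auto
    let ?p = "norm (x - b)" and ?q = "norm (y - b)"
    have d: "d \<le> ?p" "d \<le> ?q" using less.prems(8) xy by auto
    \<comment> \<open>Origin of the factor \<open>1 / 4\<close>: since both distances are at least
      \<open>d\<close>, half of \<open>d\<close> times their sum is at most their product.\<close>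
    have "norm (x - y) \<le> ?p + ?q" using norm_triangle_ineq4[of "x - b" "y - b"] by simp
    then have "d / 2 * norm (x - y) \<le> d / 2 * (?p + ?q)" using \<open>0 \<le> d\<close> by (intro mult_left_mono) auto
    also have "\<dots> \<le> ?p * ?q"
      using mult_right_mono[OF d(2), of ?p] mult_right_mono[OF d(1), of ?q] by (simp add: algebra_simps)
    finally have "(d / 2 * norm (x - y))\<^sup>2 \<le> (?p * ?q)\<^sup>2" using \<open>0 \<le> d\<close> by (intro power_mono) auto
    then show ?thesis unfolding xy using ne
      by (simp add: Sfun_pair power_mult_distrib power_divide norm_minus_commute insert_commute)
  qed
qed

text \<open>If \<open>b\<close> is alone in its part of an optimal partition,
  \<open>Sfun_join\<close> merges the other two parts, and its \<open>d\<^sup>2 / 4\<close> becomes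
  \<open>d / 2\<close> under the root. Otherwise \<open>b\<close> is deleted from its part and the
  induction hypothesis applies to the two unions that contain \<open>b\<close>.\<close>

lemma Sfun_remove:
  assumes "finite A" "3 \<le> card A" "b \<in> A" "0 \<le> d" "\<And>x. x \<in> A - {b} \<Longrightarrow> d \<le> norm (x - b)"
  shows "d / 2 * Sfun (A - {b}) \<le> Sfun A"
  using assms
proof (induction "card A" arbitrary: A rule: less_induct)
  case less
  obtain A1 A2 A3 where A: "(A1, A2, A3) \<in> tripartitions A" and b: "b \<in> A1"
    and S: "Sfun A = sqrt (Sfun (A1 \<union> A2) * Sfun (A2 \<union> A3) * Sfun (A3 \<union> A1))"
    by (rule Sfun_attained[OF less.prems(1-3)])
  have p: "A2 \<noteq> {}" "A3 \<noteq> {}" "A1 \<inter> A2 = {}" "A2 \<inter> A3 = {}" "A3 \<inter> A1 = {}" "A1 \<union> A2 \<union> A3 = A"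
    using A unfolding tripartitions_def by auto
  note t = tripartition_card[OF A less.prems(1)]
  have pos: "0 < Sfun (A2 \<union> A3)" "0 < Sfun (A1 \<union> A2)" "0 < Sfun (A3 \<union> A1)"
    by (rule Sfun_pos; use t in simp)+
  show ?case
  proof (cases "A1 = {b}")
    case True
    have "d\<^sup>2 / 4 * Sfun (A2 \<union> A3) \<le> Sfun (insert b A2) * Sfun (insert b A3)"
      by (rule Sfun_join) (use p t less.prems True in auto)
    then have "d\<^sup>2 / 4 * Sfun (A2 \<union> A3) * Sfun (A2 \<union> A3) \<le> Sfun (A1 \<union> A2) * Sfun (A3 \<union> A1) * Sfun (A2 \<union> A3)"
      using pos True by (intro mult_right_mono) (auto simp: insert_commute)
    then have "(d / 2 * Sfun (A2 \<union> A3))\<^sup>2 \<le> Sfun (A1 \<union> A2) * Sfun (A2 \<union> A3) * Sfun (A3 \<union> A1)"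
      by (simp add: power2_eq_square mult_ac)
    then have "d / 2 * Sfun (A2 \<union> A3) \<le> sqrt (Sfun (A1 \<union> A2) * Sfun (A2 \<union> A3) * Sfun (A3 \<union> A1))"
      by (rule real_le_rsqrt)
    moreover have "A - {b} = A2 \<union> A3" using True p b by auto
    ultimately show ?thesis unfolding S by simp
  next
    case False
    define A' where "A' = A1 - {b}"
    have A': "A' \<noteq> {}" "A' \<union> A2 \<union> A3 = A - {b}" "A1 \<union> A2 - {b} = A' \<union> A2" "A3 \<union> A1 - {b} = A3 \<union> A'"
      using False b p unfolding A'_def by auto
    have cA: "1 \<le> card A'" "2 \<le> card A1" "card A1 = Suc (card A')"
    proof -
      show "1 \<le> card A'" using A'(1) t(1) by (simp add: A'_def Suc_leI card_gt_0_iff)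
      moreover show "card A1 = Suc (card A')" unfolding A'_def using b t(1) by (metis card_Suc_Diff1)
      ultimately show "2 \<le> card A1" by simp
    qed
    have part: "(A', A2, A3) \<in> tripartitions (A - {b})"
    proof -
      have "A' \<subseteq> A1" unfolding A'_def by blast
      then show ?thesis unfolding tripartitions_def using A'(1,2) p(1-5) by blast
    qed
    note t' = tripartition_card[OF part finite_Diff[OF less.prems(1)]]
    have pos': "0 < Sfun (A' \<union> A2)" "0 < Sfun (A3 \<union> A')"
      by (rule Sfun_pos; use t' in simp)+
    have "Sfun (A - {b}) \<le> sqrt (Sfun (A' \<union> A2) * Sfun (A2 \<union> A3) * Sfun (A3 \<union> A'))"
      by (rule Sfun_le[OF _ _ part]) (use t' less.prems in auto)
    moreover have "d / 2 * Sfun (A1 \<union> A2 - {b}) \<le> Sfun (A1 \<union> A2)"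
      by (rule less.hyps) (use t cA less.prems b p in auto)
    moreover have "d / 2 * Sfun (A3 \<union> A1 - {b}) \<le> Sfun (A3 \<union> A1)"
      by (rule less.hyps) (use t cA less.prems b p in auto)
    ultimately have "d / 2 * Sfun (A - {b}) \<le> sqrt (Sfun (A1 \<union> A2) * Sfun (A2 \<union> A3) * Sfun (A3 \<union> A1)) * 1"
      using pos pos' less.prems(4) unfolding A'(3,4)
      by (intro sqrt_product_mono[of _ "Sfun (A' \<union> A2)" _ "Sfun (A3 \<union> A')"]) (auto intro: less_imp_le)
    then show ?thesis unfolding S by simp
  qed
qed

text \<open>Each part occurs in two of the three unions, so their cardinalities add up to
  \<open>2 * card A\<close>, which the square root halves.\<close>

lemma Sfun_ge_power:
  assumes "finite A" "2 \<le> card A" "0 \<le> r" "\<And>x y. x \<in> A \<Longrightarrow> y \<in> A \<Longrightarrow> x \<noteq> y \<Longrightarrow> r \<le> norm (x - y)"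
  shows "r ^ card A \<le> Sfun A"
  using assms
proof (induction "card A" arbitrary: A rule: less_induct)
  case less
  show ?case
  proof (cases "card A = 2")
    case True
    then obtain x y where xy: "A = {x, y}" "x \<noteq> y" by (meson card_2_iff)
    then have "r\<^sup>2 \<le> (norm (x - y))\<^sup>2" using less.prems by (intro power_mono) auto
    then show ?thesis using True unfolding xy(1) Sfun_pair[OF xy(2)] by simp
  next
    case False
    then have c: "3 \<le> card A" using less.prems by simp
    then obtain b where "b \<in> A" by (metis card.empty ex_in_conv not_numeral_le_zero)
    then obtain A1 A2 A3 where A: "(A1, A2, A3) \<in> tripartitions A"
      and S: "Sfun A = sqrt (Sfun (A1 \<union> A2) * Sfun (A2 \<union> A3) * Sfun (A3 \<union> A1))"
      using Sfun_attained[OF less.prems(1) c] by metis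
    note t = tripartition_card[OF A less.prems(1)]
    have sub: "A1 \<union> A2 \<subseteq> A" "A2 \<union> A3 \<subseteq> A" "A3 \<union> A1 \<subseteq> A" using A unfolding tripartitions_def by auto
    have ge: "r ^ card D \<le> Sfun D" if "D \<subseteq> A" "2 \<le> card D" "card D < card A" for D
    proof (rule less.hyps)
      show "r \<le> norm (x - y)" if "x \<in> D" "y \<in> D" "x \<noteq> y" for x y
        by (rule less.prems(4)) (use that \<open>D \<subseteq> A\<close> in blast)+
    qed (use that less.prems finite_subset[OF that(1)] in auto)
    have "r ^ card (A1 \<union> A2) * r ^ card (A2 \<union> A3) * r ^ card (A3 \<union> A1) \<le>
        Sfun (A1 \<union> A2) * Sfun (A2 \<union> A3) * Sfun (A3 \<union> A1)"
      by (intro mult_mono ge sub mult_nonneg_nonneg zero_le_power less.prems less_imp_le[OF Sfun_pos])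
        (use t in auto)
    moreover have "r ^ card (A1 \<union> A2) * r ^ card (A2 \<union> A3) * r ^ card (A3 \<union> A1) = (r ^ card A)\<^sup>2"
      unfolding power2_eq_square power_add[symmetric] t(7-10) by (rule arg_cong[where f = "power r"]) simp
    ultimately show ?thesis unfolding S by (intro real_le_rsqrt) simp
  qed
qed

section \<open>Adding and removing a point\<close>

lemma inj_plane: "inj plane"
  unfolding plane_def by (rule injI) (auto simp: prod_eq_iff)

lemma card_plane_image: "card (plane ` X) = card X"
  by (rule card_image) (rule inj_on_subset[OF inj_plane], simp)

lemma norm_plane_diff:
  "norm (plane x - plane y) = sqrt ((of_int (fst x - fst y))\<^sup>2 + (of_int (snd x - snd y))\<^sup>2)"
  unfolding plane_def by (simp add: norm_Pair)

lemma box_if_norm_plane_le: "norm (plane x - plane y) \<le> of_int n \<Longrightarrow> y \<in> box x n"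
proof -
  assume *: "norm (plane x - plane y) \<le> of_int n"
  have "\<bar>real_of_int (fst x - fst y)\<bar> \<le> of_int n" "\<bar>real_of_int (snd x - snd y)\<bar> \<le> of_int n"
    using order_trans[OF real_sqrt_ge_abs1 *[unfolded norm_plane_diff]]
      order_trans[OF real_sqrt_ge_abs2 *[unfolded norm_plane_diff]] by simp_all
  then show ?thesis unfolding in_box by linarith
qed

lemma norm_plane_le_if_box: "y \<in> box x n \<Longrightarrow> norm (plane x - plane y) \<le> 2 * of_int n"
proof -
  assume *: "y \<in> box x n"
  have "norm (plane x - plane y) \<le> \<bar>real_of_int (fst x - fst y)\<bar> + \<bar>real_of_int (snd x - snd y)\<bar>"
    unfolding norm_plane_diff by (rule sqrt_sum_squares_le_sum_abs)
  also have "\<dots> \<le> 2 * of_int n" using * unfolding in_box by linarith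
  finally show ?thesis .
qed

lemma norm_plane_ge_1:
  assumes "x \<noteq> y" shows "1 \<le> norm (plane x - plane y)"
proof -
  let ?s = "(fst x - fst y)\<^sup>2 + (snd x - snd y)\<^sup>2"
  have "0 < ?s" unfolding sum_power2_gt_zero_iff using assms by (auto simp: prod_eq_iff)
  then have "real_of_int 1 \<le> of_int ?s" by (simp only: of_int_le_iff)
  then have "1 \<le> sqrt (of_int ?s)" by (simp only: of_int_1 real_sqrt_ge_1_iff)
  then show ?thesis unfolding norm_plane_diff by (simp only: of_int_add of_int_power)
qed

lemma closest_pair:
  assumes "finite X" "2 \<le> card X"
  obtains a b where "a \<in> X" "b \<in> X" "a \<noteq> b"
    "\<And>x y. x \<in> X \<Longrightarrow> y \<in> X \<Longrightarrow> x \<noteq> y \<Longrightarrow> norm (plane a - plane b) \<le> norm (plane x - plane y)"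
proof -
  let ?Q = "{(x, y) \<in> X \<times> X. x \<noteq> y}" and ?f = "\<lambda>(x, y). norm (plane x - plane y)"
  have fin: "finite (?f ` ?Q)" using assms(1) by (intro finite_imageI finite_subset[of ?Q "X \<times> X"]) auto
  obtain u v where "u \<in> X" "v \<in> X" "u \<noteq> v"
    using assms by (metis card_le_Suc0_iff_eq not_less_eq_eq numeral_2_eq_2)
  then have "?Q \<noteq> {}" by blast
  then have "Min (?f ` ?Q) \<in> ?f ` ?Q" using fin by (intro Min_in) auto
  then obtain a b where ab: "(a, b) \<in> ?Q" "Min (?f ` ?Q) = ?f (a, b)" by blast
  have "norm (plane a - plane b) \<le> norm (plane x - plane y)" if "x \<in> X" "y \<in> X" "x \<noteq> y" for x y
  proof -
    have "Min (?f ` ?Q) \<le> ?f (x, y)" using that fin by (intro Min_le imageI) auto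
    then show ?thesis unfolding ab(2) by simp
  qed
  then show ?thesis using that ab(1) by blast
qed

lemma power_powr: "0 \<le> (x::real) \<Longrightarrow> (x ^ k) powr a = (x powr a) ^ k"
  by (induction k) (simp_all add: powr_mult)

text \<open>Until the connection first reaches \<open>K\<close> it uses no edge inside
  \<open>K\<close>, so this initial part is open in \<open>\<omega>\<close> itself.\<close>

lemma reroute:
  assumes "conn D (\<lambda>e. e \<subseteq> K \<or> \<omega> e) x v"
  shows "conn D \<omega> x v \<or> (\<exists>w\<in>K. conn D \<omega> x w)"
  using assms
proof (induction rule: conn_induct)
  case refl
  then show ?case by (simp add: conn_refl)
next
  case (step y z)
  show ?case
  proof (cases "\<exists>w\<in>K. conn D \<omega> x w")
    case False
    then have c: "conn D \<omega> x y" using step.IH by blast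
    then have "y \<notin> K" using False by blast
    then have "\<omega> {y, z}" using step(4) by auto
    then show ?thesis using conn_step[OF c step(2,3)] by blast
  qed blast
qed

context power_law
begin

abbreviation T :: "(int \<times> int) set \<Rightarrow> real" where
  "T X \<equiv> pr (\<lambda>\<omega>. same_cluster \<omega> X)"

text \<open>Open all edges near \<open>b\<close>: this makes the event that \<open>X - {b}\<close> is connected independent of the arm from \<open>b\<close>,
  and a circuit around \<open>b\<close> shows that its probability increases by at most a constant factor.\<close>

lemma remove_point_upper:
  assumes "finite X" "b \<in> X" "X \<noteq> {b}" "0 \<le> r" "\<And>x. x \<in> X - {b} \<Longrightarrow> x \<notin> box b (3 * r)"
    and p: "p \<le> pr (circ b r)" "0 < p"
  shows "T X \<le> arm_pr r * T (X - {b}) / p"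
proof -
  obtain N0 where N0: "box b (3 * r) \<subseteq> box (0, 0) (int N0)" using finite_subset_large_box[OF finite_box] by blast
  show ?thesis
  proof (rule pr_same_cluster_le[OF assms(1), of N0])
    fix N assume "N0 \<le> N"
    let ?D = "box (0, 0) (int N)"
    have D: "box b (3 * r) \<subseteq> ?D" using N0 box_mono[of "int N0" "int N" "(0, 0)"] \<open>N0 \<le> N\<close> by auto
    define E where "E \<omega> = linked ?D (X - {b}) (\<lambda>e. e \<subseteq> box b r \<or> \<omega> e)" for \<omega>
    let ?F = "edges_in ?D - edges_in (box b r)"
    have detE: "determined ?F E"
      unfolding determined_def
    proof (intro allI impI)
      fix \<omega> \<omega>' :: "(int \<times> int) set \<Rightarrow> bool" assume *: "\<forall>e\<in>?F. \<omega> e = \<omega>' e"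
      have "conn ?D (\<lambda>e. e \<subseteq> box b r \<or> \<omega> e) x y = conn ?D (\<lambda>e. e \<subseteq> box b r \<or> \<omega>' e) x y" for x y
        by (rule determinedD[OF conn_determined]) (use * in \<open>auto simp: edges_in_def\<close>)
      then show "E \<omega> = E \<omega>'" unfolding E_def linked_def by simp
    qed
    have finF: "finite ?F" "?F \<subseteq> lattice_edges" using finite_edges_in[of ?D] edges_in_lattice by auto
    have upE: "up_event E"
      unfolding up_event_def
    proof
      show "finitary E" by (rule finitaryI[OF finF detE])
      show "increasing E" unfolding increasing_def
      proof (intro allI impI)
        fix \<omega> \<omega>' :: "(int \<times> int) set \<Rightarrow> bool" assume le: "\<omega> \<le> \<omega>'" and "E \<omega>"
        then have "conn ?D (\<lambda>e. e \<subseteq> box b r \<or> \<omega> e) x y" if "x \<in> X - {b}" "y \<in> X - {b}" for x y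
          using that unfolding E_def linked_def by blast
        then have "conn ?D (\<lambda>e. e \<subseteq> box b r \<or> \<omega>' e) x y" if "x \<in> X - {b}" "y \<in> X - {b}" for x y
          by (rule conn_mono[OF _ order_refl]) (use that le in \<open>auto simp: le_fun_def\<close>)
        then show "E \<omega>'" unfolding E_def linked_def by blast
      qed
    qed
    have "pr E * p \<le> pr (\<lambda>\<omega>. E \<omega> \<and> circ b r \<omega>)"
      by (rule Harris_ge[OF upE up_event_circ order_refl p(1)]) (use p(2) pr_nonneg in auto)
    also have "\<dots> \<le> T (X - {b})"
    proof (rule pr_le_same_cluster)
      fix \<omega> assume E: "E \<omega> \<and> circ b r \<omega>"
      obtain c where c: "\<And>D D' u v. conn D \<omega> u v \<Longrightarrow> u \<in> box b r \<Longrightarrow> v \<notin> box b (3 * r) \<Longrightarrow>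
        D \<subseteq> D' \<Longrightarrow> box b (3 * r) \<subseteq> D' \<Longrightarrow> conn D' \<omega> c u"
        by (rule circ_hit[of b r \<omega>]) (use E in blast)+
      \<comment> \<open>If the connection depends on the opened edges, \<open>x\<close> reaches
        \<open>box b r\<close> in \<open>\<omega>\<close> from outside the annulus and is joined to
        \<open>c\<close>. Applied in both directions, this joins \<open>x\<close> and
        \<open>y\<close> directly or through \<open>c\<close>.\<close>
      have alt: "conn ?D \<omega> x y \<or> conn ?D \<omega> c x" if xy: "x \<in> X - {b}" "y \<in> X - {b}" for x y
      proof -
        have "conn ?D (\<lambda>e. e \<subseteq> box b r \<or> \<omega> e) x y" using E xy unfolding E_def linked_def by blast
        from reroute[OF this] show ?thesis
        proof
          assume "\<exists>w\<in>box b r. conn ?D \<omega> x w"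
          then obtain w where w: "w \<in> box b r" "conn ?D \<omega> x w" by blast
          have "conn ?D \<omega> c w" by (rule c[OF conn_sym[OF w(2)] w(1) assms(5)[OF xy(1)] order_refl D])
          then show ?thesis using conn_trans[OF _ conn_sym[OF w(2)]] by blast
        qed blast
      qed
      show "linked ?D (X - {b}) \<omega>"
        unfolding linked_def
      proof (intro ballI)
        fix x y assume xy: "x \<in> X - {b}" "y \<in> X - {b}"
        show "conn ?D \<omega> x y"
        proof (cases "conn ?D \<omega> x y \<or> conn ?D \<omega> y x")
          case True
          then show ?thesis using conn_sym[of ?D \<omega> y x] by blast
        next
          case False
          then have "conn ?D \<omega> c x" "conn ?D \<omega> c y" using alt[OF xy] alt[OF xy(2,1)] by blast+
          then show ?thesis using conn_trans[OF conn_sym] by blast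
        qed
      qed
    qed (use assms(1) in simp)
    finally have Ep: "pr E \<le> T (X - {b}) / p" using p(2) by (simp add: field_simps)
    have "pr (linked ?D X) \<le> pr (\<lambda>\<omega>. arm b r \<omega> \<and> E \<omega>)"
    proof (rule pr_mono[OF up_event_event[OF up_event_conj[OF up_event_arm upE]]])
      fix \<omega> assume L: "linked ?D X \<omega>"
      obtain x where x: "x \<in> X - {b}" using assms(2,3) by blast
      then have "x \<notin> box b (r - 1)" using assms(4) assms(5)[of x] box_mono[of "r - 1" "3 * r" b] by auto
      moreover have "conn ?D \<omega> b x" using L x assms(2) unfolding linked_def by blast
      ultimately have "arm b r \<omega>" using assms(4) by (intro arm_of_conn)
      moreover have "conn ?D (\<lambda>e. e \<subseteq> box b r \<or> \<omega> e) u v" if "u \<in> X" "v \<in> X" for u v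
        using L that conn_mono[of ?D \<omega> u v ?D "\<lambda>e. e \<subseteq> box b r \<or> \<omega> e"] unfolding linked_def by auto
      then have "E \<omega>" unfolding E_def linked_def by simp
      ultimately show "arm b r \<omega> \<and> E \<omega>" by blast
    qed
    also have "\<dots> = pr (arm b r) * pr E"
      by (rule pr_indep[OF finite_edges_in[OF finite_box] edges_in_lattice arm_determined finF detE]) auto
    also have "\<dots> \<le> arm_pr r * (T (X - {b}) / p)"
      unfolding pr_arm by (rule mult_left_mono[OF Ep]) (simp add: arm_pr_def pr_nonneg)
    finally show "pr (linked ?D X) \<le> arm_pr r * T (X - {b}) / p" by simp
  qed
qed

lemma T_mono: "finite X \<Longrightarrow> Y \<subseteq> X \<Longrightarrow> T X \<le> T Y"
  by (rule pr_mono[OF event_same_cluster[OF finite_subset]]) (auto simp: same_cluster_def)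

lemma remove_point_power_upper:
  "\<exists>A>0. \<forall>X b \<delta>. finite X \<longrightarrow> b \<in> X \<longrightarrow> X \<noteq> {b} \<longrightarrow> 0 < \<delta> \<longrightarrow>
     (\<forall>x\<in>X - {b}. \<delta> \<le> norm (plane b - plane x)) \<longrightarrow> T X \<le> A * \<delta> powr (- \<eta> / 2) * T (X - {b})"
proof -
  obtain p M where p: "0 < p" and M: "1 \<le> M"
    and scale: "\<And>n. 1 \<le> n \<Longrightarrow> \<exists>r\<ge>n. r \<le> M * n \<and> (\<forall>z. p \<le> pr (circ z r))"
    using circ_scales by blast
  obtain A0 where A0: "0 < A0" "\<And>n. 1 \<le> n \<Longrightarrow> arm_pr n \<le> A0 * of_int n powr (- \<eta> / 2)"
    using arm_upper by blast
  \<comment> \<open>The maximum with \<open>1\<close> covers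
    \<open>\<delta> \<le> 12 * of_int M\<close>, where \<open>T_mono\<close> is used instead of a
    circuit.\<close>
  define A where "A = max 1 (A0 / p) * (1 / (12 * of_int M)) powr (- \<eta> / 2)"
  have "0 < A" unfolding A_def using M by (simp add: less_max_iff_disj)
  moreover have "T X \<le> A * \<delta> powr (- \<eta> / 2) * T (X - {b})"
    if X: "finite X" "b \<in> X" "X \<noteq> {b}" and \<delta>: "0 < \<delta>" "\<forall>x\<in>X - {b}. \<delta> \<le> norm (plane b - plane x)" for X b \<delta>
  proof -
    let ?d = "\<delta> / (12 * of_int M)"
    have "A * \<delta> powr (- \<eta> / 2) = max 1 (A0 / p) * ((1 / (12 * of_int M)) powr (- \<eta> / 2) * \<delta> powr (- \<eta> / 2))"
      unfolding A_def by (simp only: mult.assoc)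
    also have "(1 / (12 * of_int M)) powr (- \<eta> / 2) * \<delta> powr (- \<eta> / 2) = ?d powr (- \<eta> / 2)"
      using M \<delta>(1) by (subst powr_mult[symmetric]) auto
    finally have A_eq: "A * \<delta> powr (- \<eta> / 2) = max 1 (A0 / p) * ?d powr (- \<eta> / 2)" .
    have T0: "0 \<le> T (X - {b})" by (rule pr_nonneg)
    show ?thesis
    proof (cases "\<delta> \<le> 12 * of_int M")
      case True
      then have "1 powr (- \<eta> / 2) \<le> ?d powr (- \<eta> / 2)" using \<delta>(1) M eta by (intro powr_mono2') auto
      then have "1 * 1 \<le> max 1 (A0 / p) * ?d powr (- \<eta> / 2)" by (intro mult_mono) auto
      then have "1 * T (X - {b}) \<le> A * \<delta> powr (- \<eta> / 2) * T (X - {b})"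
        unfolding A_eq by (intro mult_right_mono T0) simp
      then show ?thesis using T_mono[OF X(1), of "X - {b}"] by auto
    next
      case False
      \<comment> \<open>As \<open>1 < ?d\<close>, rounding up keeps \<open>k\<close> below
        \<open>2 * ?d\<close>. Then \<open>r \<le> M * k\<close> gives
        \<open>6 * r < \<delta>\<close>, so no other point lies in
        \<open>box b (3 * r)\<close>.\<close>
      define k where "k = \<lfloor>\<delta> / (12 * of_int M)\<rfloor> + 1"
      have 1: "1 < ?d" using False M by (simp add: field_simps)
      then have "1 \<le> \<lfloor>?d\<rfloor>" by simp
      then have "2 \<le> k" unfolding k_def by linarith
      moreover have "of_int k < 2 * ?d" "?d \<le> of_int k" unfolding k_def using 1 by linarith+
      moreover have "2 * ?d = \<delta> / (6 * of_int M)" by simp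
      ultimately have k: "2 \<le> k" "of_int k < \<delta> / (6 * of_int M)" "?d \<le> of_int k" by simp_all
      obtain r where r: "k \<le> r" "r \<le> M * k" "\<forall>z. p \<le> pr (circ z r)" using scale[of k] k by auto
      have out: "x \<notin> box b (3 * r)" if "x \<in> X - {b}" for x
      proof
        assume "x \<in> box b (3 * r)"
        then have "norm (plane b - plane x) \<le> 2 * of_int (3 * r)" by (rule norm_plane_le_if_box)
        also have "2 * real_of_int (3 * r) \<le> 6 * of_int (M * k)"
        proof -
          have "real_of_int r \<le> of_int (M * k)" using r(2) by (simp only: of_int_le_iff)
          then show ?thesis by simp
        qed
        also have "\<dots> < \<delta>" using k(2) M by (simp add: field_simps)
        finally show False using \<delta>(2)[rule_format, OF that] by simp
      qed
      have "T X \<le> arm_pr r * T (X - {b}) / p"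
        by (rule remove_point_upper[OF X _ out r(3)[rule_format] p]) (use k r(1) in auto)
      also have "\<dots> \<le> (A0 / p * of_int r powr (- \<eta> / 2)) * T (X - {b})"
        using mult_right_mono[OF A0(2)[of r] T0] k r(1) p by (simp add: field_simps)
      also have "\<dots> \<le> (max 1 (A0 / p) * ?d powr (- \<eta> / 2)) * T (X - {b})"
        using k r(1) \<delta>(1) M eta A0(1) p by (intro mult_right_mono mult_mono powr_mono2' T0) auto
      finally show ?thesis unfolding A_eq .
    qed
  qed
  ultimately show ?thesis by blast
qed

text \<open>The point \<open>x\<close> beyond the annulus forces the connection from
  \<open>a\<close> to \<open>x\<close> to meet the circuit, which an arm from \<open>b\<close> meets
  as well; so \<open>b\<close> joins the cluster of \<open>X - {b}\<close>.\<close>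

lemma keep_point_lower:
  assumes "finite X" "a \<in> X" "b \<in> X" "a \<noteq> b" "b \<in> box a r" "0 \<le> r"
    and x: "x \<in> X" "x \<notin> box a (3 * r)" and p: "p \<le> pr (circ a r)" "0 \<le> p"
  shows "T (X - {b}) * (p * arm_pr (4 * r + 1)) \<le> T X"
proof (cases "p * arm_pr (4 * r + 1) = 0")
  case True
  then show ?thesis using pr_nonneg by (simp only: True mult_zero_right)
next
  case False
  have a0: "0 \<le> arm_pr (4 * r + 1)" unfolding arm_pr_def by (rule pr_nonneg)
  then have q: "0 < p * arm_pr (4 * r + 1)" using False p(2) by (simp add: less_le)
  have box: "a \<in> box a r" using assms(6) by (simp add: in_box)
  have xb: "x \<in> X - {b}" using x assms(5) box_mono[of r "3 * r" a] assms(6) by auto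
  have "T (X - {b}) \<le> T X / (p * arm_pr (4 * r + 1))"
  proof (rule pr_same_cluster_le[of _ 0])
    fix N :: nat
    let ?D = "box (0, 0) (int N)"
    have "pr (linked ?D (X - {b})) * (p * arm_pr (4 * r + 1)) \<le>
        pr (\<lambda>\<omega>. linked ?D (X - {b}) \<omega> \<and> (circ a r \<omega> \<and> arm b (4 * r + 1) \<omega>))"
      by (rule Harris_ge[OF _ _ order_refl Harris_ge[OF up_event_circ up_event_arm p(1)]])
        (simp_all add: up_event_conj up_event_linked up_event_circ up_event_arm assms a0 pr_arm pr_nonneg)
    also have "\<dots> \<le> T X"
    proof (rule pr_le_same_cluster[OF assms(1)])
      fix \<omega> assume E: "linked ?D (X - {b}) \<omega> \<and> (circ a r \<omega> \<and> arm b (4 * r + 1) \<omega>)"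
      let ?D' = "?D \<union> box a (3 * r) \<union> box b (4 * r + 1)"
      obtain c where c: "\<And>D D' u v. conn D \<omega> u v \<Longrightarrow> u \<in> box a r \<Longrightarrow> v \<notin> box a (3 * r) \<Longrightarrow>
        D \<subseteq> D' \<Longrightarrow> box a (3 * r) \<subseteq> D' \<Longrightarrow> conn D' \<omega> c u"
        by (rule circ_hit[of a r \<omega>]) (use E in blast)+
      have L: "conn ?D \<omega> a y" if "y \<in> X - {b}" for y using E that assms(2,4) unfolding linked_def by blast
      have ca: "conn ?D' \<omega> c a" by (rule c[OF L[OF xb] box x(2)]) auto
      obtain v where v: "conn (box b (4 * r + 1)) \<omega> b v" "v \<notin> box b (4 * r)" using E by (auto elim: armE)
      have cb: "conn ?D' \<omega> c b"
        by (rule c[OF v(1) assms(5)]) (use v(2) assms(5) in \<open>auto simp: in_box\<close>)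
      show "linked ?D' X \<omega>"
      proof (rule linked_via)
        fix y assume "y \<in> X"
        show "conn ?D' \<omega> c y"
        proof (cases "y = b")
          case False
          then have "conn ?D \<omega> a y" using L \<open>y \<in> X\<close> by simp
          then have "conn ?D' \<omega> a y" by (rule conn_subset) auto
          then show ?thesis by (rule conn_trans[OF ca])
        qed (simp add: cb)
      qed
    qed
    finally show "pr (linked ?D (X - {b})) \<le> T X / (p * arm_pr (4 * r + 1))" using q by (simp add: field_simps)
  qed (simp add: assms(1))
  then show ?thesis using q by (simp add: field_simps)
qed

text \<open>With no point outside the circuit, an arm is taken from every point, and all of them
  meet the circuit.\<close>

lemma all_arms_lower:
  assumes "finite X" "X \<subseteq> box a r" "0 \<le> r" and p: "p \<le> pr (circ a r)" "0 \<le> p"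
  shows "arm_pr (4 * r + 1) ^ card X * p \<le> T X"
proof -
  have a0: "0 \<le> arm_pr (4 * r + 1)" unfolding arm_pr_def by (rule pr_nonneg)
  have "arm_pr (4 * r + 1) ^ card X * p \<le> pr (\<lambda>\<omega>. (\<forall>x\<in>X. arm x (4 * r + 1) \<omega>) \<and> circ a r \<omega>)"
    by (rule Harris_ge[OF up_event_ball up_event_circ Harris_ball p(1)])
      (use assms a0 in \<open>simp_all add: up_event_arm pr_arm\<close>)
  also have "\<dots> \<le> T X"
  proof (rule pr_le_same_cluster[OF assms(1)])
    fix \<omega> assume E: "(\<forall>x\<in>X. arm x (4 * r + 1) \<omega>) \<and> circ a r \<omega>"
    obtain c where c: "\<And>D D' u v. conn D \<omega> u v \<Longrightarrow> u \<in> box a r \<Longrightarrow> v \<notin> box a (3 * r) \<Longrightarrow>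
      D \<subseteq> D' \<Longrightarrow> box a (3 * r) \<subseteq> D' \<Longrightarrow> conn D' \<omega> c u"
      by (rule circ_hit[of a r \<omega>]) (use E in blast)+
    show "linked (box a (6 * r + 1)) X \<omega>"
    proof (rule linked_via)
      fix x assume "x \<in> X"
      then have x: "x \<in> box a r" "arm x (4 * r + 1) \<omega>" using E assms(2) by auto
      obtain v where v: "conn (box x (4 * r + 1)) \<omega> x v" "v \<notin> box x (4 * r)" using x(2) by (auto elim: armE)
      show "conn (box a (6 * r + 1)) \<omega> c x"
        by (rule c[OF v(1) x(1)]) (use v(2) x(1) assms(3) in \<open>auto simp: in_box\<close>)
    qed
  qed
  finally show ?thesis .
qed

text \<open>Pigeonhole: the annuli obtained by iterating \<open>n \<mapsto> 3 * f n + 1\<close> are disjoint and do not contain \<open>a\<close>.\<close>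

lemma empty_annulus:
  fixes f :: "int \<Rightarrow> int"
  assumes f: "\<And>n. 1 \<le> n \<Longrightarrow> n \<le> f n \<and> f n \<le> M * n" and "1 \<le> M" "1 \<le> \<rho>" "finite X" "a \<in> X"
  shows "\<exists>n\<ge>\<rho>. f n \<le> M * (4 * M) ^ card X * \<rho> \<and> (\<forall>x\<in>X. x \<in> box a (f n) \<or> x \<notin> box a (3 * f n))"
proof -
  \<comment> \<open>\<open>f\<close> selects a good scale near its argument; the next one is sought
    just beyond the outer radius of the current annulus, which costs a factor of at most
    \<open>4 * M\<close>.\<close>
  define R where "R i = ((\<lambda>n. 3 * f n + 1) ^^ i) \<rho>" for i
  have R0: "R 0 = \<rho>" and RSuc: "R (Suc i) = 3 * f (R i) + 1" for i unfolding R_def by auto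
  have R_ge: "\<rho> \<le> R i" for i
  proof (induction i)
    case (Suc i)
    then show ?case using f[of "R i"] assms(3) unfolding RSuc by linarith
  qed (simp add: R0)
  have R_le: "R i \<le> (4 * M) ^ i * \<rho>" for i
  proof (induction i)
    case (Suc i)
    have "1 * 1 \<le> M * R i" by (rule mult_mono) (use R_ge[of i] assms in auto)
    then have "R (Suc i) \<le> 4 * M * R i" using f[of "R i"] R_ge[of i] assms(3) unfolding RSuc by simp
    also have "\<dots> \<le> 4 * M * ((4 * M) ^ i * \<rho>)" by (rule mult_left_mono[OF Suc]) (use assms in simp)
    finally show ?case by (simp add: mult_ac)
  qed (simp add: R0)
  have f1: "R i \<le> f (R i)" "f (R i) \<le> M * R i" "1 \<le> R i" for i using f[of "R i"] R_ge[of i] assms(3) by auto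
  have fSuc: "3 * f (R i) \<le> f (R (Suc i))" for i using f1(1)[of "Suc i"] unfolding RSuc by linarith
  have mono: "f (R i) \<le> f (R j)" if "i \<le> j" for i j
    by (rule lift_Suc_mono_le[OF _ that]) (use fSuc f1 in \<open>smt (verit)\<close>)
  have "\<exists>i<card X. \<forall>x\<in>X. x \<in> box a (f (R i)) \<or> x \<notin> box a (3 * f (R i))"
  proof (rule ccontr)
    assume "\<not> ?thesis"
    then have "\<forall>i<card X. \<exists>x. x \<in> X \<and> x \<notin> box a (f (R i)) \<and> x \<in> box a (3 * f (R i))" by blast
    then obtain g where g: "\<And>i. i < card X \<Longrightarrow> g i \<in> X \<and> g i \<notin> box a (f (R i)) \<and> g i \<in> box a (3 * f (R i))"
      by metis
    have neq: "g i \<noteq> g j" if "i < j" "j < card X" for i j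
    proof -
      have "3 * f (R i) \<le> f (R j)" using fSuc[of i] mono[of "Suc i" j] that(1) by simp
      then have "box a (3 * f (R i)) \<subseteq> box a (f (R j))" by (rule box_mono)
      then show ?thesis using g[of i] g[of j] that by auto
    qed
    have "inj_on g {..<card X}" by (rule inj_onI) (use neq in \<open>metis lessThan_iff linorder_neqE_nat\<close>)
    then have "card (g ` {..<card X}) = card X" by (simp add: card_image)
    moreover have ga: "g i \<noteq> a" if "i < card X" for i
      using g[OF that] f1(1,3)[of i] by (auto simp: in_box)
    have "g ` {..<card X} \<subseteq> X - {a}" using g ga by blast
    then have "card (g ` {..<card X}) \<le> card (X - {a})" using assms(4) by (intro card_mono) auto
    moreover have "card (X - {a}) < card X" using assms(4,5) by (rule card_Diff1_less)
    ultimately show False by simp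
  qed
  then obtain i where i: "i < card X" "\<forall>x\<in>X. x \<in> box a (f (R i)) \<or> x \<notin> box a (3 * f (R i))" by blast
  have "f (R i) \<le> M * ((4 * M) ^ i * \<rho>)"
    by (rule order_trans[OF f1(2) mult_left_mono[OF R_le]]) (use assms in simp)
  also have "\<dots> \<le> M * ((4 * M) ^ card X * \<rho>)"
    by (intro mult_left_mono mult_right_mono power_increasing) (use i(1) assms in auto)
  finally show ?thesis using R_ge[of i] i(2) by (intro exI[of _ "R i"]) (auto simp: mult_ac)
qed

lemma add_point_lower:
  "\<exists>e>0. \<forall>X a b. finite X \<longrightarrow> card X = k \<longrightarrow> a \<in> X \<longrightarrow> b \<in> X \<longrightarrow> a \<noteq> b \<longrightarrow>
     e * norm (plane a - plane b) powr (- \<eta> / 2) * T (X - {b}) \<le> T X \<or>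
     e * (norm (plane a - plane b) ^ k) powr (- \<eta> / 2) \<le> T X"
proof -
  obtain p M where p: "0 < p" and M: "1 \<le> M"
    and scale: "\<And>n. 1 \<le> n \<Longrightarrow> \<exists>r\<ge>n. r \<le> M * n \<and> (\<forall>z. p \<le> pr (circ z r))"
    using circ_scales by blast
  then obtain f where f: "\<And>n. 1 \<le> n \<Longrightarrow> n \<le> f n \<and> f n \<le> M * n"
    and circ: "\<And>n z. 1 \<le> n \<Longrightarrow> p \<le> pr (circ z (f n))" by metis
  obtain a0 where a0: "0 < a0" "\<And>n. 1 \<le> n \<Longrightarrow> a0 * of_int n powr (- \<eta> / 2) \<le> arm_pr n"
    using arm_lower by blast
  \<comment> \<open>The bound of \<open>empty_annulus\<close>. The \<open>10\<close> in
    \<open>a1\<close> comes from \<open>4 * r + 1 \<le> 5 * (L * \<rho>)\<close> and from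
    \<open>\<rho>\<close> being at most twice the distance of \<open>a\<close> and
    \<open>b\<close>.\<close>
  define L where "L = M * (4 * M) ^ k"
  have L: "1 \<le> L"
  proof -
    have "1 * 1 \<le> M * (4 * M) ^ k" by (intro mult_mono one_le_power) (use M in auto)
    then show ?thesis unfolding L_def by simp
  qed
  define a1 where "a1 = a0 * (10 * of_int L) powr (- \<eta> / 2)"
  have a1: "0 < a1" unfolding a1_def using a0 L by simp
  define e where "e = min (p * a1) (p * a1 ^ k)"
  have "0 < e" unfolding e_def using p a1 by simp
  moreover have "e * norm (plane a - plane b) powr (- \<eta> / 2) * T (X - {b}) \<le> T X \<or>
     e * (norm (plane a - plane b) ^ k) powr (- \<eta> / 2) \<le> T X"
    if X: "finite X" "card X = k" "a \<in> X" "b \<in> X" "a \<noteq> b" for X a b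
  proof -
    let ?\<delta> = "norm (plane a - plane b)"
    have \<delta>: "1 \<le> ?\<delta>" by (rule norm_plane_ge_1[OF X(5)])
    define \<rho> where "\<rho> = \<lceil>?\<delta>\<rceil>"
    have \<rho>: "1 \<le> \<rho>" "?\<delta> \<le> of_int \<rho>" "of_int \<rho> \<le> 2 * ?\<delta>" unfolding \<rho>_def using \<delta> by linarith+
    obtain n where n: "\<rho> \<le> n" "f n \<le> L * \<rho>" "\<forall>x\<in>X. x \<in> box a (f n) \<or> x \<notin> box a (3 * f n)"
      using empty_annulus[OF f M \<rho>(1) X(1,3)] X(2) unfolding L_def by auto
    define r where "r = f n"
    have r: "\<rho> \<le> r" "r \<le> L * \<rho>" "\<And>z. p \<le> pr (circ z r)"
      using n f[of n] circ[of n] \<rho>(1) unfolding r_def by auto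
    have ba: "b \<in> box a r" using box_if_norm_plane_le[OF \<rho>(2)] box_mono[OF r(1)] by blast
    have "real_of_int (4 * r + 1) \<le> (10 * of_int L) * ?\<delta>"
    proof -
      have "real_of_int (4 * r + 1) \<le> of_int (5 * (L * \<rho>))" unfolding of_int_le_iff using r \<rho>(1) by linarith
      also have "\<dots> = 5 * of_int L * of_int \<rho>" by simp
      also have "\<dots> \<le> 5 * of_int L * (2 * ?\<delta>)" by (rule mult_left_mono[OF \<rho>(3)]) (use L in simp)
      finally show ?thesis by simp
    qed
    then have "a0 * ((10 * of_int L) * ?\<delta>) powr (- \<eta> / 2) \<le> a0 * of_int (4 * r + 1) powr (- \<eta> / 2)"
      using a0(1) eta r(1) \<rho>(1) by (intro mult_left_mono powr_mono2') auto
    also have "\<dots> \<le> arm_pr (4 * r + 1)" by (rule a0(2)) (use r \<rho> in linarith)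
    finally have arm: "a1 * ?\<delta> powr (- \<eta> / 2) \<le> arm_pr (4 * r + 1)"
      unfolding a1_def using L \<delta> by (subst (asm) powr_mult) (auto simp: mult.assoc)
    show ?thesis
    proof (cases "X \<subseteq> box a r")
      case False
      then obtain x where x: "x \<in> X" "x \<notin> box a (3 * r)" using n(3) unfolding r_def by blast
      have "e * ?\<delta> powr (- \<eta> / 2) \<le> p * a1 * ?\<delta> powr (- \<eta> / 2)"
        by (rule mult_right_mono) (simp_all add: e_def)
      also have "\<dots> \<le> p * arm_pr (4 * r + 1)" using mult_left_mono[OF arm, of p] p by (simp add: mult_ac)
      finally have "e * ?\<delta> powr (- \<eta> / 2) * T (X - {b}) \<le> p * arm_pr (4 * r + 1) * T (X - {b})"
        by (rule mult_right_mono) (rule pr_nonneg)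
      also have "\<dots> = T (X - {b}) * (p * arm_pr (4 * r + 1))" by (rule mult.commute)
      also have "\<dots> \<le> T X"
        by (rule keep_point_lower[OF X(1,3,4,5) ba _ x r(3)]) (use r \<rho> p in auto)
      finally show ?thesis ..
    next
      case True
      have "(?\<delta> ^ k) powr (- \<eta> / 2) = (?\<delta> powr (- \<eta> / 2)) ^ k"
        by (rule power_powr) simp
      then have "e * (?\<delta> ^ k) powr (- \<eta> / 2) \<le> p * a1 ^ k * (?\<delta> powr (- \<eta> / 2)) ^ k"
        by (simp add: e_def mult_right_mono)
      also have "\<dots> = (a1 * ?\<delta> powr (- \<eta> / 2)) ^ k * p" by (simp add: power_mult_distrib)
      also have "\<dots> \<le> arm_pr (4 * r + 1) ^ k * p"
        by (intro mult_right_mono power_mono arm) (use a1 p in auto)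
      also have "\<dots> \<le> T X"
        using all_arms_lower[OF X(1) True _ r(3)] r(1) \<rho>(1) p X(2) by simp
      finally show ?thesis ..
    qed
  qed
  ultimately show ?thesis by blast
qed

section \<open>Induction on the number of points\<close>

text \<open>The exponent is negative, so lower bounds for \<open>S\<close> are what is required:
  \<open>Sfun_remove\<close> and \<open>Sfun_ge_power\<close> answer the two alternatives of
  \<open>add_point_lower\<close>, both with the minimal distance in \<open>X\<close>.\<close>

lemma k_point_lower:
  "2 \<le> k \<Longrightarrow> \<exists>e>0. \<forall>X. card X = k \<longrightarrow> e * Sfun (plane ` X) powr (- \<eta> / 2) \<le> T X"
proof (induction k rule: nat_induct_at_least)
  case base
  have "c * Sfun (plane ` X) powr (- \<eta> / 2) \<le> T X" if c2: "card X = 2" for X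
  proof -
    obtain x y where X: "X = {x, y}" "x \<noteq> y" using c2 by (meson card_2_iff)
    then have ne: "plane x \<noteq> plane y" using inj_plane by (simp add: inj_eq)
    have "Sfun (plane ` X) powr (- \<eta> / 2) = norm (plane x - plane y) powr (- \<eta>)"
      unfolding X image_insert image_empty Sfun_pair[OF ne]
      using power_powr[of "norm (plane x - plane y)" 2 "- \<eta> / 2"]
      by (simp add: power2_eq_square flip: powr_add)
    then show ?thesis using lower[OF X(2)] unfolding X(1) by simp
  qed
  then show ?case using c_pos by blast
next
  case (Suc k)
  obtain e1 where e1: "0 < e1" "\<And>X. card X = k \<Longrightarrow> e1 * Sfun (plane ` X) powr (- \<eta> / 2) \<le> T X"
    using Suc.IH by blast
  obtain e2 where e2: "0 < e2" "\<And>X a b. finite X \<Longrightarrow> card X = Suc k \<Longrightarrow> a \<in> X \<Longrightarrow> b \<in> X \<Longrightarrow> a \<noteq> b \<Longrightarrow>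
     e2 * norm (plane a - plane b) powr (- \<eta> / 2) * T (X - {b}) \<le> T X \<or>
     e2 * (norm (plane a - plane b) ^ Suc k) powr (- \<eta> / 2) \<le> T X"
    using add_point_lower[of "Suc k"] by blast
  define e where "e = min (e2 * e1 * 2 powr (- \<eta> / 2)) e2"
  have "e * Sfun (plane ` X) powr (- \<eta> / 2) \<le> T X" if X: "card X = Suc k" for X
  proof -
    have fin: "finite X" using X card.infinite by force
    obtain a b where ab: "a \<in> X" "b \<in> X" "a \<noteq> b"
      and close: "\<And>x y. x \<in> X \<Longrightarrow> y \<in> X \<Longrightarrow> x \<noteq> y \<Longrightarrow> norm (plane a - plane b) \<le> norm (plane x - plane y)"
      by (rule closest_pair[OF fin]) (use X Suc.hyps in auto)
    let ?\<delta> = "norm (plane a - plane b)" and ?S = "\<lambda>X. Sfun (plane ` X)"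
    have \<delta>: "1 \<le> ?\<delta>" by (rule norm_plane_ge_1[OF ab(3)])
    have cX: "card (X - {b}) = k" using X ab fin by simp
    have S: "0 < ?S X" "0 < ?S (X - {b})"
      using X cX Suc.hyps fin by (auto intro!: Sfun_pos simp: card_plane_image)
    from e2(2)[OF fin X ab] show ?thesis
    proof
      assume *: "e2 * ?\<delta> powr (- \<eta> / 2) * T (X - {b}) \<le> T X"
      have img: "plane ` (X - {b}) = plane ` X - {plane b}" using inj_plane by (simp add: image_set_diff)
      have "?\<delta> / 2 * Sfun (plane ` X - {plane b}) \<le> ?S X"
      proof (rule Sfun_remove)
        fix x assume "x \<in> plane ` X - {plane b}"
        then obtain y where "y \<in> X" "y \<noteq> b" "x = plane y" by blast
        then show "?\<delta> \<le> norm (x - plane b)" using close[of y b] ab by simp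
      qed (use fin X Suc.hyps ab in \<open>auto simp: card_plane_image\<close>)
      then have "?\<delta> * ?S (X - {b}) \<le> 2 * ?S X" unfolding img by simp
      then have "(2 * ?S X) powr (- \<eta> / 2) \<le> (?\<delta> * ?S (X - {b})) powr (- \<eta> / 2)"
        using S \<delta> eta by (intro powr_mono2' mult_pos_pos) (auto simp del: zero_less_norm_iff)
      then have "e2 * e1 * (2 powr (- \<eta> / 2) * ?S X powr (- \<eta> / 2)) \<le>
          e2 * e1 * (?\<delta> powr (- \<eta> / 2) * ?S (X - {b}) powr (- \<eta> / 2))"
        using S \<delta> e1 e2 by (simp add: powr_mult)
      also have "\<dots> = e2 * ?\<delta> powr (- \<eta> / 2) * (e1 * ?S (X - {b}) powr (- \<eta> / 2))" by simp
      also have "\<dots> \<le> e2 * ?\<delta> powr (- \<eta> / 2) * T (X - {b})"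
        by (rule mult_left_mono[OF e1(2)[OF cX]]) (use e2 in simp)
      also note *
      finally have "e2 * e1 * 2 powr (- \<eta> / 2) * ?S X powr (- \<eta> / 2) \<le> T X" by (simp add: mult_ac)
      moreover have "e * ?S X powr (- \<eta> / 2) \<le> e2 * e1 * 2 powr (- \<eta> / 2) * ?S X powr (- \<eta> / 2)"
        by (rule mult_right_mono) (simp_all add: e_def)
      ultimately show ?thesis by simp
    next
      assume *: "e2 * (?\<delta> ^ Suc k) powr (- \<eta> / 2) \<le> T X"
      have "?\<delta> ^ card (plane ` X) \<le> ?S X"
      proof (rule Sfun_ge_power)
        fix x y assume "x \<in> plane ` X" "y \<in> plane ` X" "x \<noteq> y"
        then show "?\<delta> \<le> norm (x - y)" using close by auto
      qed (use fin X Suc.hyps in \<open>auto simp: card_plane_image\<close>)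
      then have "?S X powr (- \<eta> / 2) \<le> (?\<delta> ^ Suc k) powr (- \<eta> / 2)"
        using \<delta> eta X by (intro powr_mono2') (auto simp: card_plane_image intro!: zero_less_power simp del: power_Suc)
      then have "e * ?S X powr (- \<eta> / 2) \<le> e2 * (?\<delta> ^ Suc k) powr (- \<eta> / 2)"
        using e2 by (intro mult_mono) (simp_all add: e_def)
      then show ?thesis using * by simp
    qed
  qed
  moreover have "0 < e" unfolding e_def using e1 e2 by simp
  ultimately show ?case by blast
qed

text \<open>Removing \<open>a\<close> and removing \<open>b\<close> give two bounds for
  \<open>T X\<close>. They are multiplied, since their geometric mean reproduces the square root in
  the recursion for \<open>S\<close>.\<close>

lemma k_point_upper:
  "2 \<le> k \<Longrightarrow> \<exists>B>0. \<forall>X. card X = k \<longrightarrow> T X \<le> B * Sfun (plane ` X) powr (- \<eta> / 2)"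
proof (induction k rule: nat_induct_at_least)
  case base
  have "T X \<le> C * Sfun (plane ` X) powr (- \<eta> / 2)" if c2: "card X = 2" for X
  proof -
    obtain x y where X: "X = {x, y}" "x \<noteq> y" using c2 by (meson card_2_iff)
    then have ne: "plane x \<noteq> plane y" using inj_plane by (simp add: inj_eq)
    have "Sfun (plane ` X) powr (- \<eta> / 2) = norm (plane x - plane y) powr (- \<eta>)"
      unfolding X image_insert image_empty Sfun_pair[OF ne]
      using power_powr[of "norm (plane x - plane y)" 2 "- \<eta> / 2"]
      by (simp add: power2_eq_square flip: powr_add)
    then show ?thesis using upper[OF X(2)] unfolding X(1) by simp
  qed
  then show ?case using C_pos by blast
next
  case (Suc k)
  obtain B where B: "0 < B" "\<And>X. card X = k \<Longrightarrow> T X \<le> B * Sfun (plane ` X) powr (- \<eta> / 2)"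
    using Suc.IH by blast
  obtain A where A: "0 < A" "\<And>X b \<delta>. finite X \<Longrightarrow> b \<in> X \<Longrightarrow> X \<noteq> {b} \<Longrightarrow> 0 < \<delta> \<Longrightarrow>
     (\<forall>x\<in>X - {b}. \<delta> \<le> norm (plane b - plane x)) \<Longrightarrow> T X \<le> A * \<delta> powr (- \<eta> / 2) * T (X - {b})"
    using remove_point_power_upper by blast
  have "T X \<le> A * B * Sfun (plane ` X) powr (- \<eta> / 2)" if X: "card X = Suc k" for X
  proof -
    have fin: "finite X" using X card.infinite by force
    obtain a b where ab: "a \<in> X" "b \<in> X" "a \<noteq> b"
      and close: "\<And>x y. x \<in> X \<Longrightarrow> y \<in> X \<Longrightarrow> x \<noteq> y \<Longrightarrow> norm (plane a - plane b) \<le> norm (plane x - plane y)"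
      by (rule closest_pair[OF fin]) (use X Suc.hyps in auto)
    let ?\<delta> = "norm (plane a - plane b)" and ?S = "\<lambda>X. Sfun (plane ` X)"
    have \<delta>: "1 \<le> ?\<delta>" by (rule norm_plane_ge_1[OF ab(3)])
    have step: "T X \<le> A * B * (?\<delta> * ?S (X - {z})) powr (- \<eta> / 2) \<and> 0 < ?S (X - {z})" if z: "z \<in> X" for z
    proof -
      have cX: "card (X - {z}) = k" using X z fin by simp
      have S: "0 < ?S (X - {z})" using cX Suc.hyps fin by (auto intro!: Sfun_pos simp: card_plane_image)
      have "X \<noteq> {z}" using ab by auto
      then have "T X \<le> A * ?\<delta> powr (- \<eta> / 2) * T (X - {z})"
      proof (rule A(2)[OF fin z])
        show "\<forall>x\<in>X - {z}. ?\<delta> \<le> norm (plane z - plane x)" by (intro ballI close) (use z in auto)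
      qed (use \<delta> in linarith)
      also have "\<dots> \<le> A * ?\<delta> powr (- \<eta> / 2) * (B * ?S (X - {z}) powr (- \<eta> / 2))"
        by (rule mult_left_mono[OF B(2)[OF cX]]) (use A in simp)
      also have "\<dots> = A * B * (?\<delta> * ?S (X - {z})) powr (- \<eta> / 2)"
        using S \<delta> by (simp add: powr_mult)
      finally show ?thesis using S by blast
    qed
    have S: "0 < ?S X" using X Suc.hyps fin by (auto intro!: Sfun_pos simp: card_plane_image)
    let ?a = "plane a" and ?b = "plane b" and ?P = "plane ` X"
    have ne: "?a \<noteq> ?b" using ab(3) inj_plane by (simp add: inj_eq)
    have c3: "3 \<le> card ?P" using X Suc.hyps by (simp add: card_plane_image)
    have "?P - {?a, ?b} \<noteq> {}"
    proof
      assume "?P - {?a, ?b} = {}"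
      then have "card ?P \<le> card {?a, ?b}" by (intro card_mono) auto
      then show False using c3 by (simp add: card_insert_if split: if_splits)
    qed
    then have part: "({?a}, {?b}, ?P - {?a, ?b}) \<in> tripartitions ?P"
      unfolding tripartitions_def using ab ne by auto
    have img: "{?b} \<union> (?P - {?a, ?b}) = plane ` (X - {a})" "?P - {?a, ?b} \<union> {?a} = plane ` (X - {b})"
      using ab inj_plane by (auto simp: inj_eq)
    have "?S X \<le> sqrt (Sfun ({?a} \<union> {?b}) * ?S (X - {a}) * ?S (X - {b}))"
      using Sfun_le[OF _ c3 part] fin unfolding img by simp
    also have "Sfun ({?a} \<union> {?b}) = ?\<delta>\<^sup>2" using Sfun_pair[OF ne] by (simp add: insert_commute)
    finally have SS: "?S X \<le> sqrt (?\<delta>\<^sup>2 * ?S (X - {a}) * ?S (X - {b}))" .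
    \<comment> \<open>The factor \<open>?\<delta>\<^sup>2\<close> is shared equally, one
      \<open>?\<delta>\<close> for each of the two removals.\<close>
    let ?u = "?\<delta> * ?S (X - {a})" and ?v = "?\<delta> * ?S (X - {b})"
    have "0 < ?\<delta>" using \<delta> by linarith
    then have u: "0 < ?u" "0 < ?v"
      using step[OF ab(1)] step[OF ab(2)] by (intro mult_pos_pos; simp)+
    have "(?S X)\<^sup>2 \<le> (sqrt (?u * ?v))\<^sup>2"
      using SS S by (intro power_mono) (simp_all add: power2_eq_square mult_ac)
    then have "(?S X)\<^sup>2 \<le> ?u * ?v" using u by simp
    then have *: "(?u * ?v) powr (- \<eta> / 2) \<le> ((?S X)\<^sup>2) powr (- \<eta> / 2)"
      using S eta by (intro powr_mono2') auto
    have "(T X)\<^sup>2 \<le> (A * B * ?u powr (- \<eta> / 2)) * (A * B * ?v powr (- \<eta> / 2))"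
      unfolding power2_eq_square
      by (intro mult_mono) (use step[OF ab(1)] step[OF ab(2)] pr_nonneg A B in auto)
    also have "\<dots> = (A * B)\<^sup>2 * (?u * ?v) powr (- \<eta> / 2)"
      using u by (simp add: powr_mult power2_eq_square)
    also have "\<dots> \<le> (A * B)\<^sup>2 * ((?S X)\<^sup>2) powr (- \<eta> / 2)" by (rule mult_left_mono[OF *]) simp
    also have "\<dots> = (A * B * ?S X powr (- \<eta> / 2))\<^sup>2"
      using S by (simp add: power2_eq_square powr_mult)
    finally show ?thesis by (rule power2_le_imp_le) (use A B in simp)
  qed
  moreover have "0 < A * B" using A B by simp
  ultimately show ?case by blast
qed

end

theorem mainTheorem18:
  fixes \<eta> :: real
  assumes "\<eta> > 0"
    and "equal_up_to_consts {(x, y). x \<noteq> y}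
           (\<lambda>(x, y). \<P>(\<omega> in percolation (1/2). same_cluster \<omega> {x, y}))
           (\<lambda>(x, y). norm (plane x - plane y) powr (- \<eta>))"
  shows "\<forall>k::nat \<ge> 2.
           equal_up_to_consts {xs :: (int \<times> int) list. length xs = k \<and> distinct xs}
             (\<lambda>xs. tau (1/2) xs)
             (\<lambda>xs. Sfun (plane ` set xs) powr (- \<eta> / 2))"
proof (intro allI impI)
  fix k :: nat assume k: "2 \<le> k"
  obtain c C where "0 < c" "0 < C" and *: "\<forall>z\<in>{(x, y). x \<noteq> y}.
      c * (case z of (x, y) \<Rightarrow> norm (plane x - plane y) powr (- \<eta>)) \<le>
        (case z of (x, y) \<Rightarrow> \<P>(\<omega> in percolation (1/2). same_cluster \<omega> {x, y})) \<and>
      (case z of (x, y) \<Rightarrow> \<P>(\<omega> in percolation (1/2). same_cluster \<omega> {x, y})) \<le>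
        C * (case z of (x, y) \<Rightarrow> norm (plane x - plane y) powr (- \<eta>))"
    using assms(2) unfolding equal_up_to_consts_def by blast
  interpret power_law \<eta> c C
    by standard (use assms(1) \<open>0 < c\<close> \<open>0 < C\<close> * in \<open>auto simp: pr_def\<close>)
  obtain e B where "0 < e" "0 < B" and e: "\<And>X. card X = k \<Longrightarrow> e * Sfun (plane ` X) powr (- \<eta> / 2) \<le> T X"
    and B: "\<And>X. card X = k \<Longrightarrow> T X \<le> B * Sfun (plane ` X) powr (- \<eta> / 2)"
    using k_point_lower[OF k] k_point_upper[OF k] by blast
  show "equal_up_to_consts {xs :: (int \<times> int) list. length xs = k \<and> distinct xs}
      (\<lambda>xs. tau (1/2) xs) (\<lambda>xs. Sfun (plane ` set xs) powr (- \<eta> / 2))"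
    unfolding equal_up_to_consts_def
  proof (intro exI conjI ballI)
    fix xs :: "(int \<times> int) list" assume "xs \<in> {xs. length xs = k \<and> distinct xs}"
    then have "card (set xs) = k" by (auto simp: distinct_card)
    then show "e * Sfun (plane ` set xs) powr (- \<eta> / 2) \<le> tau (1/2) xs"
      "tau (1/2) xs \<le> B * Sfun (plane ` set xs) powr (- \<eta> / 2)"
      using e B unfolding tau_def pr_def by blast+
  qed fact+
qed

end
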